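(* Let $\otimes$ be either multiplication on $[0,1]$ or the Łukasiewicz tensor $u\otimes v=\max(0,u+v-1)$ on $[0,1]$. Then the functor $$C:\mathscr{U}\text{-}\mathsf{RepDist}_{[0,1]^{\mathrm{op}}}\longrightarrow[0,1]\text{-}\mathsf{FinSup}^{\mathrm{op}},$$ which sends $X$ to $CX=\mathscr{U}\text{-}\mathsf{Rep}(X,[0,1]^{\mathrm{op}})$ and a continuous $[0,1]$-distributor $\varphi$ from $X$ to $Y$ to $C\varphi:CY\to CX$, $C\varphi(\psi)(x)=\sup_{y\in Y}\psi(y)\otimes\varphi(x,y)$, is fully faithful.
   Context: **Enriched categories.** Let $\otimes$ be the given tensor on $[0,1]$ and $\hom(u,-)$ the right adjoint of $u\otimes-$: $u\otimes v\le w\iff v\le\hom(u,w)$. A $[0,1]$-category is a set $X$ with a map $a:X\times X\to[0,1]$ with $a(x,x)=1$ and $a(x,y)\otimes a(y,z)\le a(x,z)$. A $[0,1]$-functor $f:(X,a)\to(Y,b)$ is a map with $a(x,y)\le b(f(x),f(y))$. The natural order is $x\le y\iff a(x,y)=1$; $(X,a)$ is separated if this order is anti-symmetric. A $u$-copower of $x$ is an element $x\otimes u$ with $a(x\otimes u,y)=\hom(u,a(x,y))$ for all $y$. $(X,a)$ is finitely cocomplete if it has all colimits of weighted diagrams with finite underlying set; equivalently, it has all copowers, a bottom element, and all binary suprema in the natural order, with $a(x\vee y,z)=a(x,z)\wedge a(y,z)$ for all $z$. A map between finitely cocomplete $[0,1]$-categories is a finitely cocontinuous $[0,1]$-functor iff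 it is monotone and preserves copowers and binary suprema. $[0,1]\text{-}\mathsf{FinSup}$ is the category of separated finitely cocomplete $[0,1]$-categories and finitely cocontinuous $[0,1]$-functors. **$\mathscr{U}$-categories.** $\mathbb{U}=(U,m,e)$ is the ultrafilter monad on $\mathsf{Set}$; $\xi:U[0,1]\to[0,1]$, $\xi(\mathfrak{x})=\sup_{A\in\mathfrak{x}}\inf A$, is Euclidean convergence. For $r:X\times Y\to[0,1]$, put $U_\xi r(\mathfrak{x},\mathfrak{y})=\sup\{\xi(Ur(\mathfrak{w}))\mid\mathfrak{w}\in U(X\times Y),U\pi_1(\mathfrak{w})=\mathfrak{x},U\pi_2(\mathfrak{w})=\mathfrak{y}\}$. A $\mathscr{U}$-category is a set $X$ with a map $a:UX\times X\to[0,1]$ with $a(e_X(x),x)=1$ and $U_\xi a(\mathfrak{X},\mathfrak{x})\otimes a(\mathfrak{x},x)\le a(m_X(\mathfrak{X}),x)$. A $\mathscr{U}$-functor $f:(X,a)\to(Y,b)$ is a map with $a(\mathfrak{x},x)\le b(Uf(\mathfrak{x}),f(x))$. The underlying $[0,1]$-category is $(X,a_0)$ with $a_0(x,y)=a(e_X(x),y)$; $(X,a)$ is separated if $(X,a_0)$ is. $(X,a)$ is representable if $\sup_{\mathfrak{x}}U_\xi a(\mathfrak{X},\mathfrak{x})\otimes a(\mathfrak{x},x)=a(m_X(\mathfrak{X}),x)$ for all $\mathfrak{X},x$ and there is $\alpha:UX\to X$ with $a(\mathfrak{x},x)=a_0(\alpha(\mathfrak{x}),x)$; if $(X,a)$ is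 also separated, $\alpha$ is unique and is the convergence of a compact Hausdorff topology on $X$. $\mathscr{U}\text{-}\mathsf{Rep}$ has the separated representable $\mathscr{U}$-categories as objects; morphisms are maps that are $[0,1]$-functors $(X,a_0)\to(Y,b_0)$ and continuous for the compact Hausdorff topologies. The dual $(X,a)^{\mathrm{op}}$ keeps $\alpha$ and replaces $a_0(x,y)$ by $a_0(y,x)$. $[0,1]$ denotes the object of $\mathscr{U}\text{-}\mathsf{Rep}$ with $a_0=\hom$, $\alpha=\xi$. Hence $CX$ consists of the maps $\psi:X\to[0,1]$ continuous from the compact Hausdorff topology to the Euclidean topology with $a_0(x,y)\le\hom(\psi(y),\psi(x))$; it has pointwise operations $\vee$, $-\otimes u$, and structure $\inf_x\hom(\psi_1(x),\psi_2(x))$. **Enriched Vietoris monad and its Kleisli category.** For $X$ in $\mathscr{U}\text{-}\mathsf{Rep}$, $VX$ is the set of all $\mathscr{U}$-functors $\varphi:X\to[0,1]$ with $[0,1]$-category structure $[\varphi,\varphi']=\inf_x\hom(\varphi'(x),\varphi(x))$ and compact Hausdorff topology in which an ultrafilter $\mathfrak{p}$ on $VX$ converges to $x\mapsto\sup_{\mathfrak{x}\in UX}\big(\inf_{P\in\mathfrak{p},F\in\mathfrak{x}}\sup_{h\in P,y\in F}h(y)\big)\otimes a_0(\alpha(\mathfrak{x}),x)$; this is an object of $\mathscr{U}\text{-}\mathsf{Rep}$. A continuous $[0,1]$-distributor from $X$ to $Y$ is a map $\varphi:X\times Y\to[0,1]$ such that $x\mapsto\varphi(x,-)$ is a morphism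 $X\to VY$ in $\mathscr{U}\text{-}\mathsf{Rep}$. The composite of $\varphi$ from $X$ to $Y$ and $\varphi'$ from $Y$ to $Z$ is $(x,z)\mapsto\sup_y\varphi(x,y)\otimes\varphi'(y,z)$, and the identity on $X$ is $a_0$. $X$ is $[0,1]^{\mathrm{op}}$-cogenerated if the cone of all $\psi\in CX$ is point-separating and initial, i.e. it separates points and $a_0(x,y)=\inf_{\psi\in CX}\hom(\psi(y),\psi(x))$ for all $x,y$. $\mathscr{U}\text{-}\mathsf{RepDist}_{[0,1]^{\mathrm{op}}}$ is the category of $[0,1]^{\mathrm{op}}$-cogenerated separated representable $\mathscr{U}$-categories and continuous $[0,1]$-distributors. *)

theory Defs
  imports "HOL-Analysis.Analysis"
begin

section \<open>The quantale on the unit interval\<close>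

text \<open>Suprema and infima are taken in the complete lattice \<open>{0..1}\<close>, so that the supremum
  of the empty set is 0 and the infimum of the empty set is 1.\<close>

definition sup01 :: "real set \<Rightarrow> real" where
  "sup01 A = Sup (insert 0 A)"

definition inf01 :: "real set \<Rightarrow> real" where
  "inf01 A = Inf (insert 1 A)"

definition mult_tensor :: "real \<Rightarrow> real \<Rightarrow> real" where
  "mult_tensor u v = u * v"

definition lukasiewicz_tensor :: "real \<Rightarrow> real \<Rightarrow> real" where
  "lukasiewicz_tensor u v = max 0 (u + v - 1)"

definition hom01 :: "(real \<Rightarrow> real \<Rightarrow> real) \<Rightarrow> real \<Rightarrow> real \<Rightarrow> real" where
  "hom01 T u w = sup01 {v \<in> {0..1}. T u v \<le> w}"

lemma sup01_le_iff:
  assumes "A \<subseteq> {0..1}" "0 \<le> w"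
  shows "sup01 A \<le> w \<longleftrightarrow> (\<forall>v\<in>A. v \<le> w)"
proof -
  have "bdd_above (insert 0 A)"
    using assms(1) by (intro bdd_aboveI[of _ 1]) auto
  then show ?thesis
    unfolding sup01_def using assms(2) by (subst cSup_le_iff) auto
qed

lemma sup01_upper:
  assumes "A \<subseteq> {0..1}" "v \<in> A"
  shows "v \<le> sup01 A"
proof -
  have "bdd_above (insert 0 A)"
    using assms(1) by (intro bdd_aboveI[of _ 1]) auto
  then show ?thesis
    unfolding sup01_def using assms(2) by (intro cSup_upper) auto
qed

lemma hom01_mult:
  assumes "u \<in> {0..1}" "w \<in> {0..1}"
  shows "hom01 mult_tensor u w = (if u \<le> w then 1 else w / u)"
proof (rule antisym)
  show "hom01 mult_tensor u w \<le> (if u \<le> w then 1 else w / u)"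
    unfolding hom01_def using assms
    by (subst sup01_le_iff) (auto simp: mult_tensor_def field_simps)
  show "(if u \<le> w then 1 else w / u) \<le> hom01 mult_tensor u w"
    unfolding hom01_def using assms
    by (intro sup01_upper) (auto simp: mult_tensor_def field_simps)
qed

lemma hom01_lukasiewicz:
  assumes "u \<in> {0..1}" "w \<in> {0..1}"
  shows "hom01 lukasiewicz_tensor u w = min 1 (1 - u + w)"
proof (rule antisym)
  show "hom01 lukasiewicz_tensor u w \<le> min 1 (1 - u + w)"
    unfolding hom01_def using assms
    by (subst sup01_le_iff) (auto simp: lukasiewicz_tensor_def)
  show "min 1 (1 - u + w) \<le> hom01 lukasiewicz_tensor u w"
    unfolding hom01_def using assms
    by (intro sup01_upper) (auto simp: lukasiewicz_tensor_def)
qed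

lemma hom01_adjunction:
  assumes "T = mult_tensor \<or> T = lukasiewicz_tensor"
    and "u \<in> {0..1}" "v \<in> {0..1}" "w \<in> {0..1}"
  shows "T u v \<le> w \<longleftrightarrow> v \<le> hom01 T u w"
  using assms(1)
proof
  assume T: "T = mult_tensor"
  have "u * v \<le> w" if "u \<le> w"
    using that assms mult_left_le[of v u] by auto
  then show ?thesis
    using assms by (auto simp: T hom01_mult mult_tensor_def field_simps)
next
  assume "T = lukasiewicz_tensor"
  then show ?thesis
    using assms by (auto simp: hom01_lukasiewicz lukasiewicz_tensor_def)
qed

section \<open>Categories enriched in the unit interval\<close>

record 'a vcat =
  car :: "'a set"
  ar :: "'a \<Rightarrow> 'a \<Rightarrow> real"

definition vcategory :: "(real \<Rightarrow> real \<Rightarrow> real) \<Rightarrow> 'a vcat \<Rightarrow> bool" where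
  "vcategory T A \<longleftrightarrow>
     (\<forall>x\<in>car A. \<forall>y\<in>car A. ar A x y \<in> {0..1}) \<and>
     (\<forall>x\<in>car A. ar A x x = 1) \<and>
     (\<forall>x\<in>car A. \<forall>y\<in>car A. \<forall>z\<in>car A. T (ar A x y) (ar A y z) \<le> ar A x z)"

definition vfunctor :: "'a vcat \<Rightarrow> 'b vcat \<Rightarrow> ('a \<Rightarrow> 'b) \<Rightarrow> bool" where
  "vfunctor A B f \<longleftrightarrow>
     f \<in> car A \<rightarrow> car B \<and> (\<forall>x\<in>car A. \<forall>y\<in>car A. ar A x y \<le> ar B (f x) (f y))"

definition vseparated :: "'a vcat \<Rightarrow> bool" where
  "vseparated A \<longleftrightarrow>
     (\<forall>x\<in>car A. \<forall>y\<in>car A. ar A x y = 1 \<and> ar A y x = 1 \<longrightarrow> x = y)"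

text \<open>A finite weighted diagram in \<open>A\<close>: a functor \<open>h : I \<rightarrow> A\<close> from a finite category together
  with a weight, that is, a functor \<open>w\<close> from the opposite of \<open>I\<close> to the unit interval. Up to
  isomorphism, the points of a finite category are natural numbers.\<close>

definition finite_weighted_diagram ::
  "(real \<Rightarrow> real \<Rightarrow> real) \<Rightarrow> nat vcat \<Rightarrow> (nat \<Rightarrow> 'a) \<Rightarrow> (nat \<Rightarrow> real) \<Rightarrow> 'a vcat \<Rightarrow> bool" where
  "finite_weighted_diagram T I h w A \<longleftrightarrow>
     vcategory T I \<and> finite (car I) \<and> vfunctor I A h \<and> w \<in> car I \<rightarrow> {0..1} \<and>
     (\<forall>i\<in>car I. \<forall>j\<in>car I. ar I i j \<le> hom01 T (w j) (w i))"

definition is_colimit ::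
  "(real \<Rightarrow> real \<Rightarrow> real) \<Rightarrow> nat vcat \<Rightarrow> (nat \<Rightarrow> 'a) \<Rightarrow> (nat \<Rightarrow> real) \<Rightarrow> 'a vcat \<Rightarrow> 'a \<Rightarrow> bool" where
  "is_colimit T I h w A c \<longleftrightarrow>
     c \<in> car A \<and>
     (\<forall>y\<in>car A. ar A c y = inf01 ((\<lambda>i. hom01 T (w i) (ar A (h i) y)) ` car I))"

definition finitely_cocomplete :: "(real \<Rightarrow> real \<Rightarrow> real) \<Rightarrow> 'a vcat \<Rightarrow> bool" where
  "finitely_cocomplete T A \<longleftrightarrow>
     (\<forall>I h w. finite_weighted_diagram T I h w A \<longrightarrow> (\<exists>c. is_colimit T I h w A c))"

definition finitely_cocontinuous ::
  "(real \<Rightarrow> real \<Rightarrow> real) \<Rightarrow> 'a vcat \<Rightarrow> 'b vcat \<Rightarrow> ('a \<Rightarrow> 'b) \<Rightarrow> bool" where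
  "finitely_cocontinuous T A B f \<longleftrightarrow>
     vfunctor A B f \<and>
     (\<forall>I h w c. finite_weighted_diagram T I h w A \<and> is_colimit T I h w A c \<longrightarrow>
        is_colimit T I (f \<circ> h) w B (f c))"

section \<open>The ultrafilter monad\<close>

definition is_ultrafilter :: "'a filter \<Rightarrow> bool" where
  "is_ultrafilter F \<longleftrightarrow>
     F \<noteq> bot \<and> (\<forall>P. eventually P F \<or> eventually (\<lambda>x. \<not> P x) F)"

abbreviation mem_filter :: "'a set \<Rightarrow> 'a filter \<Rightarrow> bool" where
  "mem_filter A F \<equiv> eventually (\<lambda>x. x \<in> A) F"

text \<open>The ultrafilters on a subset \<open>X\<close> of a type are the ultrafilters on the type containing
  \<open>X\<close>. The functor sends \<open>f\<close> to \<^const>\<open>filtermap\<close> \<open>f\<close>.\<close>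

definition ultrafilters :: "'a set \<Rightarrow> 'a filter set" where
  "ultrafilters X = {F. is_ultrafilter F \<and> mem_filter X F}"

definition ultra_unit :: "'a \<Rightarrow> 'a filter" where
  "ultra_unit x = principal {x}"

definition ultra_mult :: "'a filter filter \<Rightarrow> 'a filter" where
  "ultra_mult \<XX> = Abs_filter (\<lambda>P. eventually (\<lambda>F. eventually P F) \<XX>)"

lemma eventually_ultra_mult:
  "eventually P (ultra_mult \<XX>) \<longleftrightarrow> eventually (\<lambda>F. eventually P F) \<XX>"
  unfolding ultra_mult_def
proof (rule eventually_Abs_filter, rule is_filter.intro)
  show "\<forall>\<^sub>F F in \<XX>. \<forall>\<^sub>F x in F. Q x \<and> R x"
    if "\<forall>\<^sub>F F in \<XX>. eventually Q F" "\<forall>\<^sub>F F in \<XX>. eventually R F" for Q R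
    using that by eventually_elim (rule eventually_conj)
  show "\<forall>\<^sub>F F in \<XX>. eventually R F"
    if "\<forall>x. Q x \<longrightarrow> R x" "\<forall>\<^sub>F F in \<XX>. eventually Q F" for Q R
    using that(2) by eventually_elim (use that(1) in \<open>auto elim: eventually_mono\<close>)
qed (intro always_eventually allI TrueI)

definition xi :: "real filter \<Rightarrow> real" where
  "xi \<xx> = sup01 {Inf A | A. A \<subseteq> {0..1} \<and> mem_filter A \<xx>}"

definition ultra_ext ::
  "'a set \<Rightarrow> 'b set \<Rightarrow> ('a \<Rightarrow> 'b \<Rightarrow> real) \<Rightarrow> 'a filter \<Rightarrow> 'b filter \<Rightarrow> real" where
  "ultra_ext X Y r \<xx> \<yy> =
     sup01 {xi (filtermap (\<lambda>(x, y). r x y) \<ww>) | \<ww>.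
       \<ww> \<in> ultrafilters (X \<times> Y) \<and> filtermap fst \<ww> = \<xx> \<and> filtermap snd \<ww> = \<yy>}"

section \<open>Ultrafilter-enriched categories\<close>

record 'a ucat =
  ucar :: "'a set"
  uar :: "'a filter \<Rightarrow> 'a \<Rightarrow> real"

definition ucategory :: "(real \<Rightarrow> real \<Rightarrow> real) \<Rightarrow> 'a ucat \<Rightarrow> bool" where
  "ucategory T X \<longleftrightarrow>
     (\<forall>\<xx>\<in>ultrafilters (ucar X). \<forall>x\<in>ucar X. uar X \<xx> x \<in> {0..1}) \<and>
     (\<forall>x\<in>ucar X. uar X (ultra_unit x) x = 1) \<and>
     (\<forall>\<XX>\<in>ultrafilters (ultrafilters (ucar X)). \<forall>\<xx>\<in>ultrafilters (ucar X). \<forall>x\<in>ucar X.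
        T (ultra_ext (ultrafilters (ucar X)) (ucar X) (uar X) \<XX> \<xx>) (uar X \<xx> x)
          \<le> uar X (ultra_mult \<XX>) x)"

definition ufunctor :: "'a ucat \<Rightarrow> 'b ucat \<Rightarrow> ('a \<Rightarrow> 'b) \<Rightarrow> bool" where
  "ufunctor X Y f \<longleftrightarrow>
     f \<in> ucar X \<rightarrow> ucar Y \<and>
     (\<forall>\<xx>\<in>ultrafilters (ucar X). \<forall>x\<in>ucar X. uar X \<xx> x \<le> uar Y (filtermap f \<xx>) (f x))"

definition underlying :: "'a ucat \<Rightarrow> 'a vcat" where
  "underlying X = \<lparr>car = ucar X, ar = (\<lambda>x y. uar X (ultra_unit x) y)\<rparr>"

abbreviation uar0 :: "'a ucat \<Rightarrow> 'a \<Rightarrow> 'a \<Rightarrow> real" where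
  "uar0 X \<equiv> ar (underlying X)"

definition representable :: "(real \<Rightarrow> real \<Rightarrow> real) \<Rightarrow> 'a ucat \<Rightarrow> bool" where
  "representable T X \<longleftrightarrow>
     (\<forall>\<XX>\<in>ultrafilters (ultrafilters (ucar X)). \<forall>x\<in>ucar X.
        sup01 ((\<lambda>\<xx>. T (ultra_ext (ultrafilters (ucar X)) (ucar X) (uar X) \<XX> \<xx>) (uar X \<xx> x))
                 ` ultrafilters (ucar X))
          = uar X (ultra_mult \<XX>) x) \<and>
     (\<exists>\<alpha>\<in>ultrafilters (ucar X) \<rightarrow> ucar X.
        \<forall>\<xx>\<in>ultrafilters (ucar X). \<forall>x\<in>ucar X. uar X \<xx> x = uar0 X (\<alpha> \<xx>) x)"

definition rep_obj :: "(real \<Rightarrow> real \<Rightarrow> real) \<Rightarrow> 'a ucat \<Rightarrow> bool" where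
  "rep_obj T X \<longleftrightarrow> ucategory T X \<and> vseparated (underlying X) \<and> representable T X"

text \<open>The map \<open>\<alpha>\<close> witnessing representability, which is unique by separatedness.\<close>

definition conv :: "'a ucat \<Rightarrow> 'a filter \<Rightarrow> 'a" where
  "conv X \<xx> = (THE z. z \<in> ucar X \<and> (\<forall>x\<in>ucar X. uar X \<xx> x = uar0 X z x))"

text \<open>The topology with ultrafilter convergence \<^const>\<open>conv\<close>: a set is open iff it belongs to
  every ultrafilter converging to one of its points.\<close>

definition conv_topology :: "'a ucat \<Rightarrow> 'a topology" where
  "conv_topology X = topology (\<lambda>A. A \<subseteq> ucar X \<and>
     (\<forall>\<xx>\<in>ultrafilters (ucar X). conv X \<xx> \<in> A \<longrightarrow> mem_filter A \<xx>))"

lemma openin_conv_topology: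
  "openin (conv_topology X) A \<longleftrightarrow>
     A \<subseteq> ucar X \<and> (\<forall>\<xx>\<in>ultrafilters (ucar X). conv X \<xx> \<in> A \<longrightarrow> mem_filter A \<xx>)"
proof -
  let ?op = "\<lambda>A. A \<subseteq> ucar X \<and>
    (\<forall>\<xx>\<in>ultrafilters (ucar X). conv X \<xx> \<in> A \<longrightarrow> mem_filter A \<xx>)"
  have "istopology ?op"
    unfolding istopology_def
  proof (intro conjI allI impI)
    fix A B assume "?op A" "?op B"
    then show "A \<inter> B \<subseteq> ucar X"
      "\<forall>\<xx>\<in>ultrafilters (ucar X). conv X \<xx> \<in> A \<inter> B \<longrightarrow> mem_filter (A \<inter> B) \<xx>"
      by (auto intro: eventually_conj)
  next
    fix \<K> assume K: "\<forall>K\<in>\<K>. ?op K"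
    then show "\<Union>\<K> \<subseteq> ucar X" by blast
    show "\<forall>\<xx>\<in>ultrafilters (ucar X). conv X \<xx> \<in> \<Union>\<K> \<longrightarrow> mem_filter (\<Union>\<K>) \<xx>"
    proof (intro ballI impI)
      fix \<xx> assume x: "\<xx> \<in> ultrafilters (ucar X)" "conv X \<xx> \<in> \<Union>\<K>"
      then obtain K where "K \<in> \<K>" "mem_filter K \<xx>" using K by blast
      then show "mem_filter (\<Union>\<K>) \<xx>" by (auto elim: eventually_mono)
    qed
  qed
  then show ?thesis by (simp add: conv_topology_def topology_inverse')
qed

text \<open>Morphisms are represented by functions that are \<^const>\<open>undefined\<close> outside the carrier of
  their domain.\<close>

definition rep_hom :: "'a ucat \<Rightarrow> 'b ucat \<Rightarrow> ('a \<Rightarrow> 'b) set" where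
  "rep_hom X Y = {f \<in> ucar X \<rightarrow>\<^sub>E ucar Y.
     vfunctor (underlying X) (underlying Y) f \<and>
     continuous_map (conv_topology X) (conv_topology Y) f}"

definition dual :: "'a ucat \<Rightarrow> 'a ucat" where
  "dual X = \<lparr>ucar = ucar X, uar = (\<lambda>\<xx> x. uar0 X x (conv X \<xx>))\<rparr>"

definition unit_ucat :: "(real \<Rightarrow> real \<Rightarrow> real) \<Rightarrow> real ucat" where
  "unit_ucat T = \<lparr>ucar = {0..1}, uar = (\<lambda>\<xx> x. hom01 T (xi \<xx>) x)\<rparr>"

section \<open>The enriched Vietoris construction and continuous distributors\<close>

definition vietoris_car :: "(real \<Rightarrow> real \<Rightarrow> real) \<Rightarrow> 'a ucat \<Rightarrow> ('a \<Rightarrow> real) set" where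
  "vietoris_car T X = {\<phi> \<in> ucar X \<rightarrow>\<^sub>E {0..1}. ufunctor X (unit_ucat T) \<phi>}"

definition vietoris_conv ::
  "(real \<Rightarrow> real \<Rightarrow> real) \<Rightarrow> 'a ucat \<Rightarrow> ('a \<Rightarrow> real) filter \<Rightarrow> 'a \<Rightarrow> real" where
  "vietoris_conv T X \<pp> = (\<lambda>x\<in>ucar X. sup01 ((\<lambda>\<xx>.
     T (inf01 {sup01 {h y | h y. h \<in> P \<and> y \<in> F} | P F.
                 P \<subseteq> vietoris_car T X \<and> mem_filter P \<pp> \<and> F \<subseteq> ucar X \<and> mem_filter F \<xx>})
       (uar0 X (conv X \<xx>) x)) ` ultrafilters (ucar X)))"

text \<open>A separated representable object is determined by its underlying category \<open>a\<^sub>0\<close> and its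
  convergence \<open>\<alpha>\<close>, with structure \<open>a \<xx> x = a\<^sub>0 (\<alpha> \<xx>) x\<close>.\<close>

definition vietoris :: "(real \<Rightarrow> real \<Rightarrow> real) \<Rightarrow> 'a ucat \<Rightarrow> ('a \<Rightarrow> real) ucat" where
  "vietoris T X = \<lparr>ucar = vietoris_car T X,
     uar = (\<lambda>\<pp> \<phi>. inf01 ((\<lambda>x. hom01 T (\<phi> x) (vietoris_conv T X \<pp> x)) ` ucar X))\<rparr>"

text \<open>A distributor from \<open>X\<close> to \<open>Y\<close> is represented in curried form.\<close>

definition cont_distributors ::
  "(real \<Rightarrow> real \<Rightarrow> real) \<Rightarrow> 'a ucat \<Rightarrow> 'b ucat \<Rightarrow> ('a \<Rightarrow> 'b \<Rightarrow> real) set" where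
  "cont_distributors T X Y = rep_hom X (vietoris T Y)"

definition dist_id :: "'a ucat \<Rightarrow> 'a \<Rightarrow> 'a \<Rightarrow> real" where
  "dist_id X = (\<lambda>x\<in>ucar X. \<lambda>y\<in>ucar X. uar0 X x y)"

definition dist_comp ::
  "(real \<Rightarrow> real \<Rightarrow> real) \<Rightarrow> 'a ucat \<Rightarrow> 'b ucat \<Rightarrow> 'c ucat \<Rightarrow>
     ('a \<Rightarrow> 'b \<Rightarrow> real) \<Rightarrow> ('b \<Rightarrow> 'c \<Rightarrow> real) \<Rightarrow> 'a \<Rightarrow> 'c \<Rightarrow> real" where
  "dist_comp T X Y Z \<phi> \<phi>' =
     (\<lambda>x\<in>ucar X. \<lambda>z\<in>ucar Z. sup01 ((\<lambda>y. T (\<phi> x y) (\<phi>' y z)) ` ucar Y))"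

definition C_obj :: "(real \<Rightarrow> real \<Rightarrow> real) \<Rightarrow> 'a ucat \<Rightarrow> ('a \<Rightarrow> real) vcat" where
  "C_obj T X = \<lparr>car = rep_hom X (dual (unit_ucat T)),
     ar = (\<lambda>\<psi>1 \<psi>2. inf01 ((\<lambda>x. hom01 T (\<psi>1 x) (\<psi>2 x)) ` ucar X))\<rparr>"

definition cogenerated :: "(real \<Rightarrow> real \<Rightarrow> real) \<Rightarrow> 'a ucat \<Rightarrow> bool" where
  "cogenerated T X \<longleftrightarrow>
     (\<forall>x\<in>ucar X. \<forall>y\<in>ucar X. x \<noteq> y \<longrightarrow> (\<exists>\<psi>\<in>car (C_obj T X). \<psi> x \<noteq> \<psi> y)) \<and>
     (\<forall>x\<in>ucar X. \<forall>y\<in>ucar X.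
        uar0 X x y = inf01 ((\<lambda>\<psi>. hom01 T (\<psi> y) (\<psi> x)) ` car (C_obj T X)))"

definition C_mor ::
  "(real \<Rightarrow> real \<Rightarrow> real) \<Rightarrow> 'a ucat \<Rightarrow> 'b ucat \<Rightarrow> ('a \<Rightarrow> 'b \<Rightarrow> real) \<Rightarrow> ('b \<Rightarrow> real) \<Rightarrow> 'a \<Rightarrow> real" where
  "C_mor T X Y \<phi> =
     (\<lambda>\<psi>\<in>car (C_obj T Y). \<lambda>x\<in>ucar X. sup01 ((\<lambda>y. T (\<psi> y) (\<phi> x y)) ` ucar Y))"

section \<open>Categories and functors\<close>

text \<open>Hom-sets are indexed by pairs of objects and need not be disjoint.
  \<open>Comp C X Y Z f g\<close> is the composite of \<open>f : X \<rightarrow> Y\<close> followed by \<open>g : Y \<rightarrow> Z\<close>.\<close>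

record ('o, 'm) category =
  Obj :: "'o set"
  Hom :: "'o \<Rightarrow> 'o \<Rightarrow> 'm set"
  Ident :: "'o \<Rightarrow> 'm"
  Comp :: "'o \<Rightarrow> 'o \<Rightarrow> 'o \<Rightarrow> 'm \<Rightarrow> 'm \<Rightarrow> 'm"

definition is_category :: "('o, 'm) category \<Rightarrow> bool" where
  "is_category C \<longleftrightarrow>
     (\<forall>X\<in>Obj C. Ident C X \<in> Hom C X X) \<and>
     (\<forall>X\<in>Obj C. \<forall>Y\<in>Obj C. \<forall>Z\<in>Obj C. \<forall>f\<in>Hom C X Y. \<forall>g\<in>Hom C Y Z.
        Comp C X Y Z f g \<in> Hom C X Z) \<and>
     (\<forall>X\<in>Obj C. \<forall>Y\<in>Obj C. \<forall>f\<in>Hom C X Y.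
        Comp C X X Y (Ident C X) f = f \<and> Comp C X Y Y f (Ident C Y) = f) \<and>
     (\<forall>W\<in>Obj C. \<forall>X\<in>Obj C. \<forall>Y\<in>Obj C. \<forall>Z\<in>Obj C.
        \<forall>f\<in>Hom C W X. \<forall>g\<in>Hom C X Y. \<forall>h\<in>Hom C Y Z.
        Comp C W Y Z (Comp C W X Y f g) h = Comp C W X Z f (Comp C X Y Z g h))"

definition op_category :: "('o, 'm) category \<Rightarrow> ('o, 'm) category" where
  "op_category C = \<lparr>Obj = Obj C, Hom = (\<lambda>X Y. Hom C Y X), Ident = Ident C,
     Comp = (\<lambda>X Y Z f g. Comp C Z Y X g f)\<rparr>"

definition is_functor ::
  "('o, 'm) category \<Rightarrow> ('p, 'n) category \<Rightarrow> ('o \<Rightarrow> 'p) \<Rightarrow> ('o \<Rightarrow> 'o \<Rightarrow> 'm \<Rightarrow> 'n) \<Rightarrow> bool" where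
  "is_functor C D F0 F1 \<longleftrightarrow>
     is_category C \<and> is_category D \<and>
     F0 \<in> Obj C \<rightarrow> Obj D \<and>
     (\<forall>X\<in>Obj C. \<forall>Y\<in>Obj C. F1 X Y \<in> Hom C X Y \<rightarrow> Hom D (F0 X) (F0 Y)) \<and>
     (\<forall>X\<in>Obj C. F1 X X (Ident C X) = Ident D (F0 X)) \<and>
     (\<forall>X\<in>Obj C. \<forall>Y\<in>Obj C. \<forall>Z\<in>Obj C. \<forall>f\<in>Hom C X Y. \<forall>g\<in>Hom C Y Z.
        F1 X Z (Comp C X Y Z f g) = Comp D (F0 X) (F0 Y) (F0 Z) (F1 X Y f) (F1 Y Z g))"

definition fully_faithful_functor ::
  "('o, 'm) category \<Rightarrow> ('p, 'n) category \<Rightarrow> ('o \<Rightarrow> 'p) \<Rightarrow> ('o \<Rightarrow> 'o \<Rightarrow> 'm \<Rightarrow> 'n) \<Rightarrow> bool" where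
  "fully_faithful_functor C D F0 F1 \<longleftrightarrow>
     is_functor C D F0 F1 \<and>
     (\<forall>X\<in>Obj C. \<forall>Y\<in>Obj C. bij_betw (F1 X Y) (Hom C X Y) (Hom D (F0 X) (F0 Y)))"

definition RepDist ::
  "(real \<Rightarrow> real \<Rightarrow> real) \<Rightarrow> ('a ucat, 'a \<Rightarrow> 'a \<Rightarrow> real) category" where
  "RepDist T = \<lparr>Obj = {X. rep_obj T X \<and> cogenerated T X},
     Hom = cont_distributors T, Ident = dist_id, Comp = dist_comp T\<rparr>"

definition FinSup :: "(real \<Rightarrow> real \<Rightarrow> real) \<Rightarrow> ('a vcat, 'a \<Rightarrow> 'a) category" where
  "FinSup T = \<lparr>Obj = {A. vcategory T A \<and> vseparated A \<and> finitely_cocomplete T A},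
     Hom = (\<lambda>A B. {f \<in> car A \<rightarrow>\<^sub>E car B. finitely_cocontinuous T A B f}),
     Ident = (\<lambda>A. \<lambda>x\<in>car A. x),
     Comp = (\<lambda>A B D f g. compose (car A) g f)\<rparr>"

end

theory Submission
  imports Defs
begin

text \<open>An object \<open>X\<close> is recovered from \<open>CX\<close> by a Riesz-type duality. A map \<open>h\<close> in \<open>VX\<close> acts on \<open>CX\<close>
  by \<open>\<psi> \<mapsto> sup\<^sub>x \<psi> x \<otimes> h x\<close>, which is linear: it preserves copowers and binary suprema. Conversely, a
  linear functional \<open>\<Phi>\<close> is represented by the map \<open>x \<mapsto> inf\<^sub>\<psi> hom (\<psi> x) (\<Phi> \<psi>)\<close>. That both passages are
  mutually inverse rests on compactness in the following form: a property of subsets that is inherited by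
  subsets and binary unions holds for the whole set as soon as every ultrafilter contains a set with
  this property. Only closure of \<open>CX\<close> under \<open>min\<close>, \<open>max\<close>, \<open>u \<otimes> -\<close> and \<open>hom u -\<close> is needed, the last of
  which uses that \<open>hom u\<close> is continuous for both tensors.

  The limit of an ultrafilter \<open>\<pp>\<close> on \<open>VX\<close> represents the pointwise limit of the functionals along \<open>\<pp>\<close>.
  Hence a distributor is the same as a family of linear functionals on \<open>CY\<close> that yields a
  map \<open>CY \<rightarrow> CX\<close>, and this correspondence is full faithfulness.\<close>

section \<open>Ultrafilters\<close>

text \<open>Members of VX are in general only upper semicontinuous, so their behaviour at the limit
  of an ultrafilter has to be controlled by test functions from CX. What makes these flexible is
  \<open>hom\<close>: for \<psi> in CX the map \<open>hom (\<psi> x) (\<psi> z)\<close> in z has the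
  value 1 at x, and a linear \<Phi> takes on it at most the value
  \<open>hom (\<psi> x) (\<Phi> \<psi>)\<close>. Hence the infimum defining the representing map can
  be taken over test functions with value 1 at x, and this normalization survives
  \<open>min\<close>. In each compactness argument the property of a set W says that a single test
  function does its job on all of W; a union is then handled by \<open>max\<close> or
  \<open>min\<close>, and the local case by continuity of a test function at the limit.

  That h in VX is recovered from its functional is read off from the limit formula in VX at the
  principal ultrafilter of h. The laws of the category of distributors are likewise not computed
  with suprema but pulled back along the faithful passage to maps between the CX.\<close>

lemma ultrafilter_below:
  fixes F :: "'a filter"
  assumes "F \<noteq> bot"
  obtains G where "G \<le> F" "is_ultrafilter G"
proof -
  let ?A = "{G. G \<le> F \<and> G \<noteq> bot}"
  let ?P = "\<lambda>G H :: 'a filter. H \<le> G"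
  have "\<exists>m\<in>?A. \<forall>a\<in>?A. ?P m a \<longrightarrow> a = m"
  \<comment> \<open>In the filter order \<open>H \<le> G\<close> says that H is finer, so the
    relation is reversed and a maximal element is a finest proper filter. A chain is bounded by its
    infimum, which is proper because an eventual falsehood would already occur in a member of the
    chain.\<close>
  proof (rule predicate_Zorn)
    show "partial_order_on ?A (relation_of ?P ?A)"
      by (rule partial_order_on_relation_ofI) auto
  next
    fix C assume C: "C \<in> Chains (relation_of ?P ?A)"
    have sub: "C \<subseteq> ?A" and tot: "\<And>G H. G \<in> C \<Longrightarrow> H \<in> C \<Longrightarrow> G \<le> H \<or> H \<le> G"
      using C by (auto simp: Chains_def relation_of_def)
    show "\<exists>u\<in>?A. \<forall>a\<in>C. ?P a u"
    proof (cases "C = {}")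
      case True
      then show ?thesis using assms by auto
    next
      case False
      have "Inf C \<noteq> bot"
      proof
        assume "Inf C = bot"
        then have "eventually (\<lambda>_. False) (Inf C)" by simp
        moreover have "\<exists>x\<in>C. x \<le> inf G H" if "G \<in> C" "H \<in> C" for G H
          using tot[OF that] that by (metis inf.absorb1 inf.absorb2 order_refl)
        ultimately obtain b where "b \<in> C" "eventually (\<lambda>_. False) b"
          by (subst (asm) eventually_Inf_base[OF False]) auto
        then show False using sub by (auto simp: trivial_limit_def)
      qed
      moreover have "Inf C \<le> F" using False sub by (metis (mono_tags, lifting) Inf_lower2 ex_in_conv mem_Collect_eq subset_iff)
      ultimately show ?thesis by (intro bexI[of _ "Inf C"]) (auto intro: Inf_lower)
    qed
  qed
  then obtain M where M: "M \<le> F" "M \<noteq> bot"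
    and max: "\<And>G. G \<le> F \<Longrightarrow> G \<noteq> bot \<Longrightarrow> G \<le> M \<Longrightarrow> G = M"
    by auto
  have "eventually P M \<or> eventually (\<lambda>x. \<not> P x) M" for P
  proof (cases "inf M (principal {x. \<not> P x}) = bot")
    case True
    then have "eventually (\<lambda>_. False) (inf M (principal {x. \<not> P x}))" by simp
    then have "eventually P M" by (simp add: eventually_inf_principal)
    then show ?thesis by simp
  next
    case False
    have "inf M (principal {x. \<not> P x}) = M"
      by (rule max) (use False M in \<open>auto intro: le_infI1\<close>)
    moreover have "eventually (\<lambda>x. \<not> P x) (inf M (principal {x. \<not> P x}))"
      by (simp add: eventually_inf_principal)
    ultimately show ?thesis by simp
  qed
  then show ?thesis using that M by (auto simp: is_ultrafilter_def)
qed

text \<open>If \<open>Q W\<close> failed, the complements in \<open>W\<close> of the sets satisfying \<open>Q\<close> would form a proper filter,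
  and an ultrafilter refining it would contain no such set.\<close>

lemma ultrafilter_cover:
  assumes empty: "Q {}"
    and union: "\<And>A B. Q A \<Longrightarrow> Q B \<Longrightarrow> Q (A \<union> B)"
    and subset: "\<And>A B. Q A \<Longrightarrow> B \<subseteq> A \<Longrightarrow> Q B"
    and local: "\<And>F. F \<in> ultrafilters W \<Longrightarrow> \<exists>A. Q A \<and> mem_filter A F"
  shows "Q W"
proof (rule ccontr)
  assume W: "\<not> Q W"
  define G where "G = Abs_filter (\<lambda>P. Q {x\<in>W. \<not> P x})"
  have ev: "eventually P G \<longleftrightarrow> Q {x\<in>W. \<not> P x}" for P
    unfolding G_def
  proof (rule eventually_Abs_filter, rule is_filter.intro)
    show "Q {x\<in>W. \<not> True}" using empty by simp
    show "Q {x \<in> W. \<not> (R x \<and> S x)}" if "Q {x \<in> W. \<not> R x}" "Q {x \<in> W. \<not> S x}" for R S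
      by (rule subset[OF union[OF that]]) auto
    show "Q {x \<in> W. \<not> S x}" if "\<forall>x. R x \<longrightarrow> S x" "Q {x \<in> W. \<not> R x}" for R S
      by (rule subset[OF that(2)]) (use that(1) in auto)
  qed
  have "G \<noteq> bot" using W by (simp add: trivial_limit_def ev)
  then obtain F where F: "F \<le> G" "is_ultrafilter F" by (rule ultrafilter_below)
  have "mem_filter W G" using empty by (simp add: ev)
  then have "F \<in> ultrafilters W" using F by (auto simp: ultrafilters_def dest: filter_leD)
  then obtain A where A: "Q A" "mem_filter A F" using local by blast
  have "eventually (\<lambda>x. x \<notin> A) G"
    unfolding ev by (rule subset[OF A(1)]) auto
  then have "eventually (\<lambda>x. x \<notin> A) F" using F(1) by (rule filter_leD[rotated])
  with A(2) have "eventually (\<lambda>x. False) F" by eventually_elim simp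
  then show False using F(2) by (simp add: is_ultrafilter_def)
qed

lemma ultrafilters_filtermap:
  assumes "\<xx> \<in> ultrafilters X" "\<And>x. x \<in> X \<Longrightarrow> f x \<in> Y"
  shows "filtermap f \<xx> \<in> ultrafilters Y"
  using assms
  by (auto simp: ultrafilters_def is_ultrafilter_def eventually_filtermap filtermap_bot_iff
      elim: eventually_mono)

lemma ultrafilters_unit: "x \<in> X \<Longrightarrow> ultra_unit x \<in> ultrafilters X"
  by (auto simp: ultrafilters_def is_ultrafilter_def ultra_unit_def eventually_principal
      principal_eq_bot_iff)

lemma filtermap_ultra_unit: "filtermap f (ultra_unit x) = ultra_unit (f x)"
  by (simp add: ultra_unit_def filtermap_principal)

lemma ultrafilters_D:
  assumes "\<xx> \<in> ultrafilters X"
  shows "\<xx> \<noteq> bot" "mem_filter X \<xx>"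
  using assms by (auto simp: ultrafilters_def is_ultrafilter_def)

section \<open>Suprema and infima in the unit interval\<close>

lemma sup01_range: "A \<subseteq> {0..1} \<Longrightarrow> sup01 A \<in> {0..1}"
proof -
  assume A: "A \<subseteq> {0..1}"
  have "bdd_above (insert 0 A)" using A by (intro bdd_aboveI[of _ 1]) auto
  then have "0 \<le> sup01 A" unfolding sup01_def by (intro cSup_upper) auto
  moreover have "sup01 A \<le> 1" using A by (subst sup01_le_iff) auto
  ultimately show ?thesis by simp
qed

lemma less_sup01D:
  assumes "A \<subseteq> {0..1}" "0 \<le> w" "w < sup01 A"
  shows "\<exists>v\<in>A. w < v"
  using sup01_le_iff[OF assms(1,2)] assms(3) by (meson not_le)

lemma le_inf01_iff:
  assumes "A \<subseteq> {0..1}" "w \<le> 1"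
  shows "w \<le> inf01 A \<longleftrightarrow> (\<forall>v\<in>A. w \<le> v)"
proof -
  have "bdd_below (insert 1 A)" using assms by (intro bdd_belowI[of _ 0]) auto
  then show ?thesis unfolding inf01_def using assms by (subst le_cInf_iff) auto
qed

lemma inf01_lower:
  assumes "A \<subseteq> {0..1}" "v \<in> A"
  shows "inf01 A \<le> v"
proof -
  have "bdd_below (insert 1 A)" using assms by (intro bdd_belowI[of _ 0]) auto
  then show ?thesis unfolding inf01_def using assms by (intro cInf_lower) auto
qed

lemma inf01_range: "A \<subseteq> {0..1} \<Longrightarrow> inf01 A \<in> {0..1}"
proof -
  assume A: "A \<subseteq> {0..1}"
  have "bdd_below (insert 1 A)" using A by (intro bdd_belowI[of _ 0]) auto
  then have "inf01 A \<le> 1" unfolding inf01_def by (intro cInf_lower) auto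
  moreover have "0 \<le> inf01 A" using A by (subst le_inf01_iff) auto
  ultimately show ?thesis by simp
qed

lemma inf01_less_iff:
  assumes "A \<subseteq> {0..1}"
  shows "inf01 A < w \<longleftrightarrow> 1 < w \<or> (\<exists>v\<in>A. v < w)"
proof -
  have "inf01 A < w \<longleftrightarrow> (\<exists>v\<in>insert 1 A. v < w)"
    unfolding inf01_def
    by (rule cInf_less_iff) (use assms in \<open>auto intro!: bdd_belowI[of _ 0]\<close>)
  then show ?thesis by auto
qed

section \<open>Limits along ultrafilters\<close>

text \<open>A bound a below \<open>xi F\<close> is witnessed by a member A of F with
  \<open>Inf A\<close> above a. For a bound above, the ultrafilter property is used: otherwise the
  points of the interval that are at least a form a member of F, and its infimum enters the
  supremum.\<close>

lemma xi_tendsto_id: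
  assumes "F \<in> ultrafilters {0..1}"
  shows "xi F \<in> {0..1}" "((\<lambda>x. x) \<longlongrightarrow> xi F) F"
proof -
  let ?S = "{Inf A | A. A \<subseteq> {0..1} \<and> mem_filter A F}"
  have nb: "F \<noteq> bot" and m: "mem_filter {0..1} F" using ultrafilters_D[OF assms] by auto
  have ne: "A \<noteq> {}" if "mem_filter A F" for A
    using that nb by auto
  have S: "?S \<subseteq> {0..1}"
  proof
    fix v assume "v \<in> ?S"
    then obtain A where A: "v = Inf A" "A \<subseteq> {0..1}" "mem_filter A F" by auto
    then obtain x where x: "x \<in> A" using ne by blast
    have "Inf A \<le> x" using x A by (intro cInf_lower bdd_belowI[of _ 0]) auto
    moreover have "0 \<le> Inf A" using ne A by (intro cInf_greatest) auto
    ultimately show "v \<in> {0..1}" using x A by (auto intro: order_trans)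
  qed
  show r: "xi F \<in> {0..1}" unfolding xi_def by (rule sup01_range[OF S])
  show "((\<lambda>x. x) \<longlongrightarrow> xi F) F"
  proof (rule order_tendstoI)
    fix a assume a: "a < xi F"
    show "\<forall>\<^sub>F x in F. a < x"
    proof (cases "a < 0")
      case True
      then show ?thesis using m by (auto elim: eventually_mono)
    next
      case False
      then obtain v where "v \<in> ?S" "a < v"
        using less_sup01D[OF S, of a] a by (auto simp: xi_def)
      then obtain A where A: "a < Inf A" "A \<subseteq> {0..1}" "mem_filter A F" by auto
      show ?thesis using A(3)
      proof eventually_elim
        case (elim x)
        have "Inf A \<le> x" using elim A by (intro cInf_lower bdd_belowI[of _ 0]) auto
        then show ?case using A by simp
      qed
    qed
  next
    fix a assume a: "xi F < a"
    show "\<forall>\<^sub>F x in F. x < a"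
    proof (rule ccontr)
      assume "\<not> ?thesis"
      then have "\<forall>\<^sub>F x in F. \<not> x < a"
        using assms by (auto simp: ultrafilters_def is_ultrafilter_def)
      then have A: "mem_filter {x\<in>{0..1}. a \<le> x} F"
        using m by eventually_elim auto
      have "Inf {x\<in>{0..1}. a \<le> x} \<le> xi F" unfolding xi_def
        by (rule sup01_upper[OF S]) (use A in auto)
      moreover have "a \<le> Inf {x\<in>{0..1}. a \<le> x}" using ne[OF A] by (intro cInf_greatest) auto
      ultimately show False using a by simp
    qed
  qed
qed

lemma xi_tendsto:
  assumes "\<xx> \<in> ultrafilters X" "\<And>x. x \<in> X \<Longrightarrow> f x \<in> {0..1}"
  shows "xi (filtermap f \<xx>) \<in> {0..1}" "(f \<longlongrightarrow> xi (filtermap f \<xx>)) \<xx>"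
  using xi_tendsto_id[OF ultrafilters_filtermap[OF assms]]
  by (auto simp: filterlim_filtermap)

lemma xi_eqI:
  assumes "\<xx> \<in> ultrafilters X" "\<And>x. x \<in> X \<Longrightarrow> f x \<in> {0..1}" "(f \<longlongrightarrow> l) \<xx>"
  shows "xi (filtermap f \<xx>) = l"
  using tendsto_unique[OF ultrafilters_D(1)[OF assms(1)] xi_tendsto(2)[OF assms(1,2)] assms(3)] .

lemma tendsto_ultra_unit: "(f \<longlongrightarrow> f x) (ultra_unit x)"
  by (auto simp: ultra_unit_def eventually_principal tendsto_def)

lemma xi_unit: "u \<in> {0..1} \<Longrightarrow> xi (ultra_unit u) = u"
  using xi_eqI[OF ultrafilters_unit _ tendsto_ultra_unit, of u "{0..1}" "\<lambda>x. x"] by simp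

section \<open>The two tensors\<close>

locale unit_tensor =
  fixes T :: "real \<Rightarrow> real \<Rightarrow> real"
  assumes tensor: "T = mult_tensor \<or> T = lukasiewicz_tensor"
begin

abbreviation hom :: "real \<Rightarrow> real \<Rightarrow> real" where
  "hom \<equiv> hom01 T"

lemma T_range: "u \<in> {0..1} \<Longrightarrow> v \<in> {0..1} \<Longrightarrow> T u v \<in> {0..1}"
  using tensor by (auto simp: mult_tensor_def lukasiewicz_tensor_def mult_le_one)

lemma T_commute: "T u v = T v u"
  using tensor by (auto simp: mult_tensor_def lukasiewicz_tensor_def algebra_simps)

lemma T_assoc:
  "u \<in> {0..1} \<Longrightarrow> v \<in> {0..1} \<Longrightarrow> w \<in> {0..1} \<Longrightarrow> T (T u v) w = T u (T v w)"
  using tensor by (auto simp: mult_tensor_def lukasiewicz_tensor_def max_def)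

lemma T_left_commute:
  "u \<in> {0..1} \<Longrightarrow> v \<in> {0..1} \<Longrightarrow> w \<in> {0..1} \<Longrightarrow> T u (T v w) = T v (T u w)"
  by (metis T_assoc T_commute)

lemma T_one [simp]: "u \<in> {0..1} \<Longrightarrow> T 1 u = u" "u \<in> {0..1} \<Longrightarrow> T u 1 = u"
  using tensor by (auto simp: mult_tensor_def lukasiewicz_tensor_def)

lemma T_zero [simp]: "u \<in> {0..1} \<Longrightarrow> T 0 u = 0" "u \<in> {0..1} \<Longrightarrow> T u 0 = 0"
  using tensor by (auto simp: mult_tensor_def lukasiewicz_tensor_def)

lemma T_mono:
  "u \<in> {0..1} \<Longrightarrow> v \<in> {0..1} \<Longrightarrow> u' \<in> {0..1} \<Longrightarrow> v' \<in> {0..1} \<Longrightarrow> u \<le> u' \<Longrightarrow> v \<le> v'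
     \<Longrightarrow> T u v \<le> T u' v'"
  using tensor by (auto simp: mult_tensor_def lukasiewicz_tensor_def intro!: mult_mono)

lemma T_le_left: "u \<in> {0..1} \<Longrightarrow> v \<in> {0..1} \<Longrightarrow> T u v \<le> u"
  using T_mono[of u v u 1] by simp

lemma T_tendsto: "(f \<longlongrightarrow> a) F \<Longrightarrow> (g \<longlongrightarrow> b) F \<Longrightarrow> ((\<lambda>x. T (f x) (g x)) \<longlongrightarrow> T a b) F"
  using tensor unfolding mult_tensor_def lukasiewicz_tensor_def
  by (elim disjE) (auto intro!: tendsto_intros)

lemma hom_range: "hom u w \<in> {0..1}"
  unfolding hom01_def by (rule sup01_range) auto

lemma hom_adj:
  "u \<in> {0..1} \<Longrightarrow> v \<in> {0..1} \<Longrightarrow> w \<in> {0..1} \<Longrightarrow> T u v \<le> w \<longleftrightarrow> v \<le> hom u w"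
  by (rule hom01_adjunction[OF tensor])

lemma T_hom_le: "u \<in> {0..1} \<Longrightarrow> w \<in> {0..1} \<Longrightarrow> T u (hom u w) \<le> w"
  using hom_adj[of u "hom u w" w] hom_range by auto

lemma hom_mono:
  "u \<in> {0..1} \<Longrightarrow> w \<in> {0..1} \<Longrightarrow> w' \<in> {0..1} \<Longrightarrow> w \<le> w' \<Longrightarrow> hom u w \<le> hom u w'"
  using T_hom_le[of u w] hom_adj[of u "hom u w" w'] hom_range by auto

lemma hom_eq_one_iff: "u \<in> {0..1} \<Longrightarrow> w \<in> {0..1} \<Longrightarrow> hom u w = 1 \<longleftrightarrow> u \<le> w"
  using hom_adj[of u 1 w] hom_range[of u w] by auto

lemma hom_one [simp]: "w \<in> {0..1} \<Longrightarrow> hom 1 w = w"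
  using T_hom_le[of 1 w] hom_adj[of 1 w w] hom_range[of 1 w] by auto

text \<open>Tensoring the left side with u and moving v to the front leaves
  \<open>T u (hom u w)\<close>, which is at most w; then transpose. This is what closes CX under
  \<open>hom u\<close>.\<close>

lemma T_hom_le_hom:
  assumes "u \<in> {0..1}" "v \<in> {0..1}" "w \<in> {0..1}"
  shows "T v (hom u w) \<le> hom u (T v w)"
proof -
  have "T u (T v (hom u w)) = T v (T u (hom u w))"
    using assms hom_range by (intro T_left_commute)
  also have "\<dots> \<le> T v w"
    using assms hom_range[of u w] T_range[of u "hom u w"] by (intro T_mono T_hom_le) auto
  finally show ?thesis
    using assms hom_range[of u w] by (subst (asm) hom_adj) (auto intro!: T_range simp del: atLeastAtMost_iff)
qed

text \<open>For fixed u, both homs are \<open>min 1\<close> of an affine function of w, except for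
  multiplication with u = 0, where \<open>hom u\<close> is constantly 1. The argument u stays fixed
  because the hom of multiplication is not jointly continuous at (0, 0).\<close>

lemma hom_tendsto:
  assumes "u \<in> {0..1}" "a \<in> {0..1}" "\<forall>\<^sub>F x in F. f x \<in> {0..1}" "(f \<longlongrightarrow> a) F"
  shows "((\<lambda>x. hom u (f x)) \<longlongrightarrow> hom u a) F"
  using tensor
proof
  assume T: "T = mult_tensor"
  show ?thesis
  proof (cases "u = 0")
    case True
    have "\<forall>\<^sub>F x in F. hom u (f x) = 1"
      using assms(3) by eventually_elim (use assms True in \<open>auto simp: hom_eq_one_iff\<close>)
    moreover have "hom u a = 1" using True assms by (auto simp: hom_eq_one_iff)
    ultimately show ?thesis by (simp add: tendsto_eventually)
  next
    case False
    have eq: "hom u w = min 1 (w / u)" if "w \<in> {0..1}" for w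
      using False that assms by (auto simp: T hom01_mult min_def field_simps)
    have "((\<lambda>x. min 1 (f x / u)) \<longlongrightarrow> min 1 (a / u)) F"
      using False by (intro tendsto_intros assms) auto
    then show ?thesis
      unfolding eq[OF assms(2)]
      by (rule Lim_transform_eventually) (use assms(3) in \<open>eventually_elim, simp only: eq\<close>)
  qed
next
  assume T: "T = lukasiewicz_tensor"
  have eq: "hom u w = min 1 (1 - u + w)" if "w \<in> {0..1}" for w
    using that assms by (simp add: T hom01_lukasiewicz)
  have "((\<lambda>x. min 1 (1 - u + f x)) \<longlongrightarrow> min 1 (1 - u + a)) F"
    by (intro tendsto_intros assms)
  then show ?thesis
    unfolding eq[OF assms(2)]
    by (rule Lim_transform_eventually) (use assms(3) in \<open>eventually_elim, simp only: eq\<close>)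
qed

text \<open>Provides the slack in \<open>pairing_repr\<close>, where s is the value of a test
  function at a point and t the value of the functional on a function equal to 1 there. As e
  decreases to 0 the two arguments tend to s and t, since \<open>hom\<close> is continuous in its
  first variable at 1.\<close>

lemma T_hom_perturb:
  assumes "s \<in> {0..1}" "t \<in> {0..1}" "T s t < c"
  shows "\<exists>e>0. e < 1 \<and> T (min 1 (s + e)) (hom (1 - e) t) < c"
proof -
  have small: "\<forall>\<^sub>F e in at_right (0::real). 0 < e \<and> e < 1"
    using eventually_at_right_real[of 0 1] by (auto elim: eventually_mono)
  have "((\<lambda>e. hom (1 - e) t) \<longlongrightarrow> t) (at_right 0)"
    using tensor
  proof
    assume T: "T = mult_tensor"
    have "((\<lambda>e. min 1 (t / (1 - e))) \<longlongrightarrow> min 1 (t / (1 - 0))) (at_right 0)"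
      by (intro tendsto_intros) auto
    moreover have "\<forall>\<^sub>F e in at_right 0. min 1 (t / (1 - e)) = hom (1 - e) t"
      using small by eventually_elim (use assms in \<open>auto simp: T hom01_mult min_def field_simps\<close>)
    ultimately show ?thesis using assms by (auto dest: Lim_transform_eventually)
  next
    assume T: "T = lukasiewicz_tensor"
    have "((\<lambda>e. min 1 (1 - (1 - e) + t)) \<longlongrightarrow> min 1 (1 - (1 - 0) + t)) (at_right 0)"
      by (intro tendsto_intros)
    moreover have "\<forall>\<^sub>F e in at_right 0. min 1 (1 - (1 - e) + t) = hom (1 - e) t"
      using small by eventually_elim (use assms in \<open>auto simp: T hom01_lukasiewicz\<close>)
    ultimately show ?thesis using assms by (auto dest: Lim_transform_eventually)
  qed
  then have "((\<lambda>e. T (min 1 (s + e)) (hom (1 - e) t)) \<longlongrightarrow> T (min 1 (s + 0)) t) (at_right 0)"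
    by (intro T_tendsto tendsto_intros)
  then have "\<forall>\<^sub>F e in at_right 0. T (min 1 (s + e)) (hom (1 - e) t) < c"
    by (rule order_tendstoD) (use assms in simp)
  with small have "\<forall>\<^sub>F e in at_right 0. 0 < e \<and> e < 1 \<and> T (min 1 (s + e)) (hom (1 - e) t) < c"
    by eventually_elim simp
  then show ?thesis
    using eventually_happens trivial_limit_at_right_real by blast
qed

lemma T_less_perturb:
  assumes "T s t < c"
  shows "\<exists>r>t. T s r < c"
proof -
  have "((\<lambda>r. T s r) \<longlongrightarrow> T s t) (at_right t)"
    by (intro T_tendsto tendsto_intros)
  then have "\<forall>\<^sub>F r in at_right t. T s r < c" by (rule order_tendstoD(2)) (rule assms)
  then have "\<forall>\<^sub>F r in at_right t. t < r \<and> T s r < c"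
    using eventually_at_right_less[of t] by eventually_elim simp
  then show ?thesis
    using eventually_happens trivial_limit_at_right_real by blast
qed

text \<open>By right continuity of \<open>T s\<close> the strict inequality survives at some r above
  the infimum, and some element lies below r. The alternative \<open>T s 1 < c\<close> accounts for
  the element 1 that \<open>inf01\<close> adds.\<close>

lemma T_inf01_less:
  assumes "s \<in> {0..1}" "A \<subseteq> {0..1}" "T s (inf01 A) < c"
  shows "T s 1 < c \<or> (\<exists>v\<in>A. T s v < c)"
proof -
  obtain r where r: "inf01 A < r" "T s r < c" using T_less_perturb[OF assms(3)] by auto
  then consider "1 < r" | v where "v \<in> A" "v < r" using inf01_less_iff[OF assms(2)] by auto
  then show ?thesis
  proof cases
    case 1
    \<comment> \<open>Here r lies outside the unit interval, where \<open>T_mono\<close> says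
      nothing, so both tensors are unfolded.\<close>
    have "0 \<le> T s r - T s 1"
      using 1 assms(1) tensor by (auto simp: mult_tensor_def lukasiewicz_tensor_def mult_le_cancel_left1)
    then show ?thesis using r by auto
  next
    case 2
    have "T s v \<le> T s r"
      using 2 assms tensor by (auto simp: mult_tensor_def lukasiewicz_tensor_def mult_left_mono)
    then have "T s v < c" using r by simp
    then show ?thesis using 2 by blast
  qed
qed

lemma T_sup01_le_iff:
  assumes "u \<in> {0..1}" "A \<subseteq> {0..1}" "w \<in> {0..1}"
  shows "T u (sup01 A) \<le> w \<longleftrightarrow> (\<forall>v\<in>A. T u v \<le> w)"
proof -
  have "T u (sup01 A) \<le> w \<longleftrightarrow> sup01 A \<le> hom u w"
    using assms sup01_range by (intro hom_adj) auto
  also have "\<dots> \<longleftrightarrow> (\<forall>v\<in>A. v \<le> hom u w)"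
    using assms hom_range[of u w] by (intro sup01_le_iff) auto
  also have "\<dots> \<longleftrightarrow> (\<forall>v\<in>A. T u v \<le> w)"
    using assms hom_adj[of u _ w] by (auto simp: subset_iff)
  finally show ?thesis .
qed

section \<open>Objects\<close>

lemma uar0_eq: "uar0 X x y = uar X (ultra_unit x) y"
  by (simp add: underlying_def)

text \<open>Uniqueness is a Yoneda argument: two representing points have the same hom-values, in
  particular the value 1 in both directions between them. Based on reflexivity and separatedness
  alone, it applies to the unit interval, its dual and the Vietoris object as well as to given
  objects.\<close>

lemma conv_eqI:
  assumes "z \<in> ucar X" "\<And>x. x \<in> ucar X \<Longrightarrow> uar X \<xx> x = uar0 X z x"
    and refl: "\<And>x. x \<in> ucar X \<Longrightarrow> uar0 X x x = 1" and sep: "vseparated (underlying X)"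
  shows "conv X \<xx> = z"
  unfolding conv_def
proof (rule the_equality)
  show "z \<in> ucar X \<and> (\<forall>x\<in>ucar X. uar X \<xx> x = uar0 X z x)" using assms by blast
  fix w assume w: "w \<in> ucar X \<and> (\<forall>x\<in>ucar X. uar X \<xx> x = uar0 X w x)"
  then have "uar0 X w x = uar0 X z x" if "x \<in> ucar X" for x using that assms by auto
  then have "uar0 X w z = 1" "uar0 X z w = 1" using refl[of z] refl[of w] w assms(1) by auto
  then show "w = z"
    using sep w assms(1) unfolding vseparated_def by (auto simp: underlying_def)
qed

lemma topspace_conv_topology [simp]: "topspace (conv_topology X) = ucar X"
proof -
  have "openin (conv_topology X) (ucar X)"
    by (auto simp: openin_conv_topology ultrafilters_def)
  then show ?thesis by (metis openin_conv_topology openin_subset openin_topspace subset_antisym)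
qed

text \<open>Open sets are defined through ultrafilters, so preservation of their limits gives
  continuity directly. The converse depends on Y having enough open sets and is proved for the dual
  unit interval in \<open>continuous_map_dual_unit_iff\<close>.\<close>

lemma continuous_map_convI:
  assumes "\<And>x. x \<in> ucar X \<Longrightarrow> f x \<in> ucar Y"
    and "\<And>\<xx>. \<xx> \<in> ultrafilters (ucar X) \<Longrightarrow> conv X \<xx> \<in> ucar X"
    and "\<And>\<xx>. \<xx> \<in> ultrafilters (ucar X) \<Longrightarrow> conv Y (filtermap f \<xx>) = f (conv X \<xx>)"
  shows "continuous_map (conv_topology X) (conv_topology Y) f"
  unfolding continuous_map_def
proof (intro conjI allI impI)
  show "f \<in> topspace (conv_topology X) \<rightarrow> topspace (conv_topology Y)" using assms by auto
  fix U assume U: "openin (conv_topology Y) U"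
  show "openin (conv_topology X) {x \<in> topspace (conv_topology X). f x \<in> U}"
    unfolding openin_conv_topology
  proof (intro conjI ballI impI)
    fix \<xx> assume x: "\<xx> \<in> ultrafilters (ucar X)"
      and "conv X \<xx> \<in> {x \<in> topspace (conv_topology X). f x \<in> U}"
    then have "conv Y (filtermap f \<xx>) \<in> U" using assms(3) by auto
    then have "mem_filter U (filtermap f \<xx>)"
      using U ultrafilters_filtermap[OF x assms(1)] by (auto simp: openin_conv_topology)
    then show "mem_filter {x \<in> topspace (conv_topology X). f x \<in> U} \<xx>"
      using ultrafilters_D(2)[OF x] unfolding eventually_filtermap
      by eventually_elim simp
  qed auto
qed

section \<open>The unit interval and its dual\<close>

lemma uar0_unit: "x \<in> {0..1} \<Longrightarrow> uar0 (unit_ucat T) x y = hom x y"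
  by (simp add: uar0_eq unit_ucat_def xi_unit)

lemma conv_unit:
  assumes "\<xx> \<in> ultrafilters {0..1}"
  shows "conv (unit_ucat T) \<xx> = xi \<xx>"
proof (rule conv_eqI)
  show "xi \<xx> \<in> ucar (unit_ucat T)"
    using xi_tendsto_id[OF assms] by (simp add: unit_ucat_def)
  then show "uar (unit_ucat T) \<xx> x = uar0 (unit_ucat T) (xi \<xx>) x" for x
    by (simp add: uar0_eq unit_ucat_def xi_unit)
  show "uar0 (unit_ucat T) x x = 1" if "x \<in> ucar (unit_ucat T)" for x
    using that by (subst uar0_unit) (auto simp: hom_eq_one_iff unit_ucat_def)
  show "vseparated (underlying (unit_ucat T))"
    by (auto simp: vseparated_def uar0_unit hom_eq_one_iff) (auto simp: underlying_def unit_ucat_def uar0_unit hom_eq_one_iff xi_unit)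
qed

lemma uar0_dual_unit:
  assumes "x \<in> {0..1}" "y \<in> {0..1}"
  shows "uar0 (dual (unit_ucat T)) x y = hom y x"
  using assms by (simp add: uar0_eq dual_def conv_unit ultrafilters_unit xi_unit)
    (simp add: unit_ucat_def xi_unit)

lemma ucar_dual_unit [simp]: "ucar (dual (unit_ucat T)) = {0..1}"
  by (simp add: dual_def unit_ucat_def)

lemma conv_dual_unit:
  assumes "\<xx> \<in> ultrafilters {0..1}"
  shows "conv (dual (unit_ucat T)) \<xx> = xi \<xx>"
proof (rule conv_eqI)
  show "xi \<xx> \<in> ucar (dual (unit_ucat T))"
    using xi_tendsto_id[OF assms] by simp
  then show "uar (dual (unit_ucat T)) \<xx> x = uar0 (dual (unit_ucat T)) (xi \<xx>) x"
    if "x \<in> ucar (dual (unit_ucat T))" for x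
    using that assms by (simp add: uar0_dual_unit) (simp add: dual_def conv_unit uar0_unit)
  show "uar0 (dual (unit_ucat T)) x x = 1" if "x \<in> ucar (dual (unit_ucat T))" for x
    using that by (subst uar0_dual_unit) (auto simp: hom_eq_one_iff)
  have "car (underlying (dual (unit_ucat T))) = {0..1}"
    by (simp add: underlying_def)
  then show "vseparated (underlying (dual (unit_ucat T)))"
    unfolding vseparated_def
    using uar0_dual_unit hom_eq_one_iff by (metis order_antisym)
qed

text \<open>From left to right: Euclidean open sets, cut down to the unit interval, are open for
  convergence by \<open>xi\<close>, because an ultrafilter with limit in S contains S. Their
  preimages then control f along every ultrafilter.\<close>

lemma continuous_map_dual_unit_iff:
  assumes f: "\<And>x. x \<in> ucar X \<Longrightarrow> f x \<in> {0..1}"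
    and c: "\<And>\<xx>. \<xx> \<in> ultrafilters (ucar X) \<Longrightarrow> conv X \<xx> \<in> ucar X"
  shows "continuous_map (conv_topology X) (conv_topology (dual (unit_ucat T))) f \<longleftrightarrow>
    (\<forall>\<xx>\<in>ultrafilters (ucar X). (f \<longlongrightarrow> f (conv X \<xx>)) \<xx>)" (is "?L \<longleftrightarrow> ?R")
proof
  assume L: ?L
  show ?R
  proof (intro ballI topological_tendstoI)
    fix \<xx> and S :: "real set"
    assume x: "\<xx> \<in> ultrafilters (ucar X)" and S: "open S" "f (conv X \<xx>) \<in> S"
    have "openin (conv_topology (dual (unit_ucat T))) (S \<inter> {0..1})"
      unfolding openin_conv_topology
    proof (intro conjI ballI impI)
      fix \<yy> assume y: "\<yy> \<in> ultrafilters (ucar (dual (unit_ucat T)))"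
        and "conv (dual (unit_ucat T)) \<yy> \<in> S \<inter> {0..1}"
      then have "xi \<yy> \<in> S" by (simp add: conv_dual_unit)
      then have "\<forall>\<^sub>F x in \<yy>. x \<in> S"
        using y by (intro topological_tendstoD[OF xi_tendsto_id(2)] S) auto
      then show "mem_filter (S \<inter> {0..1}) \<yy>"
        using ultrafilters_D(2)[OF y] by eventually_elim auto
    qed auto
    then have "openin (conv_topology X) {x \<in> ucar X. f x \<in> S \<inter> {0..1}}"
      using openin_continuous_map_preimage[OF L] unfolding topspace_conv_topology by blast
    then have "mem_filter {x \<in> ucar X. f x \<in> S \<inter> {0..1}} \<xx>"
      using x S c[OF x] f[OF c[OF x]] by (auto simp: openin_conv_topology)
    then show "\<forall>\<^sub>F x in \<xx>. f x \<in> S" by eventually_elim auto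
  qed
next
  assume R: ?R
  show ?L
  proof (rule continuous_map_convI)
    fix \<xx> assume x: "\<xx> \<in> ultrafilters (ucar X)"
    show "conv (dual (unit_ucat T)) (filtermap f \<xx>) = f (conv X \<xx>)"
      using R x f xi_eqI[OF x f] ultrafilters_filtermap[OF x f] by (subst conv_dual_unit) auto
  qed (use f c in auto)
qed

section \<open>Pointwise descriptions of CX and VX\<close>

definition obj :: "'a ucat \<Rightarrow> bool" where
  "obj X \<longleftrightarrow> rep_obj T X \<and> cogenerated T X"

abbreviation C :: "'a ucat \<Rightarrow> ('a \<Rightarrow> real) set" where
  "C X \<equiv> car (C_obj T X)"

abbreviation V :: "'a ucat \<Rightarrow> ('a \<Rightarrow> real) set" where
  "V X \<equiv> vietoris_car T X"

lemma uar0_range: "obj X \<Longrightarrow> x \<in> ucar X \<Longrightarrow> y \<in> ucar X \<Longrightarrow> uar0 X x y \<in> {0..1}"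
  by (auto simp: uar0_eq obj_def rep_obj_def ucategory_def ultrafilters_unit simp del: atLeastAtMost_iff)

lemma uar0_refl: "obj X \<Longrightarrow> x \<in> ucar X \<Longrightarrow> uar0 X x x = 1"
  by (auto simp: uar0_eq obj_def rep_obj_def ucategory_def)

lemma
  assumes "obj X" "\<xx> \<in> ultrafilters (ucar X)"
  shows conv_in: "conv X \<xx> \<in> ucar X"
    and uar_conv: "x \<in> ucar X \<Longrightarrow> uar X \<xx> x = uar0 X (conv X \<xx>) x"
proof -
  obtain z where z: "z \<in> ucar X" "\<And>x. x \<in> ucar X \<Longrightarrow> uar X \<xx> x = uar0 X z x"
    using assms unfolding obj_def rep_obj_def representable_def by (metis PiE Pi_mem)
  have "conv X \<xx> = z"
    using z by (rule conv_eqI) (use assms in \<open>auto simp: uar0_refl obj_def rep_obj_def\<close>)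
  then show "conv X \<xx> \<in> ucar X" "x \<in> ucar X \<Longrightarrow> uar X \<xx> x = uar0 X (conv X \<xx>) x"
    using z by auto
qed

lemma conv_ultra_unit: "obj X \<Longrightarrow> x \<in> ucar X \<Longrightarrow> conv X (ultra_unit x) = x"
  by (rule conv_eqI) (auto simp: uar0_refl uar0_eq[symmetric], auto simp: obj_def rep_obj_def)

lemma mem_C:
  assumes X: "obj X"
  shows "\<psi> \<in> C X \<longleftrightarrow> \<psi> \<in> ucar X \<rightarrow>\<^sub>E {0..1} \<and>
    (\<forall>x\<in>ucar X. \<forall>y\<in>ucar X. T (uar0 X x y) (\<psi> y) \<le> \<psi> x) \<and>
    (\<forall>\<xx>\<in>ultrafilters (ucar X). (\<psi> \<longlongrightarrow> \<psi> (conv X \<xx>)) \<xx>)"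
proof (cases "\<psi> \<in> ucar X \<rightarrow>\<^sub>E {0..1}")
  case True
  then have r: "\<psi> x \<in> {0..1}" if "x \<in> ucar X" for x using that by (rule PiE_mem)
  have a: "uar0 X x y \<le> uar0 (dual (unit_ucat T)) (\<psi> x) (\<psi> y) \<longleftrightarrow> T (uar0 X x y) (\<psi> y) \<le> \<psi> x"
    if "x \<in> ucar X" "y \<in> ucar X" for x y
    using r[OF that(1)] r[OF that(2)] uar0_range[OF X that]
    by (subst uar0_dual_unit) (auto simp: hom_adj[symmetric] T_commute)
  show ?thesis
    using True r conv_in[OF X] a
    by (auto simp: C_obj_def rep_hom_def continuous_map_dual_unit_iff vfunctor_def
        simp del: atLeastAtMost_iff) (auto simp: underlying_def)
next
  case False
  then show ?thesis by (auto simp: C_obj_def rep_hom_def)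
qed

text \<open>The adjunction turns the functor condition into a product. At x =
  \<open>conv X \<xx>\<close> it says that the limit of h along \<open>\<xx>\<close> is at most the
  value of h at the limit point: h is upper semicontinuous, where members of CX are
  continuous.\<close>

lemma mem_V:
  assumes X: "obj X"
  shows "h \<in> V X \<longleftrightarrow> h \<in> ucar X \<rightarrow>\<^sub>E {0..1} \<and>
    (\<forall>\<xx>\<in>ultrafilters (ucar X). \<forall>x\<in>ucar X.
       T (xi (filtermap h \<xx>)) (uar0 X (conv X \<xx>) x) \<le> h x)"
proof (cases "h \<in> ucar X \<rightarrow>\<^sub>E {0..1}")
  case True
  then have r: "h x \<in> {0..1}" if "x \<in> ucar X" for x using that by (rule PiE_mem)
  have "uar X \<xx> x \<le> hom (xi (filtermap h \<xx>)) (h x) \<longleftrightarrow>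
      T (xi (filtermap h \<xx>)) (uar0 X (conv X \<xx>) x) \<le> h x"
    if x: "\<xx> \<in> ultrafilters (ucar X)" "x \<in> ucar X" for \<xx> x
    using xi_tendsto(1)[OF x(1) r] uar0_range[OF X conv_in[OF X x(1)] x(2)] r[OF x(2)]
    by (subst hom_adj) (auto simp: uar_conv[OF X x])
  then show ?thesis
    using True by (auto simp: vietoris_car_def ufunctor_def unit_ucat_def simp del: atLeastAtMost_iff)
next
  case False
  then show ?thesis by (auto simp: vietoris_car_def)
qed

lemma C_range: "obj X \<Longrightarrow> \<psi> \<in> C X \<Longrightarrow> x \<in> ucar X \<Longrightarrow> \<psi> x \<in> {0..1}"
  using mem_C[of X \<psi>] PiE_mem by metis

lemma V_range: "obj X \<Longrightarrow> h \<in> V X \<Longrightarrow> x \<in> ucar X \<Longrightarrow> h x \<in> {0..1}"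
  using mem_V[of X h] PiE_mem by metis

lemma C_tendsto: "obj X \<Longrightarrow> \<psi> \<in> C X \<Longrightarrow> \<xx> \<in> ultrafilters (ucar X) \<Longrightarrow> (\<psi> \<longlongrightarrow> \<psi> (conv X \<xx>)) \<xx>"
  using mem_C by blast

lemma C_le: "obj X \<Longrightarrow> \<psi> \<in> C X \<Longrightarrow> x \<in> ucar X \<Longrightarrow> y \<in> ucar X \<Longrightarrow> T (uar0 X x y) (\<psi> y) \<le> \<psi> x"
  using mem_C by blast

lemma C_extensional: "obj X \<Longrightarrow> \<psi> \<in> C X \<Longrightarrow> \<psi> \<in> extensional (ucar X)"
  by (auto simp: mem_C PiE_iff)

lemma C_eqI: "obj X \<Longrightarrow> p \<in> C X \<Longrightarrow> q \<in> C X \<Longrightarrow> (\<And>x. x \<in> ucar X \<Longrightarrow> p x = q x) \<Longrightarrow> p = q"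
  by (meson C_extensional extensionalityI)

section \<open>Linear functionals and their representing maps\<close>

lemma T_max: "a \<in> {0..1} \<Longrightarrow> b \<in> {0..1} \<Longrightarrow> c \<in> {0..1} \<Longrightarrow> T a (max b c) = max (T a b) (T a c)"
  using T_mono[of a b a c] T_mono[of a c a b] by (auto simp: max_def)

text \<open>The case v = 0 is a copower and u = v = 1 a binary supremum, so the single equation in
  \<open>linear\<close> expresses preservation of both.\<close>

definition join :: "'a ucat \<Rightarrow> real \<Rightarrow> ('a \<Rightarrow> real) \<Rightarrow> real \<Rightarrow> ('a \<Rightarrow> real) \<Rightarrow> 'a \<Rightarrow> real" where
  "join X u p v q = (\<lambda>x\<in>ucar X. max (T u (p x)) (T v (q x)))"

definition linear :: "'a ucat \<Rightarrow> (('a \<Rightarrow> real) \<Rightarrow> real) \<Rightarrow> bool" where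
  "linear X \<Phi> \<longleftrightarrow> (\<forall>p\<in>C X. \<Phi> p \<in> {0..1}) \<and>
    (\<forall>p\<in>C X. \<forall>q\<in>C X. \<forall>u\<in>{0..1}. \<forall>v\<in>{0..1}.
       \<Phi> (join X u p v q) = max (T u (\<Phi> p)) (T v (\<Phi> q)))"

definition pairing :: "'a ucat \<Rightarrow> ('a \<Rightarrow> real) \<Rightarrow> ('a \<Rightarrow> real) \<Rightarrow> real" where
  "pairing X \<psi> h = sup01 ((\<lambda>x. T (\<psi> x) (h x)) ` ucar X)"

text \<open>By adjunction this is the largest map h with
  \<open>T (\<psi> x) (h x) \<le> \<Phi> \<psi>\<close> for all \<psi> in CX and all x in X;
  \<open>T_repr_le\<close> and \<open>le_repr\<close> express this, and it is how
  \<open>repr\<close> is used.\<close>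

definition repr :: "'a ucat \<Rightarrow> (('a \<Rightarrow> real) \<Rightarrow> real) \<Rightarrow> 'a \<Rightarrow> real" where
  "repr X \<Phi> = (\<lambda>x\<in>ucar X. inf01 ((\<lambda>\<psi>. hom (\<psi> x) (\<Phi> \<psi>)) ` C X))"

section \<open>Closure properties of CX\<close>

lemma C_restrictI:
  assumes X: "obj X" and r: "\<And>x. x \<in> ucar X \<Longrightarrow> f x \<in> {0..1}"
    and le: "\<And>x y. x \<in> ucar X \<Longrightarrow> y \<in> ucar X \<Longrightarrow> T (uar0 X x y) (f y) \<le> f x"
    and lim: "\<And>\<xx>. \<xx> \<in> ultrafilters (ucar X) \<Longrightarrow> (f \<longlongrightarrow> f (conv X \<xx>)) \<xx>"
  shows "restrict f (ucar X) \<in> C X"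
  unfolding mem_C[OF X]
proof (intro conjI ballI)
  fix \<xx> assume x: "\<xx> \<in> ultrafilters (ucar X)"
  have "\<forall>\<^sub>F x in \<xx>. f x = restrict f (ucar X) x"
    using ultrafilters_D(2)[OF x] by eventually_elim simp
  with lim[OF x] have "(restrict f (ucar X) \<longlongrightarrow> f (conv X \<xx>)) \<xx>"
    by (rule Lim_transform_eventually)
  then show "(restrict f (ucar X) \<longlongrightarrow> restrict f (ucar X) (conv X \<xx>)) \<xx>"
    using conv_in[OF X x] by simp
qed (use r le in auto)

lemma C_const: "obj X \<Longrightarrow> c \<in> {0..1} \<Longrightarrow> (\<lambda>x\<in>ucar X. c) \<in> C X"
  by (rule C_restrictI) (auto intro!: T_le_left[of c, unfolded T_commute[of c]] uar0_range simp del: atLeastAtMost_iff)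

lemma C_join:
  assumes X: "obj X" and pq: "p \<in> C X" "q \<in> C X" and uv: "u \<in> {0..1}" "v \<in> {0..1}"
  shows "join X u p v q \<in> C X"
  unfolding join_def
proof (rule C_restrictI[OF X])
  note r = C_range[OF X pq(1)] C_range[OF X pq(2)]
  fix x assume x: "x \<in> ucar X"
  show "max (T u (p x)) (T v (q x)) \<in> {0..1}"
    using r[OF x] uv T_range by (auto simp: max_def simp del: atLeastAtMost_iff)
  fix y assume y: "y \<in> ucar X"
  note a = uar0_range[OF X x y]
  have *: "T (uar0 X x y) (T w (s y)) \<le> T w (s x)" if "s \<in> C X" "w \<in> {0..1}" for s w
  proof -
    have "T (uar0 X x y) (T w (s y)) = T w (T (uar0 X x y) (s y))"
      using a that C_range[OF X that(1)] x y by (intro T_left_commute) auto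
    also have "\<dots> \<le> T w (s x)"
      using a that C_range[OF X that(1)] x y by (intro T_mono T_range C_le[OF X]) auto
    finally show ?thesis .
  qed
  show "T (uar0 X x y) (max (T u (p y)) (T v (q y))) \<le> max (T u (p x)) (T v (q x))"
    using a uv r[OF y] *[OF pq(1) uv(1)] *[OF pq(2) uv(2)]
    by (subst T_max) (auto intro!: T_range max.mono simp del: atLeastAtMost_iff)
next
  fix \<xx> assume x: "\<xx> \<in> ultrafilters (ucar X)"
  show "((\<lambda>x. max (T u (p x)) (T v (q x))) \<longlongrightarrow>
          max (T u (p (conv X \<xx>))) (T v (q (conv X \<xx>)))) \<xx>"
    by (intro tendsto_max T_tendsto tendsto_const C_tendsto[OF X] pq x)
qed

lemma C_min:
  assumes X: "obj X" and pq: "p \<in> C X" "q \<in> C X"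
  shows "(\<lambda>x\<in>ucar X. min (p x) (q x)) \<in> C X"
proof (rule C_restrictI[OF X])
  note r = C_range[OF X pq(1)] C_range[OF X pq(2)]
  fix x assume x: "x \<in> ucar X"
  show "min (p x) (q x) \<in> {0..1}" using r[OF x] by auto
  fix y assume y: "y \<in> ucar X"
  show "T (uar0 X x y) (min (p y) (q y)) \<le> min (p x) (q x)"
    using C_le[OF X pq(1) x y] C_le[OF X pq(2) x y] uar0_range[OF X x y] r[OF y]
      T_mono[of "uar0 X x y" "min (p y) (q y)" "uar0 X x y" "p y"]
      T_mono[of "uar0 X x y" "min (p y) (q y)" "uar0 X x y" "q y"] by auto
next
  fix \<xx> assume x: "\<xx> \<in> ultrafilters (ucar X)"
  show "((\<lambda>x. min (p x) (q x)) \<longlongrightarrow> min (p (conv X \<xx>)) (q (conv X \<xx>))) \<xx>"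
    by (intro tendsto_min C_tendsto[OF X] pq x)
qed

lemma C_hom:
  assumes X: "obj X" and p: "p \<in> C X" and u: "u \<in> {0..1}"
  shows "(\<lambda>x\<in>ucar X. hom u (p x)) \<in> C X"
proof (rule C_restrictI[OF X])
  note r = C_range[OF X p]
  fix x assume x: "x \<in> ucar X"
  show "hom u (p x) \<in> {0..1}" by (rule hom_range)
  fix y assume y: "y \<in> ucar X"
  have "T (uar0 X x y) (hom u (p y)) \<le> hom u (T (uar0 X x y) (p y))"
    using u uar0_range[OF X x y] r[OF y] by (rule T_hom_le_hom)
  also have "\<dots> \<le> hom u (p x)"
    by (intro hom_mono u T_range r x y C_le[OF X p] uar0_range[OF X])
  finally show "T (uar0 X x y) (hom u (p y)) \<le> hom u (p x)" .
next
  fix \<xx> assume x: "\<xx> \<in> ultrafilters (ucar X)"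
  have "\<forall>\<^sub>F x in \<xx>. p x \<in> {0..1}"
    using ultrafilters_D(2)[OF x] by eventually_elim (rule C_range[OF X p])
  then show "((\<lambda>x. hom u (p x)) \<longlongrightarrow> hom u (p (conv X \<xx>))) \<xx>"
    by (intro hom_tendsto u C_range[OF X p] conv_in[OF X x] C_tendsto[OF X p x])
qed

section \<open>Representation of a linear functional\<close>

context
  fixes X :: "'a ucat" and \<Phi>
  assumes X: "obj X" and lin: "linear X \<Phi>"
begin

lemma linear_range: "p \<in> C X \<Longrightarrow> \<Phi> p \<in> {0..1}"
  using lin by (simp add: linear_def)

lemma linear_join:
  "p \<in> C X \<Longrightarrow> q \<in> C X \<Longrightarrow> u \<in> {0..1} \<Longrightarrow> v \<in> {0..1} \<Longrightarrow>
     \<Phi> (join X u p v q) = max (T u (\<Phi> p)) (T v (\<Phi> q))"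
  using lin by (simp add: linear_def)

lemma linear_mono:
  assumes pq: "p \<in> C X" "q \<in> C X" "\<And>x. x \<in> ucar X \<Longrightarrow> p x \<le> q x"
  shows "\<Phi> p \<le> \<Phi> q"
proof -
  have "join X 1 p 1 q = q"
    using pq C_range[OF X pq(1)] C_range[OF X pq(2)]
    by (intro C_eqI[OF X C_join[OF X pq(1,2)]]) (auto simp: join_def)
  then have "\<Phi> q = max (T 1 (\<Phi> p)) (T 1 (\<Phi> q))"
    using linear_join[OF pq(1,2), of 1 1] by simp
  then show ?thesis using linear_range pq by simp
qed

lemma
  assumes p: "p \<in> C X" and u: "u \<in> {0..1}"
  shows C_scale: "(\<lambda>x\<in>ucar X. T u (p x)) \<in> C X"
    and linear_scale: "\<Phi> (\<lambda>x\<in>ucar X. T u (p x)) = T u (\<Phi> p)"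
proof -
  have "max (T u (p x)) 0 = T u (p x)" if "x \<in> ucar X" for x
    using T_range[OF u C_range[OF X p that]] by simp
  then have eq: "join X u p 0 p = (\<lambda>x\<in>ucar X. T u (p x))"
    using C_range[OF X p] by (auto simp: join_def fun_eq_iff)
  show "(\<lambda>x\<in>ucar X. T u (p x)) \<in> C X"
    unfolding eq[symmetric] by (intro C_join X p u) auto
  show "\<Phi> (\<lambda>x\<in>ucar X. T u (p x)) = T u (\<Phi> p)"
    unfolding eq[symmetric] using linear_join[OF p p u, of 0] linear_range[OF p]
      T_range[OF u linear_range[OF p]] by simp
qed

lemma linear_const_le:
  assumes c: "c \<in> {0..1}"
  shows "\<Phi> (\<lambda>x\<in>ucar X. c) \<le> c"
proof -
  have one: "(\<lambda>x\<in>ucar X. 1) \<in> C X" by (intro C_const X) auto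
  have "(\<lambda>x\<in>ucar X. c) = (\<lambda>x\<in>ucar X. T c ((\<lambda>x\<in>ucar X. 1) x))"
    using c by (auto simp: fun_eq_iff)
  then have "\<Phi> (\<lambda>x\<in>ucar X. c) = T c (\<Phi> (\<lambda>x\<in>ucar X. 1))"
    using linear_scale[OF one c] by simp
  then show ?thesis using T_le_left[OF c linear_range[OF one]] by simp
qed

text \<open>Linearity gives only an inequality for \<open>hom u\<close>: apply \<Phi> to
  \<open>T u (hom u (p x)) \<le> p x\<close> and transpose.\<close>

lemma linear_hom_le:
  assumes p: "p \<in> C X" and u: "u \<in> {0..1}"
  shows "\<Phi> (\<lambda>x\<in>ucar X. hom u (p x)) \<le> hom u (\<Phi> p)"
proof -
  let ?q = "\<lambda>x\<in>ucar X. hom u (p x)"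
  have q: "?q \<in> C X" by (intro C_hom X p u)
  have "T u (\<Phi> ?q) = \<Phi> (\<lambda>x\<in>ucar X. T u (?q x))" by (rule linear_scale[OF q u, symmetric])
  also have "\<dots> \<le> \<Phi> p"
    by (rule linear_mono[OF C_scale[OF q u] p]) (use T_hom_le[OF u C_range[OF X p]] in simp)
  finally show ?thesis using hom_adj[OF u linear_range[OF q] linear_range[OF p]] by simp
qed

lemma repr_range: "x \<in> ucar X \<Longrightarrow> repr X \<Phi> x \<in> {0..1}"
  unfolding repr_def using hom_range by (auto intro!: inf01_range simp del: atLeastAtMost_iff)

lemma T_repr_le:
  assumes "\<psi> \<in> C X" "x \<in> ucar X"
  shows "T (\<psi> x) (repr X \<Phi> x) \<le> \<Phi> \<psi>"
proof -
  have "repr X \<Phi> x \<le> hom (\<psi> x) (\<Phi> \<psi>)"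
    unfolding repr_def using hom_range assms
    by (auto intro!: inf01_lower simp del: atLeastAtMost_iff)
  then show ?thesis using hom_adj C_range[OF X assms] repr_range[OF assms(2)] linear_range[OF assms(1)] by simp
qed

lemma le_repr:
  assumes "x \<in> ucar X" "w \<in> {0..1}" "\<And>\<psi>. \<psi> \<in> C X \<Longrightarrow> T (\<psi> x) w \<le> \<Phi> \<psi>"
  shows "w \<le> repr X \<Phi> x"
proof -
  have "(\<lambda>\<psi>. hom (\<psi> x) (\<Phi> \<psi>)) ` C X \<subseteq> {0..1}" using hom_range by auto
  then have "w \<le> inf01 ((\<lambda>\<psi>. hom (\<psi> x) (\<Phi> \<psi>)) ` C X)"
    using assms C_range[OF X _ assms(1)] linear_range
    by (subst le_inf01_iff) (auto simp: hom_adj[symmetric])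
  then show ?thesis using assms(1) by (simp add: repr_def)
qed

lemma repr_le:
  assumes "\<psi> \<in> C X" "x \<in> ucar X" "\<psi> x = 1"
  shows "repr X \<Phi> x \<le> \<Phi> \<psi>"
  using T_repr_le[OF assms(1,2)] repr_range[OF assms(2)] assms(3) by simp

text \<open>If \<psi> nearly attains the infimum at x, then \<open>hom (\<psi> x)\<close> applied to
  \<psi> has the value 1 at x and, by \<open>linear_hom_le\<close>, does at least as well. Witnesses
  that share the value 1 at x can be combined by \<open>min\<close>. The factor s allows the
  approximation to take place inside a product.\<close>

lemma repr_normalized:
  assumes x: "x \<in> ucar X" and s: "s \<in> {0..1}" and less: "T s (repr X \<Phi> x) < c"
  shows "\<exists>p\<in>C X. p x = 1 \<and> T s (\<Phi> p) < c"
proof -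
  have "T s (inf01 ((\<lambda>\<psi>. hom (\<psi> x) (\<Phi> \<psi>)) ` C X)) < c"
    using less x by (simp add: repr_def)
  then consider "T s 1 < c" | \<psi> where "\<psi> \<in> C X" "T s (hom (\<psi> x) (\<Phi> \<psi>)) < c"
    using T_inf01_less[OF s, of "(\<lambda>\<psi>. hom (\<psi> x) (\<Phi> \<psi>)) ` C X" c] hom_range by blast
  then show ?thesis
  proof cases
    case 1
    have one: "(\<lambda>x\<in>ucar X. 1) \<in> C X" by (intro C_const X) auto
    have "T s (\<Phi> (\<lambda>x\<in>ucar X. 1)) \<le> s"
      by (intro T_le_left s linear_range one)
    with 1 s show ?thesis by (intro bexI[OF _ one]) (use x in auto)
  next
    case 2
    let ?p = "\<lambda>z\<in>ucar X. hom (\<psi> x) (\<psi> z)"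
    have u: "\<psi> x \<in> {0..1}" by (rule C_range[OF X 2(1) x])
    have p: "?p \<in> C X" by (intro C_hom X 2 u)
    have "T s (\<Phi> ?p) \<le> T s (hom (\<psi> x) (\<Phi> \<psi>))"
      by (intro T_mono s linear_range p hom_range linear_hom_le 2 u order_refl)
    with 2 u show ?thesis by (intro bexI[OF _ p]) (use x in \<open>auto simp: hom_eq_one_iff\<close>)
  qed
qed

text \<open>By \<open>le_repr\<close> it suffices to compare with \<open>\<Phi> \<psi>\<close>. The
  order condition on \<psi> moves the evaluation from x to the limit of \<open>\<xx>\<close>, and
  there the bound is the limit of \<open>T_repr_le\<close> along \<open>\<xx>\<close>, since \<psi>
  is continuous.\<close>

lemma repr_in_V: "repr X \<Phi> \<in> V X"
  unfolding mem_V[OF X]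
proof (intro conjI ballI)
  show "repr X \<Phi> \<in> ucar X \<rightarrow>\<^sub>E {0..1}"
    using repr_range by (intro PiE_I) (auto simp: repr_def)
  fix \<xx> x assume x: "\<xx> \<in> ultrafilters (ucar X)" "x \<in> ucar X"
  let ?s = "xi (filtermap (repr X \<Phi>) \<xx>)"
  let ?a = "uar0 X (conv X \<xx>) x"
  note s = xi_tendsto[OF x(1) repr_range]
  note cx = conv_in[OF X x(1)]
  note a = uar0_range[OF X cx x(2)]
  show "T ?s ?a \<le> repr X \<Phi> x"
  proof (rule le_repr)
    fix \<psi> assume \<psi>: "\<psi> \<in> C X"
    have "T (\<psi> x) (T ?s ?a) = T (T ?a (\<psi> x)) ?s"
      using T_assoc[OF s(1) a C_range[OF X \<psi> x(2)]] by (simp only: T_commute)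
    also have "\<dots> \<le> T (\<psi> (conv X \<xx>)) ?s"
      using s a C_range[OF X \<psi>] x cx by (intro T_mono T_range C_le[OF X \<psi>]) auto
    also have "\<dots> \<le> \<Phi> \<psi>"
    proof (rule tendsto_upperbound)
      show "((\<lambda>z. T (\<psi> z) (repr X \<Phi> z)) \<longlongrightarrow> T (\<psi> (conv X \<xx>)) ?s) \<xx>"
        by (intro T_tendsto s C_tendsto[OF X \<psi> x(1)])
      show "\<forall>\<^sub>F z in \<xx>. T (\<psi> z) (repr X \<Phi> z) \<le> \<Phi> \<psi>"
        using ultrafilters_D(2)[OF x(1)] by eventually_elim (rule T_repr_le[OF \<psi>])
    qed (use ultrafilters_D[OF x(1)] in auto)
    finally show "T (\<psi> x) (T ?s ?a) \<le> \<Phi> \<psi>" .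
  qed (use x s a T_range in auto)
qed

text \<open>The existence half of the Riesz correspondence. One inequality is
  \<open>T_repr_le\<close>. For the other, compactness yields, for each c above the pairing, some q
  in CX that dominates \<psi> on all of X and satisfies \<open>\<Phi> q \<le> c\<close>; then \<Phi>
  is monotone. On a union the two majorants are joined.\<close>

lemma pairing_repr:
  assumes \<psi>: "\<psi> \<in> C X"
  shows "pairing X \<psi> (repr X \<Phi>) = \<Phi> \<psi>"
proof (rule antisym)
  let ?A = "(\<lambda>x. T (\<psi> x) (repr X \<Phi> x)) ` ucar X"
  have A: "?A \<subseteq> {0..1}" using T_range C_range[OF X \<psi>] repr_range by auto
  show "pairing X \<psi> (repr X \<Phi>) \<le> \<Phi> \<psi>"
    unfolding pairing_def using T_repr_le[OF \<psi>] linear_range[OF \<psi>]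
    by (subst sup01_le_iff[OF A]) auto
  show "\<Phi> \<psi> \<le> pairing X \<psi> (repr X \<Phi>)"
  proof (rule dense_ge)
    fix c assume c: "pairing X \<psi> (repr X \<Phi>) < c"
    have pos: "0 < c" using c sup01_range[OF A] by (simp add: pairing_def)
    define Q where "Q W \<longleftrightarrow> (\<exists>q\<in>C X. \<Phi> q \<le> c \<and> (\<forall>z\<in>W \<inter> ucar X. \<psi> z \<le> q z))" for W
    have "Q (ucar X)"
    proof (rule ultrafilter_cover)
      have zero: "(\<lambda>x\<in>ucar X. 0) \<in> C X" by (intro C_const X) auto
      show "Q {}" unfolding Q_def
        using linear_const_le[of 0] pos by (intro bexI[OF _ zero]) auto
    next
      fix A B assume "Q A" "Q B"
      then obtain p q where pq: "p \<in> C X" "q \<in> C X" "\<Phi> p \<le> c" "\<Phi> q \<le> c"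
        and le: "\<forall>z\<in>A \<inter> ucar X. \<psi> z \<le> p z" "\<forall>z\<in>B \<inter> ucar X. \<psi> z \<le> q z"
        unfolding Q_def by auto
      have j: "join X 1 p 1 q \<in> C X" by (intro C_join X pq) auto
      have "\<Phi> (join X 1 p 1 q) \<le> c"
        using pq linear_range by (subst linear_join) auto
      moreover have "\<psi> z \<le> join X 1 p 1 q z" if "z \<in> (A \<union> B) \<inter> ucar X" for z
        using that le C_range[OF X pq(1)] C_range[OF X pq(2)] by (auto simp: join_def le_max_iff_disj)
      ultimately show "Q (A \<union> B)" unfolding Q_def using j by blast
    next
      show "Q B" if "Q A" "B \<subseteq> A" for A B using that unfolding Q_def by blast
    next
      fix \<yy> assume y: "\<yy> \<in> ultrafilters (ucar X)"
      define y0 where "y0 = conv X \<yy>"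
      have y0: "y0 \<in> ucar X" unfolding y0_def by (rule conv_in[OF X y])
      note s = C_range[OF X \<psi> y0]
      have "T (\<psi> y0) (repr X \<Phi> y0) < c"
        using c sup01_upper[OF A, of "T (\<psi> y0) (repr X \<Phi> y0)"] y0 by (auto simp: pairing_def)
      then obtain p where p: "p \<in> C X" "p y0 = 1" "T (\<psi> y0) (\<Phi> p) < c"
        using repr_normalized[OF y0 s] by blast
      then obtain e where e: "0 < e" "e < 1" "T (min 1 (\<psi> y0 + e)) (hom (1 - e) (\<Phi> p)) < c"
        using T_hom_perturb[OF s linear_range[OF p(1)]] by blast
      \<comment> \<open>The local majorant is \<open>hom ?u\<close> of p, scaled by
        \<open>?v\<close>. Since p y0 = 1, near y0 the value of p exceeds \<open>?u\<close>, so the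
        \<open>hom\<close> factor is 1 and the majorant equals \<open>?v\<close>, while \<psi> stays
        below \<psi> y0 + e. The choice of e keeps the functional of the majorant below c.\<close>
      let ?v = "min 1 (\<psi> y0 + e)" and ?u = "1 - e"
      have uv: "?v \<in> {0..1}" "?u \<in> {0..1}" using e s by auto
      let ?h = "\<lambda>z\<in>ucar X. hom ?u (p z)"
      have h: "?h \<in> C X" by (intro C_hom X p uv)
      let ?q = "\<lambda>z\<in>ucar X. T ?v (?h z)"
      have q: "?q \<in> C X" by (rule C_scale[OF h uv(1)])
      have "\<Phi> ?q = T ?v (\<Phi> ?h)" by (rule linear_scale[OF h uv(1)])
      also have "\<dots> \<le> T ?v (hom ?u (\<Phi> p))"
        by (intro T_mono uv linear_range h hom_range linear_hom_le p order_refl)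
      finally have le: "\<Phi> ?q \<le> c" using e by simp
      let ?W = "{z \<in> ucar X. \<psi> z < \<psi> y0 + e \<and> ?u < p z}"
      have "\<psi> z \<le> ?q z" if z: "z \<in> ?W" for z
      proof -
        have "hom ?u (p z) = 1"
          using z C_range[OF X p(1), of z] uv by (subst hom_eq_one_iff) auto
        then show ?thesis using z uv C_range[OF X \<psi>, of z] by auto
      qed
      then have "Q ?W" unfolding Q_def using le by (intro bexI[OF _ q]) auto
      moreover have "mem_filter ?W \<yy>"
      proof -
        have "\<forall>\<^sub>F z in \<yy>. \<psi> z < \<psi> y0 + e"
          by (rule order_tendstoD(2)[OF C_tendsto[OF X \<psi> y]]) (use e in \<open>simp add: y0_def\<close>)
        moreover have "\<forall>\<^sub>F z in \<yy>. ?u < p z"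
          by (rule order_tendstoD(1)[OF C_tendsto[OF X p(1) y]]) (use e p in \<open>simp add: y0_def\<close>)
        ultimately show ?thesis using ultrafilters_D(2)[OF y] by eventually_elim simp
      qed
      ultimately show "\<exists>A. Q A \<and> mem_filter A \<yy>" by blast
    qed
    then obtain q where "q \<in> C X" "\<Phi> q \<le> c" "\<And>z. z \<in> ucar X \<Longrightarrow> \<psi> z \<le> q z"
      unfolding Q_def by auto
    then show "\<Phi> \<psi> \<le> c" using linear_mono[OF \<psi>, of q] by force
  qed
qed

end

section \<open>The Vietoris object\<close>

lemma
  assumes p: "\<And>x. x \<in> ucar X \<Longrightarrow> p x \<in> {0..1}" and h: "\<And>x. x \<in> ucar X \<Longrightarrow> h x \<in> {0..1}"
  shows pairing_range: "pairing X p h \<in> {0..1}"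
    and pairing_le_iff: "0 \<le> w \<Longrightarrow> pairing X p h \<le> w \<longleftrightarrow> (\<forall>x\<in>ucar X. T (p x) (h x) \<le> w)"
    and pairing_upper: "x \<in> ucar X \<Longrightarrow> T (p x) (h x) \<le> pairing X p h"
    and T_pairing_le_iff: "u \<in> {0..1} \<Longrightarrow> w \<in> {0..1} \<Longrightarrow>
      T u (pairing X p h) \<le> w \<longleftrightarrow> (\<forall>x\<in>ucar X. T u (T (p x) (h x)) \<le> w)"
proof -
  have A: "(\<lambda>x. T (p x) (h x)) ` ucar X \<subseteq> {0..1}" using T_range p h by auto
  show "pairing X p h \<in> {0..1}" unfolding pairing_def by (rule sup01_range[OF A])
  show "0 \<le> w \<Longrightarrow> pairing X p h \<le> w \<longleftrightarrow> (\<forall>x\<in>ucar X. T (p x) (h x) \<le> w)"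
    unfolding pairing_def using sup01_le_iff[OF A] by auto
  show "x \<in> ucar X \<Longrightarrow> T (p x) (h x) \<le> pairing X p h"
    unfolding pairing_def using sup01_upper[OF A] by auto
  show "T u (pairing X p h) \<le> w \<longleftrightarrow> (\<forall>x\<in>ucar X. T u (T (p x) (h x)) \<le> w)"
    if "u \<in> {0..1}" "w \<in> {0..1}"
    unfolding pairing_def using T_sup01_le_iff[OF that(1) A that(2)] by auto
qed

lemma linear_pairing:
  assumes X: "obj X" and h: "\<And>x. x \<in> ucar X \<Longrightarrow> h x \<in> {0..1}"
  shows "linear X (\<lambda>\<psi>. pairing X \<psi> h)"
  unfolding linear_def
proof (intro conjI ballI)
  show "pairing X p h \<in> {0..1}" if "p \<in> C X" for p
    by (intro pairing_range C_range[OF X that] h)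
  fix p q and u v :: real
  assume pq: "p \<in> C X" "q \<in> C X" and u: "u \<in> {0..1}" and v: "v \<in> {0..1}"
  note r = C_range[OF X pq(1)] C_range[OF X pq(2)]
  note j = C_join[OF X pq u v]
  note jr = C_range[OF X j]
  have expand: "T (join X u p v q x) (h x) = max (T u (T (p x) (h x))) (T v (T (q x) (h x)))"
    if x: "x \<in> ucar X" for x
  proof -
    have "T (join X u p v q x) (h x) = T (h x) (max (T u (p x)) (T v (q x)))"
      using x by (simp add: join_def T_commute)
    also have "\<dots> = max (T (h x) (T u (p x))) (T (h x) (T v (q x)))"
      by (intro T_max h x T_range u v r)
    also have "T (h x) (T u (p x)) = T u (T (p x) (h x))"
      using T_assoc[OF u r(1)[OF x] h[OF x]] by (simp only: T_commute)
    also have "T (h x) (T v (q x)) = T v (T (q x) (h x))"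
      using T_assoc[OF v r(2)[OF x] h[OF x]] by (simp only: T_commute)
    finally show ?thesis .
  qed
  \<comment> \<open>Two numbers in the unit interval with the same upper bounds w there are equal,
    and boundedness by w can be checked at each x separately.\<close>
  have le_iff: "pairing X (join X u p v q) h \<le> w \<longleftrightarrow>
      max (T u (pairing X p h)) (T v (pairing X q h)) \<le> w" if w: "w \<in> {0..1}" for w
    using w pairing_le_iff[of X "join X u p v q" h w, OF jr h]
      T_pairing_le_iff[of X p h u w, OF r(1) h u w] T_pairing_le_iff[of X q h v w, OF r(2) h v w]
    by (auto simp: expand)
  have "max (T u (pairing X p h)) (T v (pairing X q h)) \<in> {0..1}"
    using T_range[OF u pairing_range[of X p h, OF r(1) h]] T_range[OF v pairing_range[of X q h, OF r(2) h]]
    by (simp add: max_def)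
  with le_iff le_iff[OF pairing_range[of X "join X u p v q" h, OF jr h]]
  show "pairing X (join X u p v q) h = max (T u (pairing X p h)) (T v (pairing X q h))"
    by (meson order_antisym order_refl)
qed

lemma linear_eval: "obj X \<Longrightarrow> x \<in> ucar X \<Longrightarrow> linear X (\<lambda>\<psi>. \<psi> x)"
  by (auto simp: linear_def join_def C_range simp del: atLeastAtMost_iff)

text \<open>Here \<open>xi\<close> is the limit of the numbers \<open>\<Psi> h \<psi>\<close> along
  F, and \<open>T\<close> and \<open>max\<close> are continuous, so the equation of linearity passes
  to the limit.\<close>

lemma linear_xi:
  assumes F: "F \<in> ultrafilters W" and lin: "\<And>h. h \<in> W \<Longrightarrow> linear X (\<Psi> h)"
    and X: "obj X"
  shows "linear X (\<lambda>\<psi>. xi (filtermap (\<lambda>h. \<Psi> h \<psi>) F))"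
  unfolding linear_def
proof (intro conjI ballI)
  have r: "\<Psi> h p \<in> {0..1}" if "h \<in> W" "p \<in> C X" for h p
    using lin that by (auto simp: linear_def)
  show "xi (filtermap (\<lambda>h. \<Psi> h p) F) \<in> {0..1}" if "p \<in> C X" for p
    using xi_tendsto(1)[OF F, of "\<lambda>h. \<Psi> h p"] r that by blast
  fix p q and u v :: real
  assume pq: "p \<in> C X" "q \<in> C X" and u: "u \<in> {0..1}" and v: "v \<in> {0..1}"
  show "xi (filtermap (\<lambda>h. \<Psi> h (join X u p v q)) F) =
    max (T u (xi (filtermap (\<lambda>h. \<Psi> h p) F))) (T v (xi (filtermap (\<lambda>h. \<Psi> h q) F)))"
  proof (rule xi_eqI[OF F])
    show "\<Psi> h (join X u p v q) \<in> {0..1}" if "h \<in> W" for h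
      by (intro r that C_join X pq u v)
    have "((\<lambda>h. max (T u (\<Psi> h p)) (T v (\<Psi> h q))) \<longlongrightarrow>
      max (T u (xi (filtermap (\<lambda>h. \<Psi> h p) F))) (T v (xi (filtermap (\<lambda>h. \<Psi> h q) F)))) F"
      by (intro tendsto_max T_tendsto tendsto_const xi_tendsto(2)[OF F] r pq)
    moreover have "\<forall>\<^sub>F h in F. max (T u (\<Psi> h p)) (T v (\<Psi> h q)) = \<Psi> h (join X u p v q)"
      using ultrafilters_D(2)[OF F]
      by eventually_elim (use lin pq u v in \<open>simp add: linear_def\<close>)
    ultimately show "((\<lambda>h. \<Psi> h (join X u p v q)) \<longlongrightarrow>
      max (T u (xi (filtermap (\<lambda>h. \<Psi> h p) F))) (T v (xi (filtermap (\<lambda>h. \<Psi> h q) F)))) F"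
      by (rule Lim_transform_eventually)
  qed
qed

text \<open>This is where cogeneration enters: the hom out of x represents evaluation at x. Combined
  with \<open>repr_normalized\<close> it supplies test functions that approximate
  hom-values.\<close>

lemma uar0_eq_repr:
  assumes "obj X" "x \<in> ucar X" "y \<in> ucar X"
  shows "uar0 X x y = repr X (\<lambda>\<psi>. \<psi> x) y"
  using assms by (simp add: obj_def cogenerated_def repr_def)

section \<open>Limits of ultrafilters on VX\<close>

context
  fixes X :: "'a ucat" and \<pp> :: "('a \<Rightarrow> real) filter"
  assumes X: "obj X" and p: "\<pp> \<in> ultrafilters (V X)"
begin

text \<open>The limit superior of the evaluation of h at y along the product of the filters
  \<open>\<pp>\<close> and \<open>\<xx>\<close>; it is the inner term of
  \<open>vietoris_conv\<close>.\<close>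

definition gap :: "'a filter \<Rightarrow> real" where
  "gap \<xx> = inf01 {sup01 {h y | h y. h \<in> P \<and> y \<in> F} | P F.
     P \<subseteq> V X \<and> mem_filter P \<pp> \<and> F \<subseteq> ucar X \<and> mem_filter F \<xx>}"

lemma gap_sup_subset: "P \<subseteq> V X \<Longrightarrow> F \<subseteq> ucar X \<Longrightarrow> {h y | h y. h \<in> P \<and> y \<in> F} \<subseteq> {0..1}"
  using V_range[OF X] by blast

lemma gap_subset: "{sup01 {h y | h y. h \<in> P \<and> y \<in> F} | P F.
     P \<subseteq> V X \<and> mem_filter P \<pp> \<and> F \<subseteq> ucar X \<and> mem_filter F \<xx>} \<subseteq> {0..1}"
  using sup01_range[OF gap_sup_subset] by blast

lemma gap_range: "gap \<xx> \<in> {0..1}"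
  unfolding gap_def by (rule inf01_range[OF gap_subset])

lemma gap_leI:
  assumes "mem_filter P \<pp>" "P \<subseteq> V X" "mem_filter F \<xx>" "F \<subseteq> ucar X" "0 \<le> c"
    "\<And>h y. h \<in> P \<Longrightarrow> y \<in> F \<Longrightarrow> h y \<le> c"
  shows "gap \<xx> \<le> c"
proof -
  have "gap \<xx> \<le> sup01 {h y | h y. h \<in> P \<and> y \<in> F}"
    unfolding gap_def by (rule inf01_lower[OF gap_subset]) (use assms in blast)
  also have "\<dots> \<le> c" using assms by (subst sup01_le_iff[OF gap_sup_subset]) auto
  finally show ?thesis .
qed

lemma gap_lessD:
  assumes s: "s \<in> {0..1}" "T (gap \<xx>) s < c" and x: "\<xx> \<in> ultrafilters (ucar X)"
  shows "\<exists>P F t. mem_filter P \<pp> \<and> P \<subseteq> V X \<and> mem_filter F \<xx> \<and> F \<subseteq> ucar X \<and> t \<in> {0..1} \<and>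
    (\<forall>h\<in>P. \<forall>y\<in>F. h y \<le> t) \<and> T t s < c"
proof -
  define A where "A = {sup01 {h y | h y. h \<in> P \<and> y \<in> F} | P F.
     P \<subseteq> V X \<and> mem_filter P \<pp> \<and> F \<subseteq> ucar X \<and> mem_filter F \<xx>}"
  have A: "A \<subseteq> {0..1}" unfolding A_def by (rule gap_subset)
  have "T s (inf01 A) < c" using s(2) by (simp only: T_commute[of s] gap_def A_def)
  then consider "T s 1 < c" | v where "v \<in> A" "T s v < c"
    using T_inf01_less[OF s(1) A] by blast
  then show ?thesis
  proof cases
    case 1
    \<comment> \<open>The element 1 added by \<open>inf01\<close> corresponds to the trivial choice:
      all of VX, all of X and the bound 1.\<close>
    then show ?thesis
      using V_range[OF X] ultrafilters_D(2)[OF p] ultrafilters_D(2)[OF x]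
      by (intro exI[of _ "V X"] exI[of _ "ucar X"] exI[of _ 1]) (auto simp: T_commute)
  next
    case 2
    then obtain P F where PF: "v = sup01 {h y | h y. h \<in> P \<and> y \<in> F}"
      "P \<subseteq> V X" "mem_filter P \<pp>" "F \<subseteq> ucar X" "mem_filter F \<xx>" unfolding A_def by blast
    have "\<forall>h\<in>P. \<forall>y\<in>F. h y \<le> v"
      unfolding PF(1) using sup01_upper[OF gap_sup_subset[OF PF(2,4)]] by blast
    moreover have "v \<in> {0..1}" unfolding PF(1) by (rule sup01_range[OF gap_sup_subset[OF PF(2,4)]])
    ultimately show ?thesis using 2 PF
      by (intro exI[of _ P] exI[of _ F] exI[of _ v]) (simp add: T_commute)
  qed
qed

lemma vietoris_conv_gap:
  "x \<in> ucar X \<Longrightarrow> vietoris_conv T X \<pp> x =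
     sup01 ((\<lambda>\<xx>. T (gap \<xx>) (uar0 X (conv X \<xx>) x)) ` ultrafilters (ucar X))"
  by (simp add: vietoris_conv_def gap_def)

lemma pairing_V_range: "\<psi> \<in> C X \<Longrightarrow> h \<in> V X \<Longrightarrow> pairing X \<psi> h \<in> {0..1}"
  by (intro pairing_range C_range[OF X] V_range[OF X])

lemma linear_xi_pairing: "linear X (\<lambda>\<psi>. xi (filtermap (pairing X \<psi>) \<pp>))"
  by (intro linear_xi[OF p _ X] linear_pairing X V_range[OF X])

text \<open>Let c exceed the limit of the pairings and let s lie below the value of \<psi> at the
  limit of \<open>\<xx>\<close>. For h with pairing below c and y with s < \<psi> y one has
  \<open>T s (h y) \<le> c\<close>, so \<open>gap\<close> is at most \<open>hom s c\<close>.
  Strictness of s makes s < \<psi> y hold eventually; afterwards s tends to that value from the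
  left.\<close>

lemma T_gap_le:
  assumes \<psi>: "\<psi> \<in> C X" and x: "\<xx> \<in> ultrafilters (ucar X)"
  shows "T (\<psi> (conv X \<xx>)) (gap \<xx>) \<le> xi (filtermap (pairing X \<psi>) \<pp>)"
proof (rule dense_ge)
  have xi: "xi (filtermap (pairing X \<psi>) \<pp>) \<in> {0..1}"
      "(pairing X \<psi> \<longlongrightarrow> xi (filtermap (pairing X \<psi>) \<pp>)) \<pp>"
    by (intro xi_tendsto[OF p] pairing_V_range[OF \<psi>]; assumption)+
  have cx: "conv X \<xx> \<in> ucar X" by (rule conv_in[OF X x])
  fix c assume c: "xi (filtermap (pairing X \<psi>) \<pp>) < c"
  show "T (\<psi> (conv X \<xx>)) (gap \<xx>) \<le> c"
  proof (cases "c \<le> 1")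
    case False
    then show ?thesis using T_range[OF C_range[OF X \<psi> cx] gap_range, of \<xx>] by simp
  next
    case True
    have c01: "c \<in> {0..1}" using True c xi by auto
    let ?P = "{h \<in> V X. pairing X \<psi> h < c}"
    have P: "mem_filter ?P \<pp>"
      using order_tendstoD(2)[OF xi(2) c] ultrafilters_D(2)[OF p] by eventually_elim simp
    have less: "gap \<xx> \<le> hom s c" if s: "s \<in> {0..1}" "s < \<psi> (conv X \<xx>)" for s
    proof (rule gap_leI[OF P])
      show "mem_filter {y \<in> ucar X. s < \<psi> y} \<xx>"
        using order_tendstoD(1)[OF C_tendsto[OF X \<psi> x] s(2)] ultrafilters_D(2)[OF x]
        by eventually_elim simp
      fix h y assume h: "h \<in> ?P" and y: "y \<in> {y \<in> ucar X. s < \<psi> y}"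
      have "T s (h y) \<le> T (\<psi> y) (h y)"
        using h y s C_range[OF X \<psi>, of y] V_range[OF X, of h y] by (intro T_mono) auto
      also have "\<dots> \<le> pairing X \<psi> h"
        using h y by (intro pairing_upper C_range[OF X \<psi>] V_range[OF X]) auto
      finally show "h y \<le> hom s c"
        using h y s c01 V_range[OF X, of h y] by (subst hom_adj[symmetric]) auto
    qed (use hom_range[of s c] in auto)
    show ?thesis
    \<comment> \<open>At the value 0 there is no s in the unit interval from which to approach from
      the left.\<close>
    proof (cases "\<psi> (conv X \<xx>) = 0")
      case True
      then show ?thesis using gap_range c01 by simp
    next
      case False
      then have pos: "0 < \<psi> (conv X \<xx>)" using C_range[OF X \<psi> cx] by simp
      show ?thesis
      proof (rule tendsto_upperbound)
        show "((\<lambda>s. T s (gap \<xx>)) \<longlongrightarrow> T (\<psi> (conv X \<xx>)) (gap \<xx>)) (at_left (\<psi> (conv X \<xx>)))"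
          by (intro T_tendsto tendsto_intros)
        have le: "T s (gap \<xx>) \<le> c" if s: "s \<in> {0<..<\<psi> (conv X \<xx>)}" for s
        proof -
          have s01: "s \<in> {0..1}" using s C_range[OF X \<psi> cx] by auto
          then show ?thesis using less[OF s01] s hom_adj[OF s01 gap_range c01] by simp
        qed
        show "\<forall>\<^sub>F s in at_left (\<psi> (conv X \<xx>)). T s (gap \<xx>) \<le> c"
          using eventually_at_left_real[OF pos] by (rule eventually_mono) (rule le)
      qed simp
    qed
  qed
qed

text \<open>The inequality from left to right is \<open>T_gap_le\<close> together with the order
  condition on \<psi>. Conversely, for c above the supremum, compactness gives one \<psi> with
  \<psi> x = 1 and one member P of \<open>\<pp>\<close> such that
  \<open>T (\<psi> z) (h z) \<le> c\<close> for all h in P and all z. Then the pairings with \<psi>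
  are at most c on P, hence also in the limit, and \<psi> bounds the infimum in
  \<open>repr\<close>.\<close>

lemma vietoris_conv_eq: "vietoris_conv T X \<pp> = repr X (\<lambda>\<psi>. xi (filtermap (pairing X \<psi>) \<pp>))"
proof
  fix x
  let ?\<Phi> = "\<lambda>\<psi>. xi (filtermap (pairing X \<psi>) \<pp>)"
  note lin = linear_xi_pairing
  show "vietoris_conv T X \<pp> x = repr X ?\<Phi> x"
  proof (cases "x \<in> ucar X")
    case False
    then show ?thesis by (simp add: vietoris_conv_def repr_def)
  next
    case x: True
    let ?A = "(\<lambda>\<xx>. T (gap \<xx>) (uar0 X (conv X \<xx>) x)) ` ultrafilters (ucar X)"
    have a: "uar0 X (conv X \<xx>) x \<in> {0..1}" if "\<xx> \<in> ultrafilters (ucar X)" for \<xx>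
      by (intro uar0_range X conv_in that x)
    have A: "?A \<subseteq> {0..1}" using T_range[OF gap_range a] by blast
    show ?thesis unfolding vietoris_conv_gap[OF x]
    proof (rule antisym)
      show "sup01 ?A \<le> repr X ?\<Phi> x"
        unfolding sup01_le_iff[OF A repr_range[OF X lin x, unfolded atLeastAtMost_iff, THEN conjunct1]]
      proof clarify
        fix \<xx> assume f: "\<xx> \<in> ultrafilters (ucar X)"
        show "T (gap \<xx>) (uar0 X (conv X \<xx>) x) \<le> repr X ?\<Phi> x"
        proof (rule le_repr[OF X lin x T_range[OF gap_range a[OF f]]])
          fix \<psi> assume \<psi>: "\<psi> \<in> C X"
          note r = C_range[OF X \<psi> x]
          have "T (\<psi> x) (T (gap \<xx>) (uar0 X (conv X \<xx>) x)) = T (T (uar0 X (conv X \<xx>) x) (\<psi> x)) (gap \<xx>)"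
            using T_assoc[OF gap_range[of \<xx>] a[OF f] r] by (simp only: T_commute)
          also have "\<dots> \<le> T (\<psi> (conv X \<xx>)) (gap \<xx>)"
            by (intro T_mono T_range a[OF f] r gap_range C_range[OF X \<psi>] conv_in[OF X f] C_le[OF X \<psi>] x order_refl)
          also have "\<dots> \<le> ?\<Phi> \<psi>" by (rule T_gap_le[OF \<psi> f])
          finally show "T (\<psi> x) (T (gap \<xx>) (uar0 X (conv X \<xx>) x)) \<le> ?\<Phi> \<psi>" .
        qed
      qed
      show "repr X ?\<Phi> x \<le> sup01 ?A"
      proof (rule dense_ge)
        fix c assume c: "sup01 ?A < c"
        have pos: "0 < c" using c sup01_range[OF A] by auto
        define Q where "Q W \<longleftrightarrow> (\<exists>\<psi>\<in>C X. \<psi> x = 1 \<and>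
          (\<exists>P. mem_filter P \<pp> \<and> P \<subseteq> V X \<and> (\<forall>h\<in>P. \<forall>z\<in>W \<inter> ucar X. T (\<psi> z) (h z) \<le> c)))" for W
        have "Q (ucar X)"
        proof (rule ultrafilter_cover)
          have one: "(\<lambda>x\<in>ucar X. 1) \<in> C X" by (intro C_const X) auto
          show "Q {}" unfolding Q_def
            by (rule bexI[OF _ one]) (use x ultrafilters_D(2)[OF p] in auto)
        next
          fix A B assume "Q A" "Q B"
          then obtain f g P P' where fg: "f \<in> C X" "g \<in> C X" "f x = 1" "g x = 1"
            and P: "mem_filter P \<pp>" "P \<subseteq> V X" "mem_filter P' \<pp>" "P' \<subseteq> V X"
            and le: "\<And>h z. h \<in> P \<Longrightarrow> z \<in> A \<Longrightarrow> z \<in> ucar X \<Longrightarrow> T (f z) (h z) \<le> c"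
              "\<And>h z. h \<in> P' \<Longrightarrow> z \<in> B \<Longrightarrow> z \<in> ucar X \<Longrightarrow> T (g z) (h z) \<le> c"
            unfolding Q_def by (auto 4 0)
          \<comment> \<open>The minimum keeps the value 1 at x and can only decrease the products;
            the two members of \<open>\<pp>\<close> are intersected.\<close>
          let ?m = "\<lambda>z\<in>ucar X. min (f z) (g z)"
          have m: "?m \<in> C X" by (intro C_min X fg)
          have "T (?m z) (h z) \<le> c" if h: "h \<in> P \<inter> P'" and z: "z \<in> (A \<union> B) \<inter> ucar X" for h z
          proof -
            have zX: "z \<in> ucar X" using z by simp
            have hr: "h z \<in> {0..1}" using V_range[OF X _ zX] h P by blast
            note r = C_range[OF X m zX] C_range[OF X fg(1) zX] C_range[OF X fg(2) zX]
            have "T (?m z) (h z) \<le> T (f z) (h z)" "T (?m z) (h z) \<le> T (g z) (h z)"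
              by (intro T_mono r hr order_refl; use zX in simp)+
            then show ?thesis using le[of h z] h z by fastforce
          qed
          moreover have "mem_filter (P \<inter> P') \<pp>" using P by (simp add: eventually_conj)
          moreover have "?m x = 1" using fg x by simp
          ultimately show "Q (A \<union> B)" unfolding Q_def using P
            by (intro bexI[OF _ m] conjI exI[of _ "P \<inter> P'"]) auto
        next
          show "Q B" if "Q A" "B \<subseteq> A" for A B using that unfolding Q_def by blast
        next
          fix \<yy> assume y: "\<yy> \<in> ultrafilters (ucar X)"
          note cy = conv_in[OF X y]
          have "T (gap \<yy>) (uar0 X (conv X \<yy>) x) < c"
            using c sup01_upper[OF A, of "T (gap \<yy>) (uar0 X (conv X \<yy>) x)"] y by auto
          then obtain P F t where P: "mem_filter P \<pp>" "P \<subseteq> V X" "mem_filter F \<yy>" "F \<subseteq> ucar X"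
            and t: "t \<in> {0..1}" "\<And>h y. h \<in> P \<Longrightarrow> y \<in> F \<Longrightarrow> h y \<le> t"
              "T t (uar0 X (conv X \<yy>) x) < c"
            using gap_lessD[OF a[OF y] _ y] by blast
          \<comment> \<open>By cogeneration the hom-value is the value at x of the map representing
            evaluation at \<open>conv X \<yy>\<close>, so a normalized test function approximates
            it.\<close>
          obtain \<psi> where \<psi>: "\<psi> \<in> C X" "\<psi> x = 1" "T t (\<psi> (conv X \<yy>)) < c"
            using repr_normalized[OF X linear_eval[OF X cy] x t(1)] t(3)
            by (auto simp: uar0_eq_repr[OF X cy x])
          let ?W = "{z \<in> F. T t (\<psi> z) < c}"
          have "mem_filter ?W \<yy>"
            using P(3) order_tendstoD(2)[OF T_tendsto[OF tendsto_const C_tendsto[OF X \<psi>(1) y]] \<psi>(3)]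
            by eventually_elim simp
          moreover have "Q ?W" unfolding Q_def
          proof (intro bexI[OF _ \<psi>(1)] conjI exI[of _ P] P \<psi> ballI)
            fix h z assume h: "h \<in> P" and z: "z \<in> ?W \<inter> ucar X"
            have "T (\<psi> z) (h z) \<le> T (\<psi> z) t"
              using h z t P(2) by (intro T_mono C_range[OF X \<psi>(1)] V_range[OF X] t) auto
            then show "T (\<psi> z) (h z) \<le> c" using z by (simp add: T_commute)
          qed
          ultimately show "\<exists>A. Q A \<and> mem_filter A \<yy>" by blast
        qed
        then obtain \<psi> P where \<psi>: "\<psi> \<in> C X" "\<psi> x = 1" and P: "mem_filter P \<pp>" "P \<subseteq> V X"
          and le: "\<And>h z. h \<in> P \<Longrightarrow> z \<in> ucar X \<Longrightarrow> T (\<psi> z) (h z) \<le> c"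
          unfolding Q_def by auto
        have "repr X ?\<Phi> x \<le> ?\<Phi> \<psi>" by (rule repr_le[OF X lin \<psi>(1) x \<psi>(2)])
        also have "\<dots> \<le> c"
        proof (rule tendsto_upperbound[OF xi_tendsto(2)[OF p pairing_V_range[OF \<psi>(1)]]])
          show "\<forall>\<^sub>F h in \<pp>. pairing X \<psi> h \<le> c"
            using P(1)
          proof eventually_elim
            case (elim h)
            then show ?case using P le pos
              by (subst pairing_le_iff[OF C_range[OF X \<psi>(1)] V_range[OF X]]) auto
          qed
        qed (use ultrafilters_D[OF p] in auto)
        finally show "repr X ?\<Phi> x \<le> c" .
      qed
    qed
  qed
qed

end

text \<open>Needed to read off the hom of VX, since \<open>uar0\<close> evaluates the structure at a
  principal ultrafilter. For the upper bound, \<open>gap\<close> is at most the limit of h along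
  \<open>\<xx>\<close>, and the defining condition of VX applies; the lower bound is the term of the
  supremum at the principal ultrafilter of x.\<close>

lemma vietoris_conv_unit:
  assumes X: "obj X" and h: "h \<in> V X"
  shows "vietoris_conv T X (ultra_unit h) = h"
proof
  fix x
  note p = ultrafilters_unit[OF h]
  note r = V_range[OF X h]
  show "vietoris_conv T X (ultra_unit h) x = h x"
  proof (cases "x \<in> ucar X")
    case False
    then show ?thesis using h mem_V[OF X, of h] by (auto simp: vietoris_conv_def PiE_iff extensional_def)
  next
    case x: True
    have a: "uar0 X (conv X \<xx>) x \<in> {0..1}" if "\<xx> \<in> ultrafilters (ucar X)" for \<xx>
      by (intro uar0_range X conv_in that x)
    have A: "(\<lambda>\<xx>. T (gap X (ultra_unit h) \<xx>) (uar0 X (conv X \<xx>) x)) ` ultrafilters (ucar X) \<subseteq> {0..1}"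
      using T_range[OF gap_range[OF X p] a] by blast
    show ?thesis unfolding vietoris_conv_gap[OF X p x]
    proof (rule antisym)
      have "T (gap X (ultra_unit h) \<xx>) (uar0 X (conv X \<xx>) x) \<le> h x"
        if f: "\<xx> \<in> ultrafilters (ucar X)" for \<xx>
      proof -
        have xi: "xi (filtermap h \<xx>) \<in> {0..1}" "(h \<longlongrightarrow> xi (filtermap h \<xx>)) \<xx>"
          by (intro xi_tendsto[OF f] r; assumption)+
        have "gap X (ultra_unit h) \<xx> \<le> xi (filtermap h \<xx>)"
        proof (rule dense_ge)
          fix c assume c: "xi (filtermap h \<xx>) < c"
          show "gap X (ultra_unit h) \<xx> \<le> c"
          proof (rule gap_leI[OF X p])
            show "mem_filter {h} (ultra_unit h)" by (simp add: ultra_unit_def eventually_principal)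
            show "mem_filter {y \<in> ucar X. h y < c} \<xx>"
              using order_tendstoD(2)[OF xi(2) c] ultrafilters_D(2)[OF f] by eventually_elim simp
          qed (use h c xi in auto)
        qed
        then have "T (gap X (ultra_unit h) \<xx>) (uar0 X (conv X \<xx>) x)
            \<le> T (xi (filtermap h \<xx>)) (uar0 X (conv X \<xx>) x)"
          by (intro T_mono gap_range[OF X p] xi a[OF f] order_refl)
        also have "\<dots> \<le> h x" using h f x by (simp add: mem_V[OF X])
        finally show ?thesis .
      qed
      then show "sup01 ((\<lambda>\<xx>. T (gap X (ultra_unit h) \<xx>) (uar0 X (conv X \<xx>) x)) ` ultrafilters (ucar X)) \<le> h x"
        using r[OF x] by (subst sup01_le_iff[OF A]) auto
    next
      let ?x = "ultra_unit x"
      have ux: "?x \<in> ultrafilters (ucar X)" by (rule ultrafilters_unit[OF x])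
      have "h x \<le> gap X (ultra_unit h) ?x"
        unfolding gap_def[OF X p]
      proof (subst le_inf01_iff[OF gap_subset[OF X p]])
        show "h x \<le> 1" using r[OF x] by simp
        show "\<forall>v\<in>{sup01 {h y | h y. h \<in> P \<and> y \<in> F} | P F.
           P \<subseteq> V X \<and> mem_filter P (ultra_unit h) \<and> F \<subseteq> ucar X \<and> mem_filter F (ultra_unit x)}. h x \<le> v"
        proof clarify
          fix P F assume PF: "P \<subseteq> V X" "mem_filter P (ultra_unit h)" "F \<subseteq> ucar X" "mem_filter F (ultra_unit x)"
          then have "h \<in> P" "x \<in> F" by (auto simp: ultra_unit_def eventually_principal)
          then show "h x \<le> sup01 {h y | h y. h \<in> P \<and> y \<in> F}"
            by (intro sup01_upper[OF gap_sup_subset[OF X p PF(1,3)]]) blast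
        qed
      qed
      also have "\<dots> = T (gap X (ultra_unit h) ?x) (uar0 X (conv X ?x) x)"
        using gap_range[OF X p] by (simp add: conv_ultra_unit[OF X x] uar0_refl[OF X x])
      also have "\<dots> \<le> sup01 ((\<lambda>\<xx>. T (gap X (ultra_unit h) \<xx>) (uar0 X (conv X \<xx>) x)) ` ultrafilters (ucar X))"
        by (rule sup01_upper[OF A]) (use ux in blast)
      finally show "h x \<le> \<dots>" .
    qed
  qed
qed

text \<open>The uniqueness half of the Riesz correspondence. At the principal ultrafilter of h, the
  Vietoris limit is h and the limit of the pairings is the pairing with h, so
  \<open>vietoris_conv_eq\<close> becomes this equation.\<close>

lemma repr_pairing:
  assumes X: "obj X" and h: "h \<in> V X"
  shows "repr X (\<lambda>\<psi>. pairing X \<psi> h) = h"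
proof -
  have "xi (filtermap (pairing X \<psi>) (ultra_unit h)) = pairing X \<psi> h" if "\<psi> \<in> C X" for \<psi>
    unfolding filtermap_ultra_unit by (intro xi_unit pairing_range C_range[OF X that] V_range[OF X h])
  then have "repr X (\<lambda>\<psi>. pairing X \<psi> h) = repr X (\<lambda>\<psi>. xi (filtermap (pairing X \<psi>) (ultra_unit h)))"
    by (simp add: repr_def cong: image_cong)
  also have "\<dots> = h"
    using vietoris_conv_eq[OF X ultrafilters_unit[OF h]] vietoris_conv_unit[OF X h] by simp
  finally show ?thesis .
qed

lemma V_eqI:
  assumes X: "obj X" and "h \<in> V X" "k \<in> V X"
    and "\<And>\<psi>. \<psi> \<in> C X \<Longrightarrow> pairing X \<psi> h = pairing X \<psi> k"
  shows "h = k"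
proof -
  have "repr X (\<lambda>\<psi>. pairing X \<psi> h) = repr X (\<lambda>\<psi>. pairing X \<psi> k)"
    using assms(4) by (simp add: repr_def cong: image_cong)
  then show ?thesis using repr_pairing[OF X] assms by simp
qed

section \<open>The order and convergence of the Vietoris object\<close>

lemma ucar_vietoris [simp]: "ucar (vietoris T X) = V X"
  by (simp add: vietoris_def)

lemma uar0_vietoris:
  "obj X \<Longrightarrow> h \<in> V X \<Longrightarrow> uar0 (vietoris T X) h k = inf01 ((\<lambda>x. hom (k x) (h x)) ` ucar X)"
  by (simp add: uar0_eq vietoris_def vietoris_conv_unit)

lemma le_uar0_vietoris_iff:
  assumes X: "obj X" and h: "h \<in> V X" and k: "k \<in> V X" and w: "w \<in> {0..1}"
  shows "w \<le> uar0 (vietoris T X) h k \<longleftrightarrow> (\<forall>x\<in>ucar X. T (k x) w \<le> h x)"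
  unfolding uar0_vietoris[OF X h] using hom_range w V_range[OF X h] V_range[OF X k]
  by (subst le_inf01_iff) (auto simp: hom_adj simp del: atLeastAtMost_iff, auto)

text \<open>The candidate lies in VX because it represents a linear functional. Reflexivity and
  separatedness come from the fact that the hom of VX has value 1 exactly for the reversed pointwise
  order.\<close>

lemma conv_vietoris:
  assumes X: "obj X" and p: "\<pp> \<in> ultrafilters (V X)"
  shows "conv (vietoris T X) \<pp> = vietoris_conv T X \<pp>"
proof (rule conv_eqI)
  have v: "vietoris_conv T X \<pp> \<in> V X"
    unfolding vietoris_conv_eq[OF X p] by (intro repr_in_V X linear_xi_pairing p)
  then show "vietoris_conv T X \<pp> \<in> ucar (vietoris T X)" by simp
  show "uar (vietoris T X) \<pp> h = uar0 (vietoris T X) (vietoris_conv T X \<pp>) h" for h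
    unfolding uar0_vietoris[OF X v] by (simp add: vietoris_def)
  have range: "uar0 (vietoris T X) h k \<le> 1" if "h \<in> V X" "k \<in> V X" for h k
  proof -
    have "(\<lambda>x. hom (k x) (h x)) ` ucar X \<subseteq> {0..1}" using hom_range by blast
    then show ?thesis using inf01_range by (auto simp: uar0_vietoris[OF X that(1)])
  qed
  have le: "1 \<le> uar0 (vietoris T X) h k \<longleftrightarrow> (\<forall>x\<in>ucar X. k x \<le> h x)" if "h \<in> V X" "k \<in> V X" for h k
    using le_uar0_vietoris_iff[OF X that, of 1] V_range[OF X that(2)] by simp
  show "uar0 (vietoris T X) h h = 1" if "h \<in> ucar (vietoris T X)" for h
    using le[of h h] range[of h h] that by simp
  show "vseparated (underlying (vietoris T X))"
    unfolding vseparated_def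
  proof (intro ballI impI)
    fix h k assume "h \<in> car (underlying (vietoris T X))" "k \<in> car (underlying (vietoris T X))"
    then have hk: "h \<in> V X" "k \<in> V X" by (auto simp: underlying_def)
    assume "uar0 (vietoris T X) h k = 1 \<and> uar0 (vietoris T X) k h = 1"
    then have "\<forall>x\<in>ucar X. k x \<le> h x" "\<forall>x\<in>ucar X. h x \<le> k x"
      using le[OF hk] le[OF hk(2,1)] by auto
    then show "h = k"
      using hk by (intro PiE_ext[of h "ucar X" "\<lambda>_. {0..1}" k]) (auto simp: mem_V[OF X] intro!: antisym)
  qed
qed

lemma conv_vietoris_in:
  "obj X \<Longrightarrow> \<pp> \<in> ultrafilters (V X) \<Longrightarrow> conv (vietoris T X) \<pp> \<in> V X"
  by (simp add: conv_vietoris vietoris_conv_eq repr_in_V linear_xi_pairing)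

text \<open>Pairing with a representing map returns the functional, here the limit of the pairings.
  Together with \<open>V_eqI\<close> this makes convergence in VX testable on CX.\<close>

lemma pairing_conv_vietoris:
  assumes X: "obj X" and p: "\<pp> \<in> ultrafilters (V X)" and \<psi>: "\<psi> \<in> C X"
  shows "pairing X \<psi> (conv (vietoris T X) \<pp>) = xi (filtermap (pairing X \<psi>) \<pp>)"
  unfolding conv_vietoris[OF X p] vietoris_conv_eq[OF X p]
  by (rule pairing_repr[OF X linear_xi_pairing[OF X p] \<psi>])

section \<open>Continuous distributors\<close>

abbreviation D :: "'a ucat \<Rightarrow> 'b ucat \<Rightarrow> ('a \<Rightarrow> 'b \<Rightarrow> real) set" where
  "D X Y \<equiv> cont_distributors T X Y"

text \<open>Continuity of f is exploited after composing with \<open>pairing Y \<psi>\<close>: this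
  map is continuous into the dual unit interval, where continuity translates back into convergence
  along ultrafilters. The order condition comes from the hom of VY, multiplied by \<psi> z and taken
  to the supremum over z.\<close>

lemma pairing_dist_in_C:
  assumes X: "obj X" and Y: "obj Y" and f: "f \<in> D X Y" and \<psi>: "\<psi> \<in> C Y"
  shows "(\<lambda>x\<in>ucar X. pairing Y \<psi> (f x)) \<in> C X"
proof (rule C_restrictI[OF X])
  have fV: "f x \<in> V Y" if "x \<in> ucar X" for x
    using f that by (auto simp: cont_distributors_def rep_hom_def)
  note fr = V_range[OF Y fV]
  show pr: "pairing Y \<psi> (f x) \<in> {0..1}" if "x \<in> ucar X" for x
    by (intro pairing_range C_range[OF Y \<psi>] fr that)
  show "T (uar0 X x y) (pairing Y \<psi> (f y)) \<le> pairing Y \<psi> (f x)"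
    if x: "x \<in> ucar X" and y: "y \<in> ucar X" for x y
  proof -
    note a = uar0_range[OF X x y]
    have "uar0 X x y \<le> uar0 (vietoris T Y) (f x) (f y)"
      using f x y by (auto simp: cont_distributors_def rep_hom_def vfunctor_def) (auto simp: underlying_def)
    then have le: "T (f y z) (uar0 X x y) \<le> f x z" if "z \<in> ucar Y" for z
      using le_uar0_vietoris_iff[OF Y fV[OF x] fV[OF y] a] that by blast
    have "T (uar0 X x y) (T (\<psi> z) (f y z)) \<le> pairing Y \<psi> (f x)" if z: "z \<in> ucar Y" for z
    proof -
      have "T (uar0 X x y) (T (\<psi> z) (f y z)) = T (\<psi> z) (T (f y z) (uar0 X x y))"
        using T_assoc[OF C_range[OF Y \<psi> z] fr[OF y z] a] by (simp only: T_commute)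
      also have "\<dots> \<le> T (\<psi> z) (f x z)"
        by (intro T_mono C_range[OF Y \<psi> z] T_range fr x y z a le order_refl)
      also have "\<dots> \<le> pairing Y \<psi> (f x)"
        by (rule pairing_upper[OF C_range[OF Y \<psi>] fr[OF x] z])
      finally show ?thesis .
    qed
    then show ?thesis
      by (subst T_pairing_le_iff) (use C_range[OF Y \<psi>] fr[OF y] a pr[OF x] in \<open>simp_all del: atLeastAtMost_iff\<close>)
  qed
  have "continuous_map (conv_topology (vietoris T Y)) (conv_topology (dual (unit_ucat T))) (pairing Y \<psi>)"
  proof (subst continuous_map_dual_unit_iff)
    show "pairing Y \<psi> h \<in> {0..1}" if "h \<in> ucar (vietoris T Y)" for h
      using that by (intro pairing_range C_range[OF Y \<psi>] V_range[OF Y]) auto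
    then show "\<forall>\<pp>\<in>ultrafilters (ucar (vietoris T Y)). (pairing Y \<psi> \<longlongrightarrow> pairing Y \<psi> (conv (vietoris T Y) \<pp>)) \<pp>"
      using xi_tendsto(2)[of _ "V Y" "pairing Y \<psi>"] by (simp add: pairing_conv_vietoris[OF Y _ \<psi>])
  qed (simp add: conv_vietoris_in[OF Y])
  moreover have "continuous_map (conv_topology X) (conv_topology (vietoris T Y)) f"
    using f by (simp add: cont_distributors_def rep_hom_def)
  ultimately have "continuous_map (conv_topology X) (conv_topology (dual (unit_ucat T))) (\<lambda>x. pairing Y \<psi> (f x))"
    using continuous_map_compose[of _ _ f _ "pairing Y \<psi>"] unfolding comp_def by blast
  then show "((\<lambda>x. pairing Y \<psi> (f x)) \<longlongrightarrow> pairing Y \<psi> (f (conv X \<xx>))) \<xx>"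
    if "\<xx> \<in> ultrafilters (ucar X)" for \<xx>
    using that pr by (subst (asm) continuous_map_dual_unit_iff) (auto simp: conv_in[OF X])
qed

text \<open>Both the order and the limits of VY can be tested on CY: the order because each f x is
  the largest map below its own functional, by \<open>repr_pairing\<close> and
  \<open>le_repr\<close>, and the limits because members of VY with equal pairings coincide, by
  \<open>V_eqI\<close>.\<close>

lemma mem_D:
  assumes X: "obj X" and Y: "obj Y"
  shows "f \<in> D X Y \<longleftrightarrow> f \<in> ucar X \<rightarrow>\<^sub>E V Y \<and>
    (\<forall>\<psi>\<in>C Y. (\<lambda>x\<in>ucar X. pairing Y \<psi> (f x)) \<in> C X)" (is "?L \<longleftrightarrow> ?R")
proof
  assume ?L
  then show ?R using pairing_dist_in_C[OF X Y] by (auto simp: cont_distributors_def rep_hom_def)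
next
  assume R: ?R
  then have fE: "f \<in> ucar X \<rightarrow>\<^sub>E V Y" and fC: "\<And>\<psi>. \<psi> \<in> C Y \<Longrightarrow> (\<lambda>x\<in>ucar X. pairing Y \<psi> (f x)) \<in> C X"
    by auto
  have fV: "f x \<in> V Y" if "x \<in> ucar X" for x by (rule PiE_mem[OF fE that])
  note fr = V_range[OF Y fV]
  have "uar0 X x y \<le> uar0 (vietoris T Y) (f x) (f y)" if x: "x \<in> ucar X" and y: "y \<in> ucar X" for x y
  proof -
    note a = uar0_range[OF X x y]
    have "T (f y z) (uar0 X x y) \<le> f x z" if z: "z \<in> ucar Y" for z
    proof -
      have "T (f y z) (uar0 X x y) \<le> repr Y (\<lambda>\<psi>. pairing Y \<psi> (f x)) z"
      proof (rule le_repr[OF Y linear_pairing[OF Y fr[OF x]] z])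
        show "T (f y z) (uar0 X x y) \<in> {0..1}" by (intro T_range fr y z a)
        fix \<psi> assume \<psi>: "\<psi> \<in> C Y"
        note p = C_range[OF Y \<psi>]
        have "T (\<psi> z) (T (f y z) (uar0 X x y)) = T (uar0 X x y) (T (\<psi> z) (f y z))"
          using T_assoc[OF p[OF z] fr[OF y z] a] by (simp only: T_commute)
        also have "\<dots> \<le> T (uar0 X x y) (pairing Y \<psi> (f y))"
          by (intro T_mono a T_range p fr y z pairing_range pairing_upper order_refl)
        also have "\<dots> \<le> pairing Y \<psi> (f x)"
          using C_le[OF X fC[OF \<psi>] x y] x y by simp
        finally show "T (\<psi> z) (T (f y z) (uar0 X x y)) \<le> pairing Y \<psi> (f x)" .
      qed
      then show ?thesis by (simp add: repr_pairing[OF Y fV[OF x]])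
    qed
    then show ?thesis using le_uar0_vietoris_iff[OF Y fV[OF x] fV[OF y] a] by blast
  qed
  then have "vfunctor (underlying X) (underlying (vietoris T Y)) f"
    unfolding vfunctor_def using fV by (auto simp: underlying_def)
  moreover have "continuous_map (conv_topology X) (conv_topology (vietoris T Y)) f"
  proof (rule continuous_map_convI)
    fix \<xx> assume x: "\<xx> \<in> ultrafilters (ucar X)"
    have fx: "filtermap f \<xx> \<in> ultrafilters (V Y)" by (rule ultrafilters_filtermap[OF x fV])
    note cx = conv_in[OF X x]
    show "conv (vietoris T Y) (filtermap f \<xx>) = f (conv X \<xx>)"
    proof (rule V_eqI[OF Y conv_vietoris_in[OF Y fx] fV[OF cx]])
      fix \<psi> assume \<psi>: "\<psi> \<in> C Y"
      have "pairing Y \<psi> (conv (vietoris T Y) (filtermap f \<xx>)) = xi (filtermap (\<lambda>x. pairing Y \<psi> (f x)) \<xx>)"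
        by (simp add: pairing_conv_vietoris[OF Y fx \<psi>] filtermap_filtermap)
      also have "\<dots> = pairing Y \<psi> (f (conv X \<xx>))"
      proof (rule xi_eqI[OF x])
        show "pairing Y \<psi> (f x) \<in> {0..1}" if "x \<in> ucar X" for x
          by (intro pairing_range C_range[OF Y \<psi>] fr that)
        have "((\<lambda>x\<in>ucar X. pairing Y \<psi> (f x)) \<longlongrightarrow> pairing Y \<psi> (f (conv X \<xx>))) \<xx>"
          using C_tendsto[OF X fC[OF \<psi>] x] cx by simp
        moreover have "\<forall>\<^sub>F x in \<xx>. (\<lambda>x\<in>ucar X. pairing Y \<psi> (f x)) x = pairing Y \<psi> (f x)"
          using ultrafilters_D(2)[OF x] by eventually_elim simp
        ultimately show "((\<lambda>x. pairing Y \<psi> (f x)) \<longlongrightarrow> pairing Y \<psi> (f (conv X \<xx>))) \<xx>"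
          by (rule Lim_transform_eventually)
      qed
      finally show "pairing Y \<psi> (conv (vietoris T Y) (filtermap f \<xx>)) = pairing Y \<psi> (f (conv X \<xx>))" .
    qed
  qed (use fV conv_in[OF X] in auto)
  ultimately show ?L using fE by (simp add: cont_distributors_def rep_hom_def)
qed

lemma D_in_V: "obj X \<Longrightarrow> obj Y \<Longrightarrow> f \<in> D X Y \<Longrightarrow> x \<in> ucar X \<Longrightarrow> f x \<in> V Y"
  by (auto simp: mem_D)

lemma C_mor_eq: "\<psi> \<in> C Y \<Longrightarrow> C_mor T X Y f \<psi> = (\<lambda>x\<in>ucar X. pairing Y \<psi> (f x))"
  by (simp add: C_mor_def pairing_def)

lemma C_mor_in_C: "obj X \<Longrightarrow> obj Y \<Longrightarrow> f \<in> D X Y \<Longrightarrow> \<psi> \<in> C Y \<Longrightarrow> C_mor T X Y f \<psi> \<in> C X"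
  by (simp add: C_mor_eq pairing_dist_in_C)

lemma linear_C_mor:
  assumes "obj X" "obj Y" "f \<in> D X Y" "x \<in> ucar X"
  shows "linear Y (\<lambda>\<psi>. C_mor T X Y f \<psi> x)"
proof -
  have "linear Y (\<lambda>\<psi>. pairing Y \<psi> (f x))"
    using assms D_in_V[of X Y f x] by (intro linear_pairing V_range) auto
  then show ?thesis using assms by (simp add: linear_def C_mor_eq C_join)
qed

lemma D_eqI:
  assumes X: "obj X" and Y: "obj Y" and f: "f \<in> D X Y" and g: "g \<in> D X Y"
    and eq: "\<And>\<psi>. \<psi> \<in> C Y \<Longrightarrow> C_mor T X Y f \<psi> = C_mor T X Y g \<psi>"
  shows "f = g"
proof (rule PiE_ext)
  show "f \<in> ucar X \<rightarrow>\<^sub>E V Y" "g \<in> ucar X \<rightarrow>\<^sub>E V Y" using f g by (auto simp: mem_D[OF X Y])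
  fix x assume x: "x \<in> ucar X"
  show "f x = g x"
  proof (rule V_eqI[OF Y D_in_V[OF X Y f x] D_in_V[OF X Y g x]])
    fix \<psi> assume "\<psi> \<in> C Y"
    then show "pairing Y \<psi> (f x) = pairing Y \<psi> (g x)"
      using fun_cong[OF eq[of \<psi>], of x] x by (simp add: C_mor_eq)
  qed
qed

text \<open>The common source of identities, composites and preimages of morphisms: linear
  functionals that fit together to a map from CY to CX have representing maps that form a
  distributor. Here f is described by its values rather than constructed, so that
  \<open>dist_id\<close> and \<open>dist_comp\<close> can be inserted.\<close>

lemma
  assumes X: "obj X" and Y: "obj Y" and \<Gamma>: "\<And>\<psi>. \<psi> \<in> C Y \<Longrightarrow> \<Gamma> \<psi> \<in> C X"
    and lin: "\<And>x. x \<in> ucar X \<Longrightarrow> linear Y (\<lambda>\<psi>. \<Gamma> \<psi> x)"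
    and f: "f \<in> extensional (ucar X)" "\<And>x. x \<in> ucar X \<Longrightarrow> f x = repr Y (\<lambda>\<psi>. \<Gamma> \<psi> x)"
  shows D_repr: "f \<in> D X Y"
    and C_mor_repr: "\<psi> \<in> C Y \<Longrightarrow> C_mor T X Y f \<psi> = \<Gamma> \<psi>"
proof -
  have eq: "(\<lambda>x\<in>ucar X. pairing Y \<psi> (f x)) = \<Gamma> \<psi>" if "\<psi> \<in> C Y" for \<psi>
    using C_extensional[OF X \<Gamma>[OF that]] pairing_repr[OF Y lin that] f(2)
    by (intro extensionalityI[of _ "ucar X"]) auto
  show "f \<in> D X Y" unfolding mem_D[OF X Y] using eq \<Gamma> f repr_in_V[OF Y lin] by (auto simp: PiE_iff)
  show "C_mor T X Y f \<psi> = \<Gamma> \<psi>" if "\<psi> \<in> C Y" using that by (simp add: C_mor_eq eq)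
qed

lemma
  assumes X: "obj X"
  shows dist_id_in_D: "dist_id X \<in> D X X"
    and C_mor_id: "\<psi> \<in> C X \<Longrightarrow> C_mor T X X (dist_id X) \<psi> = \<psi>"
proof -
  have ext: "dist_id X \<in> extensional (ucar X)" by (simp add: dist_id_def)
  have eq: "dist_id X x = repr X (\<lambda>\<psi>. \<psi> x)" if "x \<in> ucar X" for x
    using that by (auto simp: dist_id_def uar0_eq_repr[OF X] fun_eq_iff) (simp add: repr_def)
  show "dist_id X \<in> D X X"
    by (rule D_repr[OF X X _ _ ext, of "\<lambda>\<psi>. \<psi>"]) (auto simp: eq linear_eval X)
  show "C_mor T X X (dist_id X) \<psi> = \<psi>" if "\<psi> \<in> C X"
    by (rule C_mor_repr[OF X X _ _ ext, of "\<lambda>\<psi>. \<psi>"]) (auto simp: eq linear_eval X that)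
qed

text \<open>Once the supremum over Y is known to represent the composite functional,
  \<open>D_repr\<close> makes the composite a continuous distributor. The hard inequality is
  compactness on Y: one test function on Z with value 1 at z has to bound the products for all y at
  once.\<close>

lemma dist_comp_eq_repr:
  assumes X: "obj X" and Y: "obj Y" and Z: "obj Z" and f: "f \<in> D X Y" and g: "g \<in> D Y Z"
    and x: "x \<in> ucar X"
  shows "dist_comp T X Y Z f g x = repr Z (\<lambda>\<psi>. C_mor T X Y f (C_mor T Y Z g \<psi>) x)"
    (is "_ = repr Z ?\<Psi>")
    and "linear Z (\<lambda>\<psi>. C_mor T X Y f (C_mor T Y Z g \<psi>) x)"
proof -
  note gC = C_mor_in_C[OF Y Z g]
  have fx: "f x \<in> V Y" by (rule D_in_V[OF X Y f x])
  note fr = V_range[OF Y fx]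
  note gV = D_in_V[OF Y Z g]
  note gr = V_range[OF Z gV]
  have \<Psi>: "?\<Psi> \<psi> = pairing Y (C_mor T Y Z g \<psi>) (f x)" if "\<psi> \<in> C Z" for \<psi>
    using gC[OF that] x by (simp add: C_mor_eq)
  have cm: "C_mor T Y Z g \<psi> y = pairing Z \<psi> (g y)" if "\<psi> \<in> C Z" "y \<in> ucar Y" for \<psi> y
    using that by (simp add: C_mor_eq)
  show lin: "linear Z ?\<Psi>"
    unfolding linear_def
  proof (intro conjI ballI)
    show "?\<Psi> p \<in> {0..1}" if "p \<in> C Z" for p
      by (intro C_range[OF X] C_mor_in_C[OF X Y f] gC that x)
    fix p q and u v :: real
    assume pq: "p \<in> C Z" "q \<in> C Z" and u: "u \<in> {0..1}" and v: "v \<in> {0..1}"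
    have "C_mor T Y Z g (join Z u p v q) = join Y u (C_mor T Y Z g p) v (C_mor T Y Z g q)"
    proof (rule C_eqI[OF Y])
      show "C_mor T Y Z g (join Z u p v q) \<in> C Y" by (intro gC C_join Z pq u v)
      show "join Y u (C_mor T Y Z g p) v (C_mor T Y Z g q) \<in> C Y" by (intro gC C_join Y pq u v)
      fix y assume y: "y \<in> ucar Y"
      show "C_mor T Y Z g (join Z u p v q) y = join Y u (C_mor T Y Z g p) v (C_mor T Y Z g q) y"
        using linear_join[OF Z linear_C_mor[OF Y Z g y] pq u v] y by (simp add: join_def)
    qed
    then show "?\<Psi> (join Z u p v q) = max (T u (?\<Psi> p)) (T v (?\<Psi> q))"
      using linear_join[OF Y linear_C_mor[OF X Y f x] gC[OF pq(1)] gC[OF pq(2)] u v] by simp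
  qed
  show "dist_comp T X Y Z f g x = repr Z ?\<Psi>"
  proof
    fix z
    show "dist_comp T X Y Z f g x z = repr Z ?\<Psi> z"
    proof (cases "z \<in> ucar Z")
      case False
      then show ?thesis using x by (simp add: dist_comp_def repr_def)
    next
      case z: True
      let ?A = "(\<lambda>y. T (f x y) (g y z)) ` ucar Y"
      have A: "?A \<subseteq> {0..1}" using T_range[OF fr gr] z by blast
      have dc: "dist_comp T X Y Z f g x z = sup01 ?A" using x z by (simp add: dist_comp_def)
      show ?thesis unfolding dc
      proof (rule antisym)
        have "T (f x y) (g y z) \<le> repr Z ?\<Psi> z" if y: "y \<in> ucar Y" for y
        proof (rule le_repr[OF Z lin z T_range[OF fr[OF y] gr[OF y z]]])
          fix \<psi> assume \<psi>: "\<psi> \<in> C Z"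
          have "T (\<psi> z) (T (f x y) (g y z)) = T (T (\<psi> z) (g y z)) (f x y)"
            using T_assoc[OF C_range[OF Z \<psi> z] gr[OF y z] fr[OF y]] by (simp only: T_commute)
          also have "\<dots> \<le> T (pairing Z \<psi> (g y)) (f x y)"
            by (intro T_mono T_range C_range[OF Z \<psi>] z gr y fr pairing_range pairing_upper order_refl)
          also have "\<dots> = T (C_mor T Y Z g \<psi> y) (f x y)" by (simp add: cm[OF \<psi> y])
          also have "\<dots> \<le> ?\<Psi> \<psi>"
            unfolding \<Psi>[OF \<psi>] by (rule pairing_upper[OF C_range[OF Y gC[OF \<psi>]] fr y])
          finally show "T (\<psi> z) (T (f x y) (g y z)) \<le> ?\<Psi> \<psi>" .
        qed
        then show "sup01 ?A \<le> repr Z ?\<Psi> z"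
          using repr_range[OF Z lin z] by (subst sup01_le_iff[OF A]) auto
        show "repr Z ?\<Psi> z \<le> sup01 ?A"
        proof (rule dense_ge)
          fix c assume c: "sup01 ?A < c"
          have pos: "0 \<le> c" using c sup01_range[OF A] by auto
          define Q where "Q W \<longleftrightarrow> (\<exists>\<psi>\<in>C Z. \<psi> z = 1 \<and>
            (\<forall>y\<in>W \<inter> ucar Y. T (C_mor T Y Z g \<psi> y) (f x y) \<le> c))" for W
          have "Q (ucar Y)"
          proof (rule ultrafilter_cover)
            have one: "(\<lambda>x\<in>ucar Z. 1) \<in> C Z" by (intro C_const Z) auto
            show "Q {}" unfolding Q_def by (rule bexI[OF _ one]) (use z in auto)
          next
            fix A B assume "Q A" "Q B"
            then obtain p q where pq: "p \<in> C Z" "q \<in> C Z" "p z = 1" "q z = 1"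
              and le: "\<And>y. y \<in> A \<Longrightarrow> y \<in> ucar Y \<Longrightarrow> T (C_mor T Y Z g p y) (f x y) \<le> c"
                "\<And>y. y \<in> B \<Longrightarrow> y \<in> ucar Y \<Longrightarrow> T (C_mor T Y Z g q y) (f x y) \<le> c"
              unfolding Q_def by blast
            let ?m = "\<lambda>z\<in>ucar Z. min (p z) (q z)"
            have m: "?m \<in> C Z" by (intro C_min Z pq)
            have "T (C_mor T Y Z g ?m y) (f x y) \<le> c" if y: "y \<in> (A \<union> B) \<inter> ucar Y" for y
            proof -
              have yY: "y \<in> ucar Y" using y by simp
              note l = linear_C_mor[OF Y Z g yY]
              have "C_mor T Y Z g ?m y \<le> C_mor T Y Z g p y" "C_mor T Y Z g ?m y \<le> C_mor T Y Z g q y"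
                by (rule linear_mono[OF Z l m]; use pq in simp)+
              then have "T (C_mor T Y Z g ?m y) (f x y) \<le> T (C_mor T Y Z g p y) (f x y)"
                "T (C_mor T Y Z g ?m y) (f x y) \<le> T (C_mor T Y Z g q y) (f x y)"
                by (intro T_mono C_range[OF Y] gC m pq fr yY order_refl; simp)+
              then show ?thesis using le[of y] y by fastforce
            qed
            moreover have "?m z = 1" using pq z by simp
            ultimately show "Q (A \<union> B)" unfolding Q_def by (intro bexI[OF _ m]) auto
          next
            show "Q B" if "Q A" "B \<subseteq> A" for A B using that unfolding Q_def by blast
          next
            fix \<yy> assume y: "\<yy> \<in> ultrafilters (ucar Y)"
            define y0 where "y0 = conv Y \<yy>"
            have y0: "y0 \<in> ucar Y" unfolding y0_def by (rule conv_in[OF Y y])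
            \<comment> \<open>The map f x may fail to be continuous, so its limit along
              \<open>\<yy>\<close> replaces its value at y0; the condition of VY gives
              \<open>?s \<le> f x y0\<close>.\<close>
            let ?s = "xi (filtermap (f x) \<yy>)"
            have s: "?s \<in> {0..1}" "(f x \<longlongrightarrow> ?s) \<yy>"
              by (intro xi_tendsto[OF y] fr; assumption)+
            have "?s = T ?s (uar0 Y y0 y0)" using s by (simp add: uar0_refl[OF Y y0])
            also have "\<dots> \<le> f x y0"
              using fx y y0 by (simp add: mem_V[OF Y] y0_def)
            finally have "T ?s (g y0 z) \<le> T (f x y0) (g y0 z)"
              by (intro T_mono s fr gr y0 z order_refl)
            also have "\<dots> < c"
              using c sup01_upper[OF A, of "T (f x y0) (g y0 z)"] y0 by auto
            finally have "T ?s (repr Z (\<lambda>\<psi>. pairing Z \<psi> (g y0)) z) < c"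
              by (simp add: repr_pairing[OF Z gV[OF y0]])
            moreover have "linear Z (\<lambda>\<psi>. pairing Z \<psi> (g y0))" by (intro linear_pairing Z gr y0)
            ultimately obtain \<psi> where \<psi>: "\<psi> \<in> C Z" "\<psi> z = 1" "T ?s (pairing Z \<psi> (g y0)) < c"
              using repr_normalized[OF Z _ z s(1)] by blast
            then have less: "T (C_mor T Y Z g \<psi> y0) ?s < c"
              by (simp add: cm y0 T_commute[of ?s])
            have "\<forall>\<^sub>F y in \<yy>. T (C_mor T Y Z g \<psi> y) (f x y) < c"
              by (rule order_tendstoD(2)[OF T_tendsto[OF C_tendsto[OF Y gC[OF \<psi>(1)] y] s(2)]])
                (use less in \<open>simp add: y0_def\<close>)
            then have "mem_filter {y. T (C_mor T Y Z g \<psi> y) (f x y) < c} \<yy>" by simp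
            moreover have "Q {y. T (C_mor T Y Z g \<psi> y) (f x y) < c}"
              unfolding Q_def by (intro bexI[OF _ \<psi>(1)]) (use \<psi> in auto)
            ultimately show "\<exists>A. Q A \<and> mem_filter A \<yy>" by blast
          qed
          then obtain \<psi> where \<psi>: "\<psi> \<in> C Z" "\<psi> z = 1"
            and le: "\<And>y. y \<in> ucar Y \<Longrightarrow> T (C_mor T Y Z g \<psi> y) (f x y) \<le> c"
            unfolding Q_def by auto
          have "repr Z ?\<Psi> z \<le> ?\<Psi> \<psi>" by (rule repr_le[OF Z lin \<psi>(1) z \<psi>(2)])
          also have "\<dots> \<le> c"
            unfolding \<Psi>[OF \<psi>(1)]
            by (subst pairing_le_iff) (use C_range[OF Y gC[OF \<psi>(1)]] fr pos le in \<open>simp_all del: atLeastAtMost_iff\<close>)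
          finally show "repr Z ?\<Psi> z \<le> c" .
        qed
      qed
    qed
  qed
qed

lemma
  assumes X: "obj X" and Y: "obj Y" and Z: "obj Z" and f: "f \<in> D X Y" and g: "g \<in> D Y Z"
  shows dist_comp_in_D: "dist_comp T X Y Z f g \<in> D X Z"
    and C_mor_comp: "\<psi> \<in> C Z \<Longrightarrow>
      C_mor T X Z (dist_comp T X Y Z f g) \<psi> = C_mor T X Y f (C_mor T Y Z g \<psi>)"
proof -
  let ?\<Gamma> = "\<lambda>\<psi>. C_mor T X Y f (C_mor T Y Z g \<psi>)"
  have \<Gamma>: "?\<Gamma> \<psi> \<in> C X" if "\<psi> \<in> C Z" for \<psi>
    by (intro C_mor_in_C[OF X Y f] C_mor_in_C[OF Y Z g] that)
  have ext: "dist_comp T X Y Z f g \<in> extensional (ucar X)" by (simp add: dist_comp_def)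
  note * = \<Gamma> dist_comp_eq_repr(2)[OF assms] ext dist_comp_eq_repr(1)[OF assms]
  show "dist_comp T X Y Z f g \<in> D X Z" by (rule D_repr[OF X Z, of ?\<Gamma>]) (fact *)+
  show "C_mor T X Z (dist_comp T X Y Z f g) \<psi> = ?\<Gamma> \<psi>" if "\<psi> \<in> C Z"
    by (rule C_mor_repr[OF X Z, of ?\<Gamma>]) (fact * that)+
qed

section \<open>Finite colimits\<close>

context
  fixes X :: "'a ucat"
  assumes X: "obj X"
begin

lemma ar_C: "ar (C_obj T X) p q = inf01 ((\<lambda>x. hom (p x) (q x)) ` ucar X)"
  by (simp add: C_obj_def)

lemma ar_C_range: "ar (C_obj T X) p q \<in> {0..1}"
  unfolding ar_C using hom_range by (intro inf01_range) blast

lemma le_ar_C_iff: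
  assumes p: "p \<in> C X" and q: "q \<in> C X" and w: "w \<in> {0..1}"
  shows "w \<le> ar (C_obj T X) p q \<longleftrightarrow> (\<forall>x\<in>ucar X. T (p x) w \<le> q x)"
proof -
  have "(\<lambda>x. hom (p x) (q x)) ` ucar X \<subseteq> {0..1}" using hom_range by blast
  then have "w \<le> ar (C_obj T X) p q \<longleftrightarrow> (\<forall>x\<in>ucar X. w \<le> hom (p x) (q x))"
    unfolding ar_C using w by (subst le_inf01_iff) auto
  also have "\<dots> \<longleftrightarrow> (\<forall>x\<in>ucar X. T (p x) w \<le> q x)"
    using hom_adj[OF C_range[OF X p] w C_range[OF X q]] by blast
  finally show ?thesis .
qed

lemma T_ar_C_le:
  "p \<in> C X \<Longrightarrow> q \<in> C X \<Longrightarrow> x \<in> ucar X \<Longrightarrow> T (p x) (ar (C_obj T X) p q) \<le> q x"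
  using le_ar_C_iff[of p q "ar (C_obj T X) p q"] ar_C_range by blast

lemma ar_C_eq_one_iff:
  assumes "p \<in> C X" "q \<in> C X"
  shows "ar (C_obj T X) p q = 1 \<longleftrightarrow> (\<forall>x\<in>ucar X. p x \<le> q x)"
  using le_ar_C_iff[OF assms, of 1] ar_C_range[of p q] C_range[OF X assms(1)] by auto

lemma vcategory_C_obj: "vcategory T (C_obj T X)"
  unfolding vcategory_def
proof (intro conjI ballI)
  show "ar (C_obj T X) p q \<in> {0..1}" for p q by (rule ar_C_range)
  show "ar (C_obj T X) p p = 1" if "p \<in> C X" for p using that by (simp add: ar_C_eq_one_iff)
  fix p q r assume pqr: "p \<in> C X" "q \<in> C X" "r \<in> C X"
  let ?a = "ar (C_obj T X) p q" and ?b = "ar (C_obj T X) q r"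
  have "T (p x) (T ?a ?b) \<le> r x" if x: "x \<in> ucar X" for x
  proof -
    have "T (p x) (T ?a ?b) = T (T (p x) ?a) ?b"
      by (intro T_assoc[symmetric] C_range[OF X] pqr x ar_C_range)
    also have "\<dots> \<le> T (q x) ?b"
      by (intro T_mono T_range C_range[OF X] pqr x ar_C_range T_ar_C_le order_refl)
    also have "\<dots> \<le> r x" by (intro T_ar_C_le pqr x)
    finally show ?thesis .
  qed
  then show "T ?a ?b \<le> ar (C_obj T X) p r"
    using le_ar_C_iff[OF pqr(1,3) T_range[OF ar_C_range ar_C_range]] by blast
qed

lemma vseparated_C_obj: "vseparated (C_obj T X)"
  unfolding vseparated_def
  by (auto simp: ar_C_eq_one_iff intro!: C_eqI[OF X] intro: order_antisym)

end

lemma sup01_insert: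
  assumes "a \<in> {0..1}" "A \<subseteq> {0..1}"
  shows "sup01 (insert a A) = max a (sup01 A)"
proof (rule antisym)
  have i: "insert a A \<subseteq> {0..1}" using assms by simp
  show "sup01 (insert a A) \<le> max a (sup01 A)"
    using assms sup01_upper[OF assms(2)] by (subst sup01_le_iff[OF i]) (auto simp: le_max_iff_disj)
  show "max a (sup01 A) \<le> sup01 (insert a A)"
    using assms sup01_range[OF i] sup01_upper[OF i] by (auto simp: sup01_le_iff)
qed

lemma sup01_empty [simp]: "sup01 {} = 0"
  by (simp add: sup01_def)

text \<open>Finite weighted colimits in CX are pointwise: the supremum of the copowers of the
  \<open>h i\<close> by the weights \<open>w i\<close>.\<close>

definition weighted_join :: "'a ucat \<Rightarrow> nat set \<Rightarrow> (nat \<Rightarrow> 'a \<Rightarrow> real) \<Rightarrow> (nat \<Rightarrow> real) \<Rightarrow> 'a \<Rightarrow> real" where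
  "weighted_join X I h w = (\<lambda>x\<in>ucar X. sup01 ((\<lambda>i. T (w i) (h i x)) ` I))"

lemma weighted_join_insert:
  assumes X: "obj X" and wh: "w i \<in> {0..1}" "w \<in> I \<rightarrow> {0..1}" "h i \<in> C X" "h \<in> I \<rightarrow> C X"
  shows "weighted_join X (insert i I) h w = join X (w i) (h i) 1 (weighted_join X I h w)"
proof
  fix x
  show "weighted_join X (insert i I) h w x = join X (w i) (h i) 1 (weighted_join X I h w) x"
  proof (cases "x \<in> ucar X")
    case x: True
    have a: "T (w i) (h i x) \<in> {0..1}" by (intro T_range wh C_range[OF X] x)
    have A: "(\<lambda>i. T (w i) (h i x)) ` I \<subseteq> {0..1}"
      using wh T_range C_range[OF X _ x] by blast
    show ?thesis
      using x sup01_range[OF A] by (simp add: weighted_join_def join_def sup01_insert[OF a A])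
  qed (simp add: weighted_join_def join_def)
qed

text \<open>Induction on I: a new index amounts to a \<open>join\<close> with weight 1 on the part
  already treated. The empty case is the constant 0, which \<open>linear_const_le\<close> forces to
  be sent to 0.\<close>

lemma
  assumes X: "obj X" and I: "finite I" and wh: "w \<in> I \<rightarrow> {0..1}" "h \<in> I \<rightarrow> C X"
  shows weighted_join_in_C: "weighted_join X I h w \<in> C X"
    and linear_weighted_join: "linear X \<Phi> \<Longrightarrow>
      \<Phi> (weighted_join X I h w) = sup01 ((\<lambda>i. T (w i) (\<Phi> (h i))) ` I)"
proof -
  have "weighted_join X I h w \<in> C X \<and>
      (linear X \<Phi> \<longrightarrow> \<Phi> (weighted_join X I h w) = sup01 ((\<lambda>i. T (w i) (\<Phi> (h i))) ` I))"
    using I wh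
  proof (induction I)
    case empty
    have eq: "weighted_join X {} h w = (\<lambda>x\<in>ucar X. 0)"
      by (simp add: weighted_join_def)
    have zero: "(\<lambda>x\<in>ucar X. 0) \<in> C X" by (intro C_const X) auto
    have "\<Phi> (\<lambda>x\<in>ucar X. 0) = 0" if "linear X \<Phi>"
      using linear_const_le[OF X that, of 0] linear_range[OF X that zero] by simp
    then show ?case unfolding eq image_empty sup01_empty using zero by blast
  next
    case (insert i I)
    then have wh: "w i \<in> {0..1}" "w \<in> I \<rightarrow> {0..1}" "h i \<in> C X" "h \<in> I \<rightarrow> C X" by auto
    note IH = insert.IH[OF wh(2,4)]
    note eq = weighted_join_insert[OF X wh]
    have "\<Phi> (weighted_join X (insert i I) h w) = sup01 ((\<lambda>i. T (w i) (\<Phi> (h i))) ` insert i I)"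
      if lin: "linear X \<Phi>"
    proof -
      have a: "T (w i) (\<Phi> (h i)) \<in> {0..1}" by (intro T_range wh linear_range[OF X lin])
      have A: "(\<lambda>i. T (w i) (\<Phi> (h i))) ` I \<subseteq> {0..1}"
        using wh T_range linear_range[OF X lin] by blast
      have "\<Phi> (weighted_join X (insert i I) h w) =
          max (T (w i) (\<Phi> (h i))) (T 1 (\<Phi> (weighted_join X I h w)))"
        unfolding eq by (rule linear_join[OF X lin]) (use IH wh in auto)
      also have "\<dots> = sup01 ((\<lambda>i. T (w i) (\<Phi> (h i))) ` insert i I)"
        using IH lin sup01_range[OF A] by (simp add: sup01_insert[OF a A])
      finally show ?thesis .
    qed
    moreover have "weighted_join X (insert i I) h w \<in> C X"
      unfolding eq by (intro C_join X wh) (use IH in auto)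
    ultimately show ?case by blast
  qed
  then show "weighted_join X I h w \<in> C X"
    "linear X \<Phi> \<Longrightarrow> \<Phi> (weighted_join X I h w) = sup01 ((\<lambda>i. T (w i) (\<Phi> (h i))) ` I)" by blast+
qed

lemma diagram_comp:
  "finite_weighted_diagram T I h w A \<Longrightarrow> vfunctor A B f \<Longrightarrow> finite_weighted_diagram T I (f \<circ> h) w B"
  by (auto simp: finite_weighted_diagram_def vfunctor_def Pi_iff) (meson order_trans)

text \<open>Both sides have the same lower bounds v in the unit interval: by adjunction each
  comparison becomes \<open>T (h i x) (T (w i) v) \<le> q x\<close> for all i and x.\<close>

lemma is_colimit_weighted_join:
  assumes X: "obj X" and d: "finite_weighted_diagram T I h w (C_obj T X)"
  shows "is_colimit T I h w (C_obj T X) (weighted_join X (car I) h w)"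
  unfolding is_colimit_def
proof (intro conjI ballI)
  have I: "finite (car I)" and w: "w \<in> car I \<rightarrow> {0..1}" and h: "h \<in> car I \<rightarrow> C X"
    using d by (auto simp: finite_weighted_diagram_def vfunctor_def)
  show c: "weighted_join X (car I) h w \<in> C X" by (rule weighted_join_in_C[OF X I w h])
  fix q assume q: "q \<in> C X"
  let ?l = "ar (C_obj T X) (weighted_join X (car I) h w) q"
  let ?B = "(\<lambda>i. hom (w i) (ar (C_obj T X) (h i) q)) ` car I"
  have B: "?B \<subseteq> {0..1}" using hom_range by blast
  have *: "T (h i x) (T (w i) v) = T v (T (w i) (h i x))"
    if "i \<in> car I" "x \<in> ucar X" "v \<in> {0..1}" for i x v
    using T_assoc[of v "w i" "h i x"] that w C_range[OF X funcset_mem[OF h that(1)] that(2)]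
    by (auto simp: T_commute Pi_iff)
  have "v \<le> ?l \<longleftrightarrow> v \<le> inf01 ?B" if v: "v \<in> {0..1}" for v
  proof -
    have "v \<le> ?l \<longleftrightarrow> (\<forall>x\<in>ucar X. T v (sup01 ((\<lambda>i. T (w i) (h i x)) ` car I)) \<le> q x)"
      using le_ar_C_iff[OF X c q v] by (simp add: weighted_join_def T_commute)
    also have "\<dots> \<longleftrightarrow> (\<forall>x\<in>ucar X. \<forall>i\<in>car I. T v (T (w i) (h i x)) \<le> q x)"
    proof (rule ball_cong[OF refl])
      fix x assume x: "x \<in> ucar X"
      have "(\<lambda>i. T (w i) (h i x)) ` car I \<subseteq> {0..1}"
        using w h T_range C_range[OF X _ x] by blast
      then show "T v (sup01 ((\<lambda>i. T (w i) (h i x)) ` car I)) \<le> q x \<longleftrightarrow>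
          (\<forall>i\<in>car I. T v (T (w i) (h i x)) \<le> q x)"
        using T_sup01_le_iff[OF v _ C_range[OF X q x]] by auto
    qed
    also have "\<dots> \<longleftrightarrow> (\<forall>i\<in>car I. \<forall>x\<in>ucar X. T (h i x) (T (w i) v) \<le> q x)"
      using * v by auto
    also have "\<dots> \<longleftrightarrow> (\<forall>i\<in>car I. v \<le> hom (w i) (ar (C_obj T X) (h i) q))"
    proof (rule ball_cong[OF refl])
      fix i assume i: "i \<in> car I"
      have hi: "h i \<in> C X" and wi: "w i \<in> {0..1}" using i h w by auto
      show "(\<forall>x\<in>ucar X. T (h i x) (T (w i) v) \<le> q x) \<longleftrightarrow> v \<le> hom (w i) (ar (C_obj T X) (h i) q)"
        using le_ar_C_iff[OF X hi q T_range[OF wi v]] hom_adj[OF wi v ar_C_range[OF X]] by simp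
    qed
    also have "\<dots> \<longleftrightarrow> v \<le> inf01 ?B" using v by (subst le_inf01_iff[OF B]) auto
    finally show ?thesis .
  qed
  from this[OF ar_C_range[OF X]] this[OF inf01_range[OF B]]
  show "?l = inf01 ?B" by (meson order_antisym order_refl)
qed

text \<open>Separatedness makes the colimit unique, so that cocontinuity between objects CX turns
  into an equation between functions.\<close>

lemma is_colimit_C_iff:
  assumes X: "obj X" and d: "finite_weighted_diagram T I h w (C_obj T X)"
  shows "is_colimit T I h w (C_obj T X) c \<longleftrightarrow> c = weighted_join X (car I) h w"
proof
  let ?j = "weighted_join X (car I) h w"
  note j = is_colimit_weighted_join[OF assms]
  assume c: "is_colimit T I h w (C_obj T X) c"
  have C: "c \<in> C X" "?j \<in> C X" using c j by (auto simp: is_colimit_def)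
  have "ar (C_obj T X) c q = ar (C_obj T X) ?j q" if "q \<in> C X" for q
    using c j that by (simp add: is_colimit_def)
  from this[OF C(1)] this[OF C(2)] C show "c = ?j"
    using vcategory_C_obj[OF X] vseparated_C_obj[OF X] unfolding vcategory_def vseparated_def
    by metis
qed (use is_colimit_weighted_join[OF assms] in simp)

lemma finitely_cocomplete_C_obj: "obj X \<Longrightarrow> finitely_cocomplete T (C_obj T X)"
  unfolding finitely_cocomplete_def using is_colimit_weighted_join by blast

text \<open>Evaluated at a point x the map is a linear functional, and linear functionals preserve
  weighted joins.\<close>

lemma finitely_cocontinuous_C_mor:
  assumes X: "obj X" and Y: "obj Y" and f: "f \<in> D X Y"
  shows "finitely_cocontinuous T (C_obj T Y) (C_obj T X) (C_mor T X Y f)"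
  unfolding finitely_cocontinuous_def
proof (intro conjI allI impI)
  note fC = C_mor_in_C[OF X Y f]
  show F: "vfunctor (C_obj T Y) (C_obj T X) (C_mor T X Y f)"
    unfolding vfunctor_def
  proof (intro conjI ballI funcsetI fC)
    fix p q assume p: "p \<in> C Y" and q: "q \<in> C Y"
    let ?w = "ar (C_obj T Y) p q"
    note w = ar_C_range[OF Y, of p q]
    have "T (C_mor T X Y f p x) ?w \<le> C_mor T X Y f q x" if x: "x \<in> ucar X" for x
    proof -
      note fr = V_range[OF Y D_in_V[OF X Y f x]]
      have r: "pairing Y q (f x) \<in> {0..1}" by (intro pairing_range C_range[OF Y q] fr)
      have "T ?w (T (p y) (f x y)) \<le> pairing Y q (f x)" if y: "y \<in> ucar Y" for y
      proof -
        have "T ?w (T (p y) (f x y)) = T (T (p y) ?w) (f x y)"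
          using T_assoc[OF w C_range[OF Y p y] fr[OF y]] by (simp only: T_commute)
        also have "\<dots> \<le> T (q y) (f x y)"
          by (intro T_mono T_range C_range[OF Y] p q y w fr T_ar_C_le[OF Y] order_refl)
        also have "\<dots> \<le> pairing Y q (f x)" by (intro pairing_upper C_range[OF Y q] fr y)
        finally show ?thesis .
      qed
      then have "T ?w (pairing Y p (f x)) \<le> pairing Y q (f x)"
        by (subst T_pairing_le_iff) (use C_range[OF Y p] fr w r in \<open>simp_all del: atLeastAtMost_iff\<close>)
      then show ?thesis using x p q by (simp add: C_mor_eq T_commute)
    qed
    then show "?w \<le> ar (C_obj T X) (C_mor T X Y f p) (C_mor T X Y f q)"
      using le_ar_C_iff[OF X fC[OF p] fC[OF q] w] by blast
  qed
  fix I h w c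
  assume "finite_weighted_diagram T I h w (C_obj T Y) \<and> is_colimit T I h w (C_obj T Y) c"
  then have d: "finite_weighted_diagram T I h w (C_obj T Y)" and c: "c = weighted_join Y (car I) h w"
    by (auto simp: is_colimit_C_iff[OF Y])
  have I: "finite (car I)" and w: "w \<in> car I \<rightarrow> {0..1}" and h: "h \<in> car I \<rightarrow> C Y"
    using d by (auto simp: finite_weighted_diagram_def vfunctor_def)
  have d': "finite_weighted_diagram T I (C_mor T X Y f \<circ> h) w (C_obj T X)"
    by (rule diagram_comp[OF d F])
  have h': "C_mor T X Y f \<circ> h \<in> car I \<rightarrow> C X" using fC[OF funcset_mem[OF h]] by simp
  show "is_colimit T I (C_mor T X Y f \<circ> h) w (C_obj T X) (C_mor T X Y f c)"
    unfolding is_colimit_C_iff[OF X d'] c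
  proof (rule C_eqI[OF X fC[OF weighted_join_in_C[OF Y I w h]] weighted_join_in_C[OF X I w h']])
    fix x assume "x \<in> ucar X"
    then show "C_mor T X Y f (weighted_join Y (car I) h w) x
        = weighted_join X (car I) (C_mor T X Y f \<circ> h) w x"
      using linear_weighted_join[OF Y I w h linear_C_mor[OF X Y f]] by (simp add: weighted_join_def)
  qed
qed

text \<open>\<open>join Y u p v q\<close> is the colimit of \<open>p, q\<close> with weights \<open>u, v\<close> on the discrete category with two points.\<close>

lemma linear_of_finitely_cocontinuous:
  assumes X: "obj X" and Y: "obj Y" and G: "finitely_cocontinuous T (C_obj T Y) (C_obj T X) G"
    and x: "x \<in> ucar X"
  shows "linear Y (\<lambda>\<psi>. G \<psi> x)"
  unfolding linear_def
proof (intro conjI ballI)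
  have F: "vfunctor (C_obj T Y) (C_obj T X) G" using G by (simp add: finitely_cocontinuous_def)
  then have GC: "G \<psi> \<in> C X" if "\<psi> \<in> C Y" for \<psi> using that by (auto simp: vfunctor_def)
  show "G \<psi> x \<in> {0..1}" if "\<psi> \<in> C Y" for \<psi> by (rule C_range[OF X GC[OF that] x])
  fix p q and u v :: real
  assume p: "p \<in> C Y" and q: "q \<in> C Y" and u: "u \<in> {0..1}" and v: "v \<in> {0..1}"
  define I :: "nat vcat" where "I = \<lparr>car = {0, 1}, ar = (\<lambda>i j. if i = j then 1 else 0)\<rparr>"
  define h where "h = (\<lambda>i::nat. if i = 0 then p else q)"
  define w where "w = (\<lambda>i::nat. if i = 0 then u else v)"
  have cI: "car I = {0, 1}" by (simp add: I_def)
  have aI: "ar I i j = (if i = j then 1 else 0)" for i j by (simp add: I_def)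
  have hC: "h i \<in> C Y" and w01: "w i \<in> {0..1}" for i using p q u v by (auto simp: h_def w_def)
  have one: "ar (C_obj T Y) (h i) (h i) = 1" for i using ar_C_eq_one_iff[OF Y hC hC] by simp
  have hh: "hom (w i) (w i) = 1" for i using w01 by (simp add: hom_eq_one_iff)
  have "vcategory T I"
    unfolding vcategory_def cI aI by auto
  moreover have "vfunctor I (C_obj T Y) h"
    unfolding vfunctor_def aI using hC ar_C_range[OF Y] one by auto
  ultimately have d: "finite_weighted_diagram T I h w (C_obj T Y)"
    unfolding finite_weighted_diagram_def aI using w01 hom_range hh by (auto simp: cI)
  note d' = diagram_comp[OF d F]
  have two: "weighted_join Z {0, 1} k w = join Z u (k 0) v (k 1)"
    if Z: "obj Z" and k: "\<And>i. k i \<in> C Z" for k and Z :: "'c ucat"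
  proof
    fix z
    show "weighted_join Z {0, 1} k w z = join Z u (k 0) v (k 1) z"
    proof (cases "z \<in> ucar Z")
      case z: True
      have "T u (k 0 z) \<in> {0..1}" "T v (k 1 z) \<in> {0..1}"
        by (intro T_range u v C_range[OF Z k z])+
      then show ?thesis
        using z by (simp add: weighted_join_def join_def w_def sup01_insert)
    qed (simp add: weighted_join_def join_def)
  qed
  have "join Y u p v q = weighted_join Y (car I) h w"
    using two[OF Y hC] by (simp add: cI h_def)
  then have "is_colimit T I h w (C_obj T Y) (join Y u p v q)"
    by (simp add: is_colimit_C_iff[OF Y d])
  then have "is_colimit T I (G \<circ> h) w (C_obj T X) (G (join Y u p v q))"
    using G d by (auto simp: finitely_cocontinuous_def)
  then have "G (join Y u p v q) = weighted_join X {0, 1} (G \<circ> h) w"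
    unfolding is_colimit_C_iff[OF X d'] cI .
  also have "\<dots> = join X u (G p) v (G q)"
    using two[OF X, of "G \<circ> h"] GC hC by (simp add: h_def)
  finally show "G (join Y u p v q) x = max (T u (G p x)) (T v (G q x))"
    using x by (simp add: join_def)
qed

section \<open>The functor\<close>

lemma is_colimit_cong:
  "(\<And>i. i \<in> car I \<Longrightarrow> h i = k i) \<Longrightarrow> is_colimit T I h w A c \<longleftrightarrow> is_colimit T I k w A c"
  by (simp add: is_colimit_def cong: image_cong)

lemma diagram_in: "finite_weighted_diagram T I h w A \<Longrightarrow> i \<in> car I \<Longrightarrow> h i \<in> car A"
  by (auto simp: finite_weighted_diagram_def vfunctor_def)

text \<open>Identities and composites in \<open>FinSup\<close> are restricted to carriers, whereas
  cocontinuity is shown most directly for unrestricted functions; this passes from one to the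
  other.\<close>

lemma finitely_cocontinuous_cong:
  assumes "\<And>x. x \<in> car A \<Longrightarrow> f x = g x" "finitely_cocontinuous T A B f"
  shows "finitely_cocontinuous T A B g"
  unfolding finitely_cocontinuous_def
proof (intro conjI allI impI)
  show "vfunctor A B g"
    using assms by (auto simp: finitely_cocontinuous_def vfunctor_def Pi_iff)
  fix I h w c
  assume d: "finite_weighted_diagram T I h w A \<and> is_colimit T I h w A c"
  then have "is_colimit T I (f \<circ> h) w B (f c)" using assms(2) by (auto simp: finitely_cocontinuous_def)
  moreover have "f c = g c" using d assms(1) by (simp add: is_colimit_def)
  moreover have "is_colimit T I (f \<circ> h) w B (f c) \<longleftrightarrow> is_colimit T I (g \<circ> h) w B (f c)"
    by (rule is_colimit_cong) (use d assms(1) diagram_in in force)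
  ultimately show "is_colimit T I (g \<circ> h) w B (g c)" by simp
qed

lemma finitely_cocontinuous_comp:
  assumes f: "finitely_cocontinuous T A B f" and g: "finitely_cocontinuous T B E g"
  shows "finitely_cocontinuous T A E (g \<circ> f)"
  unfolding finitely_cocontinuous_def
proof (intro conjI allI impI)
  have vf: "vfunctor A B f" and vg: "vfunctor B E g" using f g by (auto simp: finitely_cocontinuous_def)
  then show "vfunctor A E (g \<circ> f)" by (auto simp: vfunctor_def Pi_iff) (meson order_trans)
  fix I h w c
  assume "finite_weighted_diagram T I h w A \<and> is_colimit T I h w A c"
  then have "finite_weighted_diagram T I (f \<circ> h) w B" "is_colimit T I (f \<circ> h) w B (f c)"
    using f vf diagram_comp by (auto simp: finitely_cocontinuous_def)
  then have "is_colimit T I (g \<circ> (f \<circ> h)) w E (g (f c))"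
    using g by (auto simp: finitely_cocontinuous_def)
  then show "is_colimit T I (g \<circ> f \<circ> h) w E ((g \<circ> f) c)" by (simp add: o_assoc)
qed

lemma is_category_FinSup: "is_category (FinSup T :: ('a vcat, 'a \<Rightarrow> 'a) category)"
proof -
  have id: "finitely_cocontinuous T A A (\<lambda>x\<in>car A. x)" for A :: "'a vcat"
    by (rule finitely_cocontinuous_cong[of A "\<lambda>x. x"])
      (auto simp: finitely_cocontinuous_def vfunctor_def comp_def)
  have comp: "finitely_cocontinuous T A E (compose (car A) g f)"
    if "finitely_cocontinuous T A B f" "finitely_cocontinuous T B E g" for A B E :: "'a vcat" and f g
    by (rule finitely_cocontinuous_cong[OF _ finitely_cocontinuous_comp[OF that]]) (simp add: compose_def)
  have E: "compose (car A) g f \<in> car A \<rightarrow>\<^sub>E car E"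
    if "f \<in> car A \<rightarrow>\<^sub>E car B" "g \<in> car B \<rightarrow>\<^sub>E car E" for A B E :: "'a vcat" and f g
    using that by (auto simp: compose_def PiE_iff)
  have unit: "compose (car A) f (\<lambda>x\<in>car A. x) = f" "compose (car A) (\<lambda>x\<in>car B. x) f = f"
    if "f \<in> car A \<rightarrow>\<^sub>E car B" for A B :: "'a vcat" and f
    using that by (auto simp: compose_def PiE_iff extensional_def fun_eq_iff)
  have assoc: "compose (car A) h (compose (car A) g f) = compose (car A) (compose (car B) h g) f"
    if "f \<in> car A \<rightarrow>\<^sub>E car B" for A B :: "'a vcat" and f g h :: "'a \<Rightarrow> 'a"
    using that by (auto simp: compose_def PiE_iff fun_eq_iff)
  show ?thesis
    unfolding is_category_def FinSup_def category.simps
  proof (intro conjI ballI)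
    fix A B E :: "'a vcat" and f g assume "f \<in> {f \<in> car A \<rightarrow>\<^sub>E car B. finitely_cocontinuous T A B f}"
      "g \<in> {f \<in> car B \<rightarrow>\<^sub>E car E. finitely_cocontinuous T B E f}"
    then show "compose (car A) g f \<in> {f \<in> car A \<rightarrow>\<^sub>E car E. finitely_cocontinuous T A E f}"
      using comp[of A B f E g] E[of f A B g E] by simp
  qed (use id unit assoc in auto)
qed

lemma is_category_op: "is_category K \<Longrightarrow> is_category (op_category K)"
  by (auto simp: is_category_def op_category_def)

text \<open>Distributors are determined by their action under \<open>C_mor\<close>, by
  \<open>D_eqI\<close>, and this action turns \<open>dist_comp\<close> into composition of
  functions, for which the laws are evident.\<close>

lemma is_category_RepDist: "is_category (RepDist T :: ('a ucat, 'a \<Rightarrow> 'a \<Rightarrow> real) category)"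
  unfolding is_category_def
proof (intro conjI ballI)
  let ?R = "RepDist T :: ('a ucat, 'a \<Rightarrow> 'a \<Rightarrow> real) category"
  have obj: "X \<in> Obj ?R \<longleftrightarrow> obj X" for X by (simp add: RepDist_def obj_def)
  have hom: "Hom ?R = cont_distributors T" "Ident ?R = dist_id" "Comp ?R = dist_comp T"
    by (auto simp: RepDist_def)
  fix X assume "X \<in> Obj ?R"
  then have X: "obj X" by (simp add: obj)
  then show "Ident ?R X \<in> Hom ?R X X" by (simp add: hom dist_id_in_D)
  fix Y assume "Y \<in> Obj ?R"
  then have Y: "obj Y" by (simp add: obj)
  { fix f assume "f \<in> Hom ?R X Y"
    then have f: "f \<in> D X Y" by (simp add: hom)
    show "Comp ?R X X Y (Ident ?R X) f = f" unfolding hom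
      by (rule D_eqI[OF X Y dist_comp_in_D[OF X X Y dist_id_in_D[OF X] f] f])
        (simp add: C_mor_comp[OF X X Y dist_id_in_D[OF X] f] C_mor_id[OF X] C_mor_in_C[OF X Y f])
    show "Comp ?R X Y Y f (Ident ?R Y) = f" unfolding hom
      by (rule D_eqI[OF X Y dist_comp_in_D[OF X Y Y f dist_id_in_D[OF Y]] f])
        (simp add: C_mor_comp[OF X Y Y f dist_id_in_D[OF Y]] C_mor_id[OF Y]) }
  fix Z assume "Z \<in> Obj ?R"
  then have Z: "obj Z" by (simp add: obj)
  show "Comp ?R X Y Z f g \<in> Hom ?R X Z" if "f \<in> Hom ?R X Y" "g \<in> Hom ?R Y Z" for f g
    using that dist_comp_in_D[OF X Y Z] by (simp add: hom)
  fix W assume "W \<in> Obj ?R"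
  then have W: "obj W" by (simp add: obj)
  fix f g h assume "f \<in> Hom ?R X Y" "g \<in> Hom ?R Y Z" "h \<in> Hom ?R Z W"
  then have f: "f \<in> D X Y" and g: "g \<in> D Y Z" and h: "h \<in> D Z W" by (auto simp: hom)
  note fg = dist_comp_in_D[OF X Y Z f g] and gh = dist_comp_in_D[OF Y Z W g h]
  show "Comp ?R X Z W (Comp ?R X Y Z f g) h = Comp ?R X Y W f (Comp ?R Y Z W g h)"
    unfolding hom
  proof (rule D_eqI[OF X W dist_comp_in_D[OF X Z W fg h] dist_comp_in_D[OF X Y W f gh]])
    fix \<psi> assume \<psi>: "\<psi> \<in> C W"
    show "C_mor T X W (dist_comp T X Z W (dist_comp T X Y Z f g) h) \<psi> =
      C_mor T X W (dist_comp T X Y W f (dist_comp T Y Z W g h)) \<psi>"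
      using C_mor_comp[OF X Z W fg h \<psi>] C_mor_comp[OF X Y W f gh \<psi>] C_mor_comp[OF Y Z W g h \<psi>]
        C_mor_comp[OF X Y Z f g C_mor_in_C[OF Z W h \<psi>]] by simp
  qed
qed

lemma fully_faithful_C:
  "fully_faithful_functor
     (RepDist T :: ('a ucat, 'a \<Rightarrow> 'a \<Rightarrow> real) category)
     (op_category (FinSup T :: (('a \<Rightarrow> real) vcat, ('a \<Rightarrow> real) \<Rightarrow> ('a \<Rightarrow> real)) category))
     (C_obj T) (C_mor T)"
proof -
  let ?R = "RepDist T :: ('a ucat, 'a \<Rightarrow> 'a \<Rightarrow> real) category"
  let ?F = "op_category (FinSup T :: (('a \<Rightarrow> real) vcat, ('a \<Rightarrow> real) \<Rightarrow> ('a \<Rightarrow> real)) category)"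
  have R: "X \<in> Obj ?R \<longleftrightarrow> obj X" "Hom ?R = cont_distributors T" "Ident ?R = dist_id"
      "Comp ?R = dist_comp T" for X
    by (auto simp: RepDist_def obj_def)
  have F: "Obj ?F = {A. vcategory T A \<and> vseparated A \<and> finitely_cocomplete T A}"
      "Hom ?F A B = {f \<in> car B \<rightarrow>\<^sub>E car A. finitely_cocontinuous T B A f}"
      "Ident ?F A = (\<lambda>x\<in>car A. x)" "Comp ?F A B E f g = compose (car E) f g" for A B E f g
    by (auto simp: op_category_def FinSup_def)
  have hom: "C_mor T X Y f \<in> Hom ?F (C_obj T X) (C_obj T Y)"
    if "obj X" "obj Y" "f \<in> D X Y" for X Y :: "'a ucat" and f
    using that by (auto simp: F finitely_cocontinuous_C_mor C_mor_in_C PiE_iff) (simp add: C_mor_def)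
  have "is_functor ?R ?F (C_obj T) (C_mor T)"
    unfolding is_functor_def
  proof (intro conjI ballI funcsetI)
    show "is_category ?R" by (rule is_category_RepDist)
    show "is_category ?F" by (intro is_category_op is_category_FinSup)
    show "C_obj T X \<in> Obj ?F" if "X \<in> Obj ?R" for X
      using that by (auto simp: F R vcategory_C_obj vseparated_C_obj finitely_cocomplete_C_obj)
    show "C_mor T X Y f \<in> Hom ?F (C_obj T X) (C_obj T Y)"
      if "X \<in> Obj ?R" "Y \<in> Obj ?R" "f \<in> Hom ?R X Y" for X Y f
      using that by (simp add: R hom)
    show "C_mor T X X (Ident ?R X) = Ident ?F (C_obj T X)" if "X \<in> Obj ?R" for X
      using that C_mor_id by (auto simp: R F fun_eq_iff) (auto simp: C_mor_def)
    fix X Y Z f g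
    assume "X \<in> Obj ?R" "Y \<in> Obj ?R" "Z \<in> Obj ?R" "f \<in> Hom ?R X Y" "g \<in> Hom ?R Y Z"
    then have *: "obj X" "obj Y" "obj Z" "f \<in> D X Y" "g \<in> D Y Z" by (auto simp: R)
    show "C_mor T X Z (Comp ?R X Y Z f g) =
        Comp ?F (C_obj T X) (C_obj T Y) (C_obj T Z) (C_mor T X Y f) (C_mor T Y Z g)"
      unfolding R F
    proof (rule extensionalityI[of _ "C Z"])
      show "C_mor T X Z (dist_comp T X Y Z f g) \<in> extensional (C Z)" by (simp add: C_mor_def)
      show "C_mor T X Z (dist_comp T X Y Z f g) \<psi> = compose (C Z) (C_mor T X Y f) (C_mor T Y Z g) \<psi>"
        if "\<psi> \<in> C Z" for \<psi>
        using that by (simp add: C_mor_comp[OF *] compose_def)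
    qed simp
  qed
  moreover have "bij_betw (C_mor T X Y) (Hom ?R X Y) (Hom ?F (C_obj T X) (C_obj T Y))"
    if "X \<in> Obj ?R" "Y \<in> Obj ?R" for X Y
  proof -
    have X: "obj X" and Y: "obj Y" using that by (auto simp: R)
    show ?thesis
      unfolding bij_betw_def
    proof (intro conjI equalityI subsetI)
      show "inj_on (C_mor T X Y) (Hom ?R X Y)"
        by (rule inj_onI) (auto simp: R intro: D_eqI[OF X Y])
      show "G \<in> Hom ?F (C_obj T X) (C_obj T Y)" if "G \<in> C_mor T X Y ` Hom ?R X Y" for G
        using that hom[OF X Y] by (auto simp: R)
      fix G assume "G \<in> Hom ?F (C_obj T X) (C_obj T Y)"
      then have G: "G \<in> C Y \<rightarrow>\<^sub>E C X" "finitely_cocontinuous T (C_obj T Y) (C_obj T X) G"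
        by (auto simp: F)
      \<comment> \<open>The preimage of G: at x it is the map representing the functional that sends
        \<psi> to \<open>G \<psi> x\<close>, which is linear because G is cocontinuous.\<close>
      let ?f = "\<lambda>x\<in>ucar X. repr Y (\<lambda>\<psi>. G \<psi> x)"
      have GC: "G \<psi> \<in> C X" if "\<psi> \<in> C Y" for \<psi> by (rule PiE_mem[OF G(1) that])
      note lin = linear_of_finitely_cocontinuous[OF X Y G(2)]
      have f: "?f \<in> D X Y" by (rule D_repr[OF X Y, of G]) (auto intro: GC lin)
      have "C_mor T X Y ?f = G"
      proof (rule extensionalityI[of _ "C Y"])
        show "C_mor T X Y ?f \<psi> = G \<psi>" if "\<psi> \<in> C Y" for \<psi>
          by (rule C_mor_repr[OF X Y, of G]) (auto intro: GC lin that)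
      qed (use G(1) in \<open>auto simp: C_mor_def PiE_iff\<close>)
      then show "G \<in> C_mor T X Y ` Hom ?R X Y" using imageI[OF f, of "C_mor T X Y"] by (simp add: R)
    qed
  qed
  ultimately show ?thesis by (simp add: fully_faithful_functor_def)
qed

end

theorem theorem9p10:
  fixes T :: "real \<Rightarrow> real \<Rightarrow> real"
  assumes "T = mult_tensor \<or> T = lukasiewicz_tensor"
  shows "fully_faithful_functor
           (RepDist T :: ('a ucat, 'a \<Rightarrow> 'a \<Rightarrow> real) category)
           (op_category (FinSup T :: (('a \<Rightarrow> real) vcat, ('a \<Rightarrow> real) \<Rightarrow> ('a \<Rightarrow> real)) category))
           (C_obj T) (C_mor T)"
proof -
  interpret unit_tensor T by unfold_locales (rule assms)
  show ?thesis by (rule fully_faithful_C)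
qed

end
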